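(* Let $m\ge 1$, let $(u_k)_{k\ge 0}\subset V$ be generated by NGMRES for the Navier-Stokes equations with depth $m$ (as defined in the context), and let $\alpha^{k+1}_j$ be its optimization coefficients. Assume $\kappa<1$ and $\max_{k,j}|\alpha^k_j|\le\bar\alpha$ for some constant $\bar\alpha$. For each $k\ge m$ set $$\theta_{k+1}=\frac{\|\alpha^{k+1}_{k+1}g(\tilde u_{k+1})+\alpha^{k+1}_kg(u_k)+\dots+\alpha^{k+1}_{k-m}g(u_{k-m})\|_{V'}}{\|g(u_k)\|_{V'}},$$ $$\gamma_{k+1}=\frac{\|\alpha^{k+1}_{k+1}g(\tilde u_{k+1})+\alpha^{k+1}_kg(u_k)+\dots+\alpha^{k+1}_{k-m}g(u_{k-m})\|_{V'}}{\|g(\tilde u_{k+1})\|_{V'}}.$$ Then, for $k\ge m$ (and wherever the respective denominator is nonzero), $$\|g(u_{k+1})\|_{V'}\le\theta_{k+1}\|g(u_k)\|_{V'}+\mathcal{O}\left(\|g(u_k)\|_{V'}^2+\|g(u_{k-1})\|_{V'}^2+\dots+\|g(u_{k-m})\|_{V'}^2\right),$$ $$\|g(u_{k+1})\|_{V'}\le\gamma_{k+1}\kappa\|g(u_k)\|_{V'}+\mathcal{O}\left(\|g(u_k)\|_{V'}^2+\|g(u_{k-1})\|_{V'}^2+\dots+\|g(u_{k-m})\|_{V'}^2\right),$$ where $\mathcal{O}(\cdot)$ denotes a quantity bounded by a constant times its argument, the constant depending only on $M,\nu,\kappa,\bar\alpha,m$ (in particular not on $k$).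
   Context: Let $\Omega\subset\mathbb{R}^d$ ($d=2$ or $3$) be a bounded open connected set, $\nu>0$, and $f\in H^{-1}(\Omega)$ (vector valued). $\|\cdot\|$ and $(\cdot,\cdot)$ denote the $L^2(\Omega)$ norm and inner product; $(\cdot,\cdot)$ also denotes dual pairings. Let $X=H^1_0(\Omega)^d$ and $Q=\{q\in L^2(\Omega):\int_\Omega q\,dx=0\}$, and let $V=\{v\in X:(\nabla\cdot v,q)=0\ \forall q\in Q\}$ be the divergence-free subspace, with dual $V'$. Dual norms are taken with respect to $\|\nabla\cdot\|$: $\|F\|_{V'}=\sup_{0\ne\chi\in V}(F,\chi)/\|\nabla\chi\|$ and $\|f\|_{-1}=\|f\|_{H^{-1}}=\sup_{0\ne\chi\in X}(f,\chi)/\|\nabla\chi\|$. $M$ is a constant, depending only on the size of $\Omega$, such that for all $v,w,\chi\in X$: $(v\cdot\nabla w,\chi)\le M\|\nabla v\|\|\nabla w\|\|\nabla\chi\|$ and $\|v\cdot\nabla w\|_{V'}\le M\|\nabla v\|\|\nabla w\|$. Set $\kappa:=M\nu^{-2}\|f\|_{-1}$. The Picard solution operator $q:V\to V$ for the steady Navier-Stokes equations is defined by: for $v\in V$, $q(v)\in V$ is the unique solution of $\nu(\nabla q(v),\nabla\chi)+(v\cdot\nabla q(v),\chi)=(f,\chi)$ for all $\chi\in V$. The nonlinear residual $g:V\to V'$ is defined by $(g(v),\chi)=\nu(\nabla v,\nabla\chi)+(v\cdot\nabla v,\chi)-(f,\chi)$ for all $\chi\in V$. NGMRES for the Navier-Stokes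 equations with depth $m$: start from $u_0\in V$. At step $k+1$ ($k\ge0$): (1) set $\tilde u_{k+1}=q(u_k)$; (2) choose real coefficients $(\alpha^{k+1}_{k+1},\alpha^{k+1}_k,\dots,\alpha^{k+1}_{k-m})$ minimizing $\|\alpha^{k+1}_{k+1}g(\tilde u_{k+1})+\alpha^{k+1}_kg(u_k)+\dots+\alpha^{k+1}_{k-m}g(u_{k-m})\|_{V'}$ subject to $\sum_{i=k-m}^{k+1}\alpha^{k+1}_i=1$; (3) set $u_{k+1}=\alpha^{k+1}_{k+1}\tilde u_{k+1}+\alpha^{k+1}_ku_k+\dots+\alpha^{k+1}_{k-m}u_{k-m}$. At the initial steps $k<m$, $m$ is replaced by $\min\{k,m\}=k$. *)

theory Defs
  imports "HOL-Analysis.Analysis"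
begin

text \<open>
  Functions on \<open>\<Omega>\<close> are total functions on \<open>real ^ 'n\<close>, and the dimension is \<open>CARD('n)\<close>. They represent
  their a.e. equivalence class on \<open>\<Omega>\<close>: all notions below are insensitive to changes on null sets
  and outside \<open>\<Omega>\<close>. Test functions are the exception: these are smooth on the whole space.
\<close>

section \<open>Sobolev spaces\<close>

definition partial_deriv :: "'n \<Rightarrow> (real ^ 'n::finite \<Rightarrow> real) \<Rightarrow> real ^ 'n \<Rightarrow> real" where
  "partial_deriv i f x = frechet_derivative f (at x) (axis i 1)"

primrec C_k :: "nat \<Rightarrow> (real ^ 'n::finite \<Rightarrow> real) \<Rightarrow> bool" where
  "C_k 0 f \<longleftrightarrow> continuous_on UNIV f"
| "C_k (Suc k) f \<longleftrightarrow> (\<forall>x. f differentiable (at x)) \<and> (\<forall>i. C_k k (partial_deriv i f))"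

definition test_functions :: "(real ^ 'n::finite) set \<Rightarrow> (real ^ 'n \<Rightarrow> real) set" where
  "test_functions \<Omega> = {\<phi>. (\<forall>k. C_k k \<phi>) \<and> compact (closure {x. \<phi> x \<noteq> 0}) \<and> closure {x. \<phi> x \<noteq> 0} \<subseteq> \<Omega>}"

definition L2_space :: "(real ^ 'n::finite) set \<Rightarrow> (real ^ 'n \<Rightarrow> real) set" where
  "L2_space \<Omega> = {f. f \<in> borel_measurable (lebesgue_on \<Omega>) \<and> integrable (lebesgue_on \<Omega>) (\<lambda>x. (f x)\<^sup>2)}"

definition L2_inner :: "(real ^ 'n::finite) set \<Rightarrow> (real ^ 'n \<Rightarrow> real) \<Rightarrow> (real ^ 'n \<Rightarrow> real) \<Rightarrow> real" where
  "L2_inner \<Omega> f g = (\<integral>x. f x * g x \<partial>lebesgue_on \<Omega>)"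

definition L2_norm :: "(real ^ 'n::finite) set \<Rightarrow> (real ^ 'n \<Rightarrow> real) \<Rightarrow> real" where
  "L2_norm \<Omega> f = sqrt (L2_inner \<Omega> f f)"

definition has_weak_partial ::
    "(real ^ 'n::finite) set \<Rightarrow> 'n \<Rightarrow> (real ^ 'n \<Rightarrow> real) \<Rightarrow> (real ^ 'n \<Rightarrow> real) \<Rightarrow> bool" where
  "has_weak_partial \<Omega> i u g \<longleftrightarrow> g \<in> L2_space \<Omega> \<and>
     (\<forall>\<phi>\<in>test_functions \<Omega>. L2_inner \<Omega> u (partial_deriv i \<phi>) = - L2_inner \<Omega> g \<phi>)"

definition weak_partial :: "(real ^ 'n::finite) set \<Rightarrow> 'n \<Rightarrow> (real ^ 'n \<Rightarrow> real) \<Rightarrow> real ^ 'n \<Rightarrow> real" where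
  "weak_partial \<Omega> i u = (SOME g. has_weak_partial \<Omega> i u g)"

definition H1 :: "(real ^ 'n::finite) set \<Rightarrow> (real ^ 'n \<Rightarrow> real) set" where
  "H1 \<Omega> = {u \<in> L2_space \<Omega>. \<forall>i. \<exists>g. has_weak_partial \<Omega> i u g}"

text \<open>The closure of the test functions in the norm of \<open>H1\<close>.\<close>

definition H10 :: "(real ^ 'n::finite) set \<Rightarrow> (real ^ 'n \<Rightarrow> real) set" where
  "H10 \<Omega> = {u \<in> H1 \<Omega>. \<exists>\<phi> :: nat \<Rightarrow> real ^ 'n \<Rightarrow> real. (\<forall>n. \<phi> n \<in> test_functions \<Omega>) \<and>
     (\<lambda>n. L2_norm \<Omega> (\<lambda>x. \<phi> n x - u x)) \<longlonglongrightarrow> 0 \<and>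
     (\<forall>i. (\<lambda>n. L2_norm \<Omega> (\<lambda>x. partial_deriv i (\<phi> n) x - weak_partial \<Omega> i u x)) \<longlonglongrightarrow> 0)}"

section \<open>Velocity and pressure spaces\<close>

type_synonym 'n vfield = "real ^ 'n \<Rightarrow> real ^ 'n"

definition X_space :: "(real ^ 'n::finite) set \<Rightarrow> 'n vfield set" where
  "X_space \<Omega> = {v. \<forall>j. (\<lambda>x. v x $ j) \<in> H10 \<Omega>}"

definition Q_space :: "(real ^ 'n::finite) set \<Rightarrow> (real ^ 'n \<Rightarrow> real) set" where
  "Q_space \<Omega> = {q \<in> L2_space \<Omega>. (\<integral>x. q x \<partial>lebesgue_on \<Omega>) = 0}"

definition weak_div :: "(real ^ 'n::finite) set \<Rightarrow> 'n vfield \<Rightarrow> real ^ 'n \<Rightarrow> real" where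
  "weak_div \<Omega> v x = (\<Sum>i\<in>UNIV. weak_partial \<Omega> i (\<lambda>y. v y $ i) x)"

definition V_space :: "(real ^ 'n::finite) set \<Rightarrow> 'n vfield set" where
  "V_space \<Omega> = {v \<in> X_space \<Omega>. \<forall>q\<in>Q_space \<Omega>. L2_inner \<Omega> (weak_div \<Omega> v) q = 0}"

definition grad_inner :: "(real ^ 'n::finite) set \<Rightarrow> 'n vfield \<Rightarrow> 'n vfield \<Rightarrow> real" where
  "grad_inner \<Omega> v w = (\<Sum>i\<in>UNIV. \<Sum>j\<in>UNIV.
     L2_inner \<Omega> (weak_partial \<Omega> i (\<lambda>x. v x $ j)) (weak_partial \<Omega> i (\<lambda>x. w x $ j)))"

definition grad_norm :: "(real ^ 'n::finite) set \<Rightarrow> 'n vfield \<Rightarrow> real" where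
  "grad_norm \<Omega> v = sqrt (grad_inner \<Omega> v v)"

text \<open>The vector field \<open>v \<cdot> \<nabla>w\<close> and its pairing with \<open>z\<close>.\<close>

definition convect :: "(real ^ 'n::finite) set \<Rightarrow> 'n vfield \<Rightarrow> 'n vfield \<Rightarrow> 'n vfield" where
  "convect \<Omega> v w x = (\<chi> j. \<Sum>i\<in>UNIV. v x $ i * weak_partial \<Omega> i (\<lambda>y. w y $ j) x)"

definition convection_form ::
    "(real ^ 'n::finite) set \<Rightarrow> 'n vfield \<Rightarrow> 'n vfield \<Rightarrow> 'n vfield \<Rightarrow> real" where
  "convection_form \<Omega> v w z = (\<integral>x. convect \<Omega> v w x \<bullet> z x \<partial>lebesgue_on \<Omega>)"

section \<open>Dual spaces\<close>

text \<open>
  Functionals on a subspace \<open>W\<close> of \<open>X_space \<Omega>\<close>; their values outside \<open>W\<close> are irrelevant.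
\<close>

definition dual_norm :: "(real ^ 'n::finite) set \<Rightarrow> 'n vfield set \<Rightarrow> ('n vfield \<Rightarrow> real) \<Rightarrow> real" where
  "dual_norm \<Omega> W F = Sup {F z / grad_norm \<Omega> z | z. z \<in> W \<and> \<not> (AE x in lebesgue_on \<Omega>. z x = 0)}"

abbreviation Vdual_norm :: "(real ^ 'n::finite) set \<Rightarrow> ('n vfield \<Rightarrow> real) \<Rightarrow> real" where
  "Vdual_norm \<Omega> \<equiv> dual_norm \<Omega> (V_space \<Omega>)"

abbreviation Hm1_norm :: "(real ^ 'n::finite) set \<Rightarrow> ('n vfield \<Rightarrow> real) \<Rightarrow> real" where
  "Hm1_norm \<Omega> \<equiv> dual_norm \<Omega> (X_space \<Omega>)"

text \<open>
  Boundedness with respect to \<open>grad_norm\<close> forces a functional to agree on fields that are equal a.e.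
\<close>

definition Hm1 :: "(real ^ 'n::finite) set \<Rightarrow> ('n vfield \<Rightarrow> real) set" where
  "Hm1 \<Omega> = {f.
     (\<forall>v\<in>X_space \<Omega>. \<forall>w\<in>X_space \<Omega>. \<forall>a b. f (\<lambda>x. a *\<^sub>R v x + b *\<^sub>R w x) = a * f v + b * f w) \<and>
     (\<exists>K. \<forall>v\<in>X_space \<Omega>. \<bar>f v\<bar> \<le> K * grad_norm \<Omega> v)}"

section \<open>Navier-Stokes equations\<close>

definition convection_constant :: "(real ^ 'n::finite) set \<Rightarrow> real \<Rightarrow> bool" where
  "convection_constant \<Omega> M \<longleftrightarrow>
     (\<forall>v\<in>X_space \<Omega>. \<forall>w\<in>X_space \<Omega>. \<forall>z\<in>X_space \<Omega>.
        convection_form \<Omega> v w z \<le> M * grad_norm \<Omega> v * grad_norm \<Omega> w * grad_norm \<Omega> z) \<and>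
     (\<forall>v\<in>X_space \<Omega>. \<forall>w\<in>X_space \<Omega>.
        Vdual_norm \<Omega> (convection_form \<Omega> v w) \<le> M * grad_norm \<Omega> v * grad_norm \<Omega> w)"

text \<open>\<open>is_picard \<Omega> \<nu> f v w\<close> means \<open>w = q(v)\<close>; solutions are unique up to equality a.e. in \<open>\<Omega>\<close>.\<close>

definition is_picard ::
    "(real ^ 'n::finite) set \<Rightarrow> real \<Rightarrow> ('n vfield \<Rightarrow> real) \<Rightarrow> 'n vfield \<Rightarrow> 'n vfield \<Rightarrow> bool" where
  "is_picard \<Omega> \<nu> f v w \<longleftrightarrow> w \<in> V_space \<Omega> \<and>
     (\<forall>z\<in>V_space \<Omega>. \<nu> * grad_inner \<Omega> w z + convection_form \<Omega> v w z = f z)"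

definition residual ::
    "(real ^ 'n::finite) set \<Rightarrow> real \<Rightarrow> ('n vfield \<Rightarrow> real) \<Rightarrow> 'n vfield \<Rightarrow> 'n vfield \<Rightarrow> real" where
  "residual \<Omega> \<nu> f v = (\<lambda>z. \<nu> * grad_inner \<Omega> v z + convection_form \<Omega> v v z - f z)"

section \<open>NGMRES\<close>

text \<open>
  Step \<open>k + 1\<close> uses the Picard step \<open>ut (k + 1) = q(u k)\<close> and the iterates
  \<open>u k, \<dots>, u (k - min m k)\<close>. The coefficient with index \<open>k + 1\<close> belongs to \<open>ut (k + 1)\<close>,
  that with index \<open>i \<le> k\<close> to \<open>u i\<close>.
\<close>

definition combined_residual ::
    "(real ^ 'n::finite) set \<Rightarrow> real \<Rightarrow> ('n vfield \<Rightarrow> real) \<Rightarrow> nat \<Rightarrow>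
     (nat \<Rightarrow> 'n vfield) \<Rightarrow> (nat \<Rightarrow> 'n vfield) \<Rightarrow> nat \<Rightarrow> (nat \<Rightarrow> real) \<Rightarrow> 'n vfield \<Rightarrow> real" where
  "combined_residual \<Omega> \<nu> f m u ut k a = (\<lambda>z.
     a (Suc k) * residual \<Omega> \<nu> f (ut (Suc k)) z + (\<Sum>i = k - min m k..k. a i * residual \<Omega> \<nu> f (u i) z))"

definition NGMRES ::
    "(real ^ 'n::finite) set \<Rightarrow> real \<Rightarrow> ('n vfield \<Rightarrow> real) \<Rightarrow> nat \<Rightarrow>
     (nat \<Rightarrow> 'n vfield) \<Rightarrow> (nat \<Rightarrow> 'n vfield) \<Rightarrow> (nat \<Rightarrow> nat \<Rightarrow> real) \<Rightarrow> bool" where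
  "NGMRES \<Omega> \<nu> f m u ut \<alpha> \<longleftrightarrow> u 0 \<in> V_space \<Omega> \<and>
     (\<forall>k. is_picard \<Omega> \<nu> f (u k) (ut (Suc k)) \<and>
        (\<Sum>i = k - min m k..Suc k. \<alpha> (Suc k) i) = 1 \<and>
        (\<forall>\<beta>. (\<Sum>i = k - min m k..Suc k. \<beta> i) = 1 \<longrightarrow>
           Vdual_norm \<Omega> (combined_residual \<Omega> \<nu> f m u ut k (\<alpha> (Suc k)))
             \<le> Vdual_norm \<Omega> (combined_residual \<Omega> \<nu> f m u ut k \<beta>)) \<and>
        (AE x in lebesgue_on \<Omega>. u (Suc k) x =
           \<alpha> (Suc k) (Suc k) *\<^sub>R ut (Suc k) x + (\<Sum>i = k - min m k..k. \<alpha> (Suc k) i *\<^sub>R u i x)))"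

end

theory Submission
  imports Defs
begin

text \<open>
  Write \<open>b(v,w,z)\<close> for the pairing of \<open>v \<cdot> \<nabla>w\<close> with \<open>z\<close>, and \<open>q(v)\<close> for the Picard image of \<open>v\<close>. The residual
  \<open>g\<close> is affine except for the term \<open>b(v,v,\<cdot>)\<close>. Hence the residual of an affine combination
  \<open>u = \<Sum> a\<^sub>i w\<^sub>i\<close> with \<open>\<Sum> a\<^sub>i = 1\<close> differs from the combination of the residuals only by a variance,
  
  \<open>g(u) = \<Sum> a\<^sub>i g(w\<^sub>i) - \<Sum> a\<^sub>i b(w\<^sub>i - u, w\<^sub>i - u, \<cdot>)\<close>
  
  (\<open>residual_affine_combination\<close>). In an NGMRES step the first sum is the quantity that is
  minimized; its norm is \<open>\<theta> \<parallel>g(u\<^sub>k)\<parallel>\<close> and also \<open>\<gamma> \<parallel>g(q(u\<^sub>k))\<parallel>\<close>. The second sum is quadratic in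
  the distances between the fields entering the step, and these are bounded by residuals:
  
  \<^item> The form \<open>b(v,\<cdot>,\<cdot>)\<close> is skew-symmetric for divergence-free \<open>v\<close>. Testing with \<open>v - q(v)\<close> gives
  \<open>\<parallel>\<nabla>(v - q(v))\<parallel> \<le> \<parallel>g(v)\<parallel> / \<nu>\<close> (\<open>picard_increment\<close>), and testing the difference of two Picard
  equations shows that \<open>q\<close> contracts with factor \<open>\<kappa>\<close> (\<open>picard_contraction\<close>).
  \<^item> Going from \<open>v\<close> to \<open>v'\<close> through \<open>q(v)\<close> and \<open>q(v')\<close> then yields
  \<open>\<nu> (1 - \<kappa>) \<parallel>\<nabla>(v - v')\<parallel> \<le> \<parallel>g(v)\<parallel> + \<parallel>g(v')\<parallel>\<close> (\<open>distance_residual\<close>).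
  \<^item> Since \<open>g(q(v)) = b(q(v) - v, q(v), \<cdot>)\<close>, also \<open>\<parallel>g(q(v))\<parallel> \<le> \<kappa> \<parallel>g(v)\<parallel>\<close> (\<open>residual_picard\<close>), which turns
  \<open>\<gamma> \<parallel>g(q(u\<^sub>k))\<parallel>\<close> into \<open>\<gamma> \<kappa> \<parallel>g(u\<^sub>k)\<parallel>\<close> in the second estimate.
  
  This argument is abstract; it takes place in the locale \<open>picard_setting\<close>. The analysis consists in
  showing that the concrete spaces satisfy its hypotheses. Weak derivatives are chosen by a choice
  operator, so linearity of everything built from them rests on their uniqueness almost everywhere,
  that is, on the fundamental lemma of the calculus of variations (\<open>orthogonal_to_test_functions\<close>).
  Linearity of \<open>b\<close> in each argument requires the defining integral to converge, which is the
  embedding of \<open>H10\<close> into the fourth-power integrable functions, valid in dimension two and three; it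
  follows from the Ladyzhenskaya inequality (\<open>ladyzhenskaya\<close>). Skew-symmetry holds for smooth second
  and third argument by integration by parts, and in general by density (\<open>convection_form_skew\<close>).
  Finally the suprema defining the dual norms need a nonempty index set, provided by an explicit
  divergence-free field (\<open>divergence_free_field\<close>).
\<close>

section \<open>Smooth functions and test functions\<close>

lemma partial_deriv_eq:
  "(f has_derivative f') (at x) \<Longrightarrow> partial_deriv i f x = f' (axis i 1)"
  unfolding partial_deriv_def by (metis frechet_derivative_at)

lemma C_k_SucI:
  assumes "\<And>x. (f has_derivative f' x) (at x)" "\<And>i. C_k k (\<lambda>x. f' x (axis i 1))"
  shows "C_k (Suc k) f"
proof -
  have "partial_deriv i f = (\<lambda>x. f' x (axis i 1))" for i
    using partial_deriv_eq[OF assms(1)] by auto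
  then show ?thesis using assms by (auto simp: differentiable_def)
qed

lemma C_k_has_derivative:
  "C_k (Suc k) f \<Longrightarrow> (f has_derivative frechet_derivative f (at x)) (at x)"
  by (simp add: frechet_derivative_works)

lemma C_k_Suc_imp: "C_k (Suc k) f \<Longrightarrow> C_k k f"
proof (induction k arbitrary: f)
  case 0
  then show ?case
    by (auto intro!: continuous_at_imp_continuous_on differentiable_imp_continuous_within)
next
  case (Suc k)
  then show ?case by (metis C_k.simps(2))
qed

lemma C_k_const: "C_k k (\<lambda>_. c)"
proof (induction k arbitrary: c)
  case (Suc k)
  show ?case by (rule C_k_SucI[where f' = "\<lambda>_ _. 0"]) (auto simp: Suc)
qed auto

lemma C_k_lincomb:
  "C_k k f \<Longrightarrow> C_k k g \<Longrightarrow> C_k k (\<lambda>x. a * f x + b * g x)"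
proof (induction k arbitrary: f g)
  case 0
  then show ?case by (auto intro!: continuous_intros)
next
  case (Suc k)
  show ?case
  proof (rule C_k_SucI)
    show "((\<lambda>x. a * f x + b * g x) has_derivative
      (\<lambda>h. a * frechet_derivative f (at x) h + b * frechet_derivative g (at x) h)) (at x)" for x
      by (intro derivative_intros C_k_has_derivative[OF Suc.prems(1)] C_k_has_derivative[OF Suc.prems(2)])
    show "C_k k (\<lambda>x. a * frechet_derivative f (at x) (axis i 1) + b * frechet_derivative g (at x) (axis i 1))" for i
      using Suc.IH[of "partial_deriv i f" "partial_deriv i g"] Suc.prems
      by (simp add: partial_deriv_def[abs_def])
  qed
qed

lemma C_k_mult: "C_k k f \<Longrightarrow> C_k k g \<Longrightarrow> C_k k (\<lambda>x. f x * g x)"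
proof (induction k arbitrary: f g)
  case 0
  then show ?case by (auto intro!: continuous_intros)
next
  case (Suc k)
  show ?case
  proof (rule C_k_SucI)
    show "((\<lambda>x. f x * g x) has_derivative
      (\<lambda>h. f x * frechet_derivative g (at x) h + frechet_derivative f (at x) h * g x)) (at x)" for x
      by (intro has_derivative_mult C_k_has_derivative[OF Suc.prems(1)] C_k_has_derivative[OF Suc.prems(2)])
    show "C_k k (\<lambda>x. f x * frechet_derivative g (at x) (axis i 1) + frechet_derivative f (at x) (axis i 1) * g x)" for i
      using C_k_lincomb[OF Suc.IH[of f "partial_deriv i g"] Suc.IH[of "partial_deriv i f" g], of 1 1]
        Suc.prems C_k_Suc_imp[OF Suc.prems(1)] C_k_Suc_imp[OF Suc.prems(2)]
      by (simp add: partial_deriv_def[abs_def])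
  qed
qed

lemma C_k_component: "C_k k (\<lambda>x. x $ i)"
proof (cases k)
  case (Suc l)
  show ?thesis unfolding Suc
    by (rule C_k_SucI[where f' = "\<lambda>_ h. h $ i"])
      (auto intro!: bounded_linear_imp_has_derivative bounded_linear_vec_nth C_k_const)
qed (auto intro!: continuous_intros)

lemma C_k_affine_component: "C_k k (\<lambda>x. a * x $ i + b)"
  using C_k_lincomb[OF C_k_component C_k_const, where b = 1] by simp

lemma C_k_sum: "(\<And>i. i \<in> I \<Longrightarrow> C_k k (f i)) \<Longrightarrow> C_k k (\<lambda>x. \<Sum>i\<in>I. f i x)"
proof (induction I rule: infinite_finite_induct)
  case (insert i I)
  then show ?case using C_k_lincomb[of k "f i" "\<lambda>x. \<Sum>i\<in>I. f i x" 1 1] by simp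
qed (auto simp: C_k_const)

lemma C_k_prod: "(\<And>i. i \<in> I \<Longrightarrow> C_k k (f i)) \<Longrightarrow> C_k k (\<lambda>x. \<Prod>i\<in>I. f i x)"
proof (induction I rule: infinite_finite_induct)
  case (insert i I)
  then show ?case using C_k_mult[of k "f i" "\<lambda>x. \<Prod>i\<in>I. f i x"] by simp
qed (auto simp: C_k_const)

text \<open>
  The powers of \<open>t\<close> in the denominator make the family closed under differentiation, so that the
  smoothness of every member follows by one induction over the order.
\<close>

definition flat_exp :: "nat \<Rightarrow> real \<Rightarrow> real" where
  "flat_exp j t = (if t > 0 then exp (- 1 / t) / t ^ j else 0)"

lemma flat_exp_deriv:
  "(flat_exp j has_real_derivative (flat_exp (j + 2) t - real j * flat_exp (j + 1) t)) (at t)"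
proof -
  consider "t > 0" | "t < 0" | "t = 0" by linarith
  then show ?thesis
  proof cases
    case 1
    have "((\<lambda>t. exp (- 1 / t) / t ^ j) has_real_derivative
        (flat_exp (j + 2) t - real j * flat_exp (j + 1) t)) (at t)"
      using 1
      by (cases j; auto intro!: derivative_eq_intros
          simp: flat_exp_def field_simps power2_eq_square power_add)
        (metis Suc_pred One_nat_def neq0_conv power_Suc)
    then show ?thesis
      by (rule has_field_derivative_transform_within_open[where S = "{0<..}"])
        (use 1 in \<open>auto simp: flat_exp_def\<close>)
  next
    case 2
    have "((\<lambda>t. 0) has_real_derivative (flat_exp (j + 2) t - real j * flat_exp (j + 1) t)) (at t)"
      using 2 by (simp add: flat_exp_def)
    then show ?thesis
      by (rule has_field_derivative_transform_within_open[where S = "{..<0}"])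
        (use 2 in \<open>auto simp: flat_exp_def\<close>)
  next
    case 3
    \<comment> \<open>At \<open>0\<close> from the right, the difference quotient is \<open>s ^ (j + 1) / exp s\<close> with \<open>s = 1 / y\<close>.\<close>
    have "filterlim (\<lambda>y. inverse y :: real) at_top (at_right 0)"
      by (rule filterlim_inverse_at_top_right)
    then have "((\<lambda>y::real. inverse y ^ (Suc j) / exp (inverse y)) \<longlongrightarrow> 0) (at_right 0)"
      by (rule filterlim_compose[OF tendsto_power_div_exp_0])
    then have "((\<lambda>y. (flat_exp j y - flat_exp j 0) / (y - 0)) \<longlongrightarrow> 0) (at_right 0)"
      by (rule Lim_transform_eventually)
        (auto simp: eventually_at_filter flat_exp_def field_simps exp_minus)
    moreover have "((\<lambda>y. (flat_exp j y - flat_exp j 0) / (y - 0)) \<longlongrightarrow> 0) (at_left 0)"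
      by (rule Lim_transform_eventually[OF tendsto_const])
        (auto simp: eventually_at_filter flat_exp_def)
    ultimately show ?thesis
      unfolding 3 has_field_derivative_iff by (simp add: filterlim_split_at flat_exp_def)
  qed
qed

text \<open>
  The derivative of \<open>flat_exp j \<circ> q\<close> is a combination of \<open>flat_exp (j + 1) \<circ> q\<close> and
  \<open>flat_exp (j + 2) \<circ> q\<close> times a derivative of \<open>q\<close>; the induction is over \<open>k\<close> for all \<open>j\<close> at once.
\<close>

lemma C_k_flat_exp_compose:
  assumes "\<And>k. C_k k q"
  shows "C_k k (\<lambda>x. flat_exp j (q x))"
proof (induction k arbitrary: j)
  case 0
  have "continuous_on UNIV (flat_exp j)"
    using flat_exp_deriv by (auto intro!: continuous_at_imp_continuous_on DERIV_isCont)
  moreover have "continuous_on UNIV q" using assms[of 0] by simp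
  ultimately show ?case
    using continuous_on_compose2[of UNIV "flat_exp j" UNIV q] by simp
next
  case (Suc k)
  show ?case
  proof (rule C_k_SucI)
    show "((\<lambda>x. flat_exp j (q x)) has_derivative (\<lambda>h. (flat_exp (j + 2) (q x) - real j * flat_exp (j + 1) (q x))
        * frechet_derivative q (at x) h)) (at x)" for x
      using has_derivative_compose[OF C_k_has_derivative[OF assms[of "Suc 0"], of x]
          flat_exp_deriv[unfolded has_field_derivative_def, of j]]
      by simp
    show "C_k k (\<lambda>x. (flat_exp (j + 2) (q x) - real j * flat_exp (j + 1) (q x))
        * frechet_derivative q (at x) (axis i 1))" for i
    proof -
      have "C_k k (partial_deriv i q)" using assms[of "Suc k"] by simp
      from C_k_mult[OF C_k_lincomb[OF Suc.IH Suc.IH, of 1 "j+2" "- real j" "j+1"] this]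
      show ?thesis by (simp add: partial_deriv_def[abs_def])
    qed
  qed
qed

lemma test_functionI:
  assumes "\<And>k. C_k k \<phi>" "compact K" "K \<subseteq> \<Omega>" "\<And>x. x \<notin> K \<Longrightarrow> \<phi> x = 0"
  shows "\<phi> \<in> test_functions \<Omega>"
proof -
  have "closure {x. \<phi> x \<noteq> 0} \<subseteq> K"
    by (rule closure_minimal) (use assms compact_imp_closed in auto)
  moreover from this have "bounded {x. \<phi> x \<noteq> 0}"
    using assms(2) by (meson bounded_subset closure_subset compact_imp_bounded)
  ultimately show ?thesis
    using assms unfolding test_functions_def by auto
qed

lemma test_functionE:
  assumes "\<phi> \<in> test_functions \<Omega>"
  obtains K where "compact K" "K \<subseteq> \<Omega>" "\<And>x. x \<notin> K \<Longrightarrow> \<phi> x = 0"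
proof (rule that)
  show "\<phi> x = 0" if "x \<notin> closure {x. \<phi> x \<noteq> 0}" for x
    using that closure_subset[of "{x. \<phi> x \<noteq> 0}"] by auto
qed (use assms in \<open>auto simp: test_functions_def\<close>)

lemma test_function_smooth: "\<phi> \<in> test_functions \<Omega> \<Longrightarrow> C_k k \<phi>"
  by (auto simp: test_functions_def)

lemma test_function_has_derivative:
  "\<phi> \<in> test_functions \<Omega> \<Longrightarrow> (\<phi> has_derivative frechet_derivative \<phi> (at x)) (at x)"
  using C_k_has_derivative test_function_smooth by blast

lemma test_function_continuous: "\<phi> \<in> test_functions \<Omega> \<Longrightarrow> continuous_on UNIV \<phi>"
  using test_function_smooth[of \<phi> \<Omega> 0] by simp

lemma test_function_partial:
  assumes "\<phi> \<in> test_functions \<Omega>"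
  shows "partial_deriv i \<phi> \<in> test_functions \<Omega>"
proof -
  obtain K where K: "compact K" "K \<subseteq> \<Omega>" "\<And>x. x \<notin> K \<Longrightarrow> \<phi> x = 0"
    using assms by (rule test_functionE) auto
  show ?thesis
  proof (rule test_functionI[OF _ K(1,2)])
    show "C_k k (partial_deriv i \<phi>)" for k
      using test_function_smooth[OF assms, of "Suc k"] by simp
    show "partial_deriv i \<phi> x = 0" if "x \<notin> K" for x
    proof -
      have "((\<lambda>_. 0) has_derivative (\<lambda>_. 0)) (at x)" by simp
      then have "(\<phi> has_derivative (\<lambda>_. 0)) (at x)"
        by (rule has_derivative_transform_within_open[where s = "- K"])
          (use that K in \<open>auto simp: compact_imp_closed open_Compl\<close>)
      then show ?thesis by (simp add: partial_deriv_eq)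
    qed
  qed
qed

lemma test_function_mult_smooth:
  assumes "\<phi> \<in> test_functions \<Omega>" "\<And>k. C_k k f"
  shows "(\<lambda>x. f x * \<phi> x) \<in> test_functions \<Omega>"
proof -
  obtain K where K: "compact K" "K \<subseteq> \<Omega>" "\<And>x. x \<notin> K \<Longrightarrow> \<phi> x = 0"
    using assms(1) by (rule test_functionE) auto
  show ?thesis
    by (rule test_functionI[OF _ K(1,2)]) (auto intro!: C_k_mult assms test_function_smooth[OF assms(1)] simp: K(3))
qed

lemma test_function_lincomb:
  assumes "\<phi> \<in> test_functions \<Omega>" "\<psi> \<in> test_functions \<Omega>"
  shows "(\<lambda>x. a * \<phi> x + b * \<psi> x) \<in> test_functions \<Omega>"
proof -
  obtain K where K: "compact K" "K \<subseteq> \<Omega>" "\<And>x. x \<notin> K \<Longrightarrow> \<phi> x = 0"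
    using assms(1) by (rule test_functionE) auto
  obtain L where L: "compact L" "L \<subseteq> \<Omega>" "\<And>x. x \<notin> L \<Longrightarrow> \<psi> x = 0"
    using assms(2) by (rule test_functionE) auto
  show ?thesis
    by (rule test_functionI[of _ "K \<union> L"])
      (use K L in \<open>auto intro!: C_k_lincomb test_function_smooth[OF assms(1)] test_function_smooth[OF assms(2)]\<close>)
qed

lemma partial_deriv_lincomb:
  assumes "\<phi> \<in> test_functions \<Omega>" "\<psi> \<in> test_functions \<Omega>"
  shows "partial_deriv i (\<lambda>x. a * \<phi> x + b * \<psi> x) x = a * partial_deriv i \<phi> x + b * partial_deriv i \<psi> x"
proof -
  have "((\<lambda>x. a * \<phi> x + b * \<psi> x) has_derivative
      (\<lambda>h. a * frechet_derivative \<phi> (at x) h + b * frechet_derivative \<psi> (at x) h)) (at x)"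
    by (intro derivative_intros test_function_has_derivative[OF assms(1)] test_function_has_derivative[OF assms(2)])
  then show ?thesis by (simp add: partial_deriv_eq) (simp add: partial_deriv_def)
qed

lemma partial_deriv_mult:
  assumes "\<phi> \<in> test_functions \<Omega>" "\<psi> \<in> test_functions \<Omega>"
  shows "partial_deriv i (\<lambda>x. \<phi> x * \<psi> x) x = \<phi> x * partial_deriv i \<psi> x + partial_deriv i \<phi> x * \<psi> x"
proof -
  have "((\<lambda>x. \<phi> x * \<psi> x) has_derivative
      (\<lambda>h. \<phi> x * frechet_derivative \<psi> (at x) h + frechet_derivative \<phi> (at x) h * \<psi> x)) (at x)"
    by (intro has_derivative_mult test_function_has_derivative[OF assms(1)] test_function_has_derivative[OF assms(2)])
  then show ?thesis by (simp add: partial_deriv_eq) (simp add: partial_deriv_def)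
qed

lemma test_function_mult:
  "\<phi> \<in> test_functions \<Omega> \<Longrightarrow> \<psi> \<in> test_functions \<Omega> \<Longrightarrow> (\<lambda>x. \<phi> x * \<psi> x) \<in> test_functions \<Omega>"
  by (rule test_function_mult_smooth) (auto intro: test_function_smooth)

lemma test_function_line_derivative:
  assumes "\<phi> \<in> test_functions \<Omega>"
  shows "((\<lambda>t. \<phi> (x + t *\<^sub>R axis i 1)) has_real_derivative partial_deriv i \<phi> (x + t *\<^sub>R axis i 1)) (at t)"
proof -
  have "((\<lambda>t. x + t *\<^sub>R axis i 1) has_derivative (\<lambda>h. h *\<^sub>R axis i 1)) (at t)"
    by (auto intro!: derivative_eq_intros)
  from has_derivative_compose[OF this test_function_has_derivative[OF assms]]
  show ?thesis
    using linear_cmul[OF has_derivative_linear[OF test_function_has_derivative[OF assms]]]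
    by (simp add: has_field_derivative_def partial_deriv_def mult_commute_abs)
qed

section \<open>Semi-inner products on spaces of functions\<close>

text \<open>
  Functions and fields are total and represent their classes modulo null sets, so linear structure
  lives on a set of functions, and a form is only semidefinite on it. The \<open>L2\<close> inner product and the
  inner product of gradients are both of this kind.
\<close>

locale function_subspace =
  fixes S :: "('b \<Rightarrow> 'c::real_vector) set"
  assumes zero_closed: "(\<lambda>_. 0) \<in> S"
    and lincomb_closed: "v \<in> S \<Longrightarrow> w \<in> S \<Longrightarrow> (\<lambda>x. a *\<^sub>R v x + b *\<^sub>R w x) \<in> S"
begin

lemma diff_closed: "v \<in> S \<Longrightarrow> w \<in> S \<Longrightarrow> (\<lambda>x. v x - w x) \<in> S"
  using lincomb_closed[of v w 1 "-1"] by simp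

lemma uminus_closed: "v \<in> S \<Longrightarrow> (\<lambda>x. - v x) \<in> S"
  using lincomb_closed[of v v "-1" 0] by simp

lemma sum_closed: "(\<And>i. i \<in> I \<Longrightarrow> w i \<in> S) \<Longrightarrow> (\<lambda>x. \<Sum>i\<in>I. a i *\<^sub>R w i x) \<in> S"
proof (induction I rule: infinite_finite_induct)
  case (insert i I)
  then show ?case using lincomb_closed[of "w i" "\<lambda>x. \<Sum>i\<in>I. a i *\<^sub>R w i x" "a i" 1] by simp
qed (auto simp: zero_closed)

lemma linear_sum:
  assumes "\<And>v w a b. v \<in> S \<Longrightarrow> w \<in> S \<Longrightarrow> L (\<lambda>x. a *\<^sub>R v x + b *\<^sub>R w x) = a * L v + b * (L w :: real)"
    and "\<And>i. i \<in> I \<Longrightarrow> w i \<in> S"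
  shows "L (\<lambda>x. \<Sum>i\<in>I. a i *\<^sub>R w i x) = (\<Sum>i\<in>I. a i * L (w i))"
proof -
  have 0: "L (\<lambda>_. 0) = 0" using assms(1)[OF zero_closed zero_closed, of 0 0] by simp
  show ?thesis
    using assms(2)
  proof (induction I rule: infinite_finite_induct)
    case (insert i I)
    then show ?case
      using assms(1)[of "w i" "\<lambda>x. \<Sum>i\<in>I. a i *\<^sub>R w i x" "a i" 1] sum_closed[of I w a] by simp
  qed (auto simp: 0)
qed

end

locale semi_inner_space = function_subspace S
  for S :: "('b \<Rightarrow> 'c::real_vector) set" +
  fixes B :: "('b \<Rightarrow> 'c) \<Rightarrow> ('b \<Rightarrow> 'c) \<Rightarrow> real"
  assumes form_sym: "v \<in> S \<Longrightarrow> w \<in> S \<Longrightarrow> B v w = B w v"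
    and form_lincomb: "u \<in> S \<Longrightarrow> v \<in> S \<Longrightarrow> w \<in> S \<Longrightarrow>
          B (\<lambda>x. a *\<^sub>R u x + b *\<^sub>R v x) w = a * B u w + b * B v w"
    and form_nonneg: "v \<in> S \<Longrightarrow> B v v \<ge> 0"
begin

definition nrm :: "('b \<Rightarrow> 'c) \<Rightarrow> real" where "nrm v = sqrt (B v v)"

lemma nrm_nonneg: "v \<in> S \<Longrightarrow> nrm v \<ge> 0"
  by (simp add: nrm_def form_nonneg)

lemma nrm_square: "v \<in> S \<Longrightarrow> (nrm v)\<^sup>2 = B v v"
  by (simp add: nrm_def form_nonneg)

lemma form_lincomb_right: "u \<in> S \<Longrightarrow> v \<in> S \<Longrightarrow> w \<in> S \<Longrightarrow>
    B w (\<lambda>x. a *\<^sub>R u x + b *\<^sub>R v x) = a * B w u + b * B w v"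
  using form_lincomb[of u v w a b] form_sym[of w] lincomb_closed by simp

lemma form_lincomb_self: 
  assumes "v \<in> S" "w \<in> S"
  shows "B (\<lambda>x. a *\<^sub>R v x + b *\<^sub>R w x) (\<lambda>x. a *\<^sub>R v x + b *\<^sub>R w x) =
      a\<^sup>2 * B v v + 2 * a * b * B v w + b\<^sup>2 * B w w"
  using assms form_sym[of w v] lincomb_closed[OF assms, of a b]
  by (simp add: form_lincomb form_lincomb_right power2_eq_square algebra_simps)

lemma Cauchy_Schwarz:
  assumes v: "v \<in> S" and w: "w \<in> S"
  shows "\<bar>B v w\<bar> \<le> nrm v * nrm w"
proof -
  have q: "0 \<le> a\<^sup>2 * B v v + 2 * a * b * B v w + b\<^sup>2 * B w w" for a b
    using form_nonneg[OF lincomb_closed[OF v w, of a b]] form_lincomb_self[OF v w] by simp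
  have "(B v w)\<^sup>2 \<le> B v v * B w w"
  proof (cases "B w w = 0")
    case True
    have "B v w = 0"
    \<comment> \<open>A nonzero value would make the affine function \<open>b \<mapsto> B v v + 2 b B v w\<close> negative somewhere.\<close>
    proof (rule ccontr)
      assume ne: "B v w \<noteq> 0"
      have "0 \<le> B v v + 2 * b * B v w" for b using q[of 1 b] True by simp
      from this[of "- (B v v + 1) / (2 * B v w)"] show False
        using ne by (simp add: field_simps)
    qed
    then show ?thesis using True by simp
  next
    case False
    then have pos: "B w w > 0" using form_nonneg[OF w] by simp
    have "0 \<le> B w w * (B v v * B w w - (B v w)\<^sup>2)"
      using q[of "B w w" "- B v w"] by (simp add: power2_eq_square algebra_simps)
    then show ?thesis using pos by (simp add: zero_le_mult_iff)
  qed
  then have "sqrt ((B v w)\<^sup>2) \<le> sqrt (B v v * B w w)" by (rule real_sqrt_le_mono)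
  then show ?thesis by (simp add: nrm_def real_sqrt_mult)
qed

lemma nrm_lincomb:
  assumes v: "v \<in> S" and w: "w \<in> S"
  shows "nrm (\<lambda>x. a *\<^sub>R v x + b *\<^sub>R w x) \<le> \<bar>a\<bar> * nrm v + \<bar>b\<bar> * nrm w"
proof (rule power2_le_imp_le)
  have "a * b * B v w \<le> \<bar>a\<bar> * \<bar>b\<bar> * \<bar>B v w\<bar>"
    using abs_ge_self[of "a * b * B v w"] by (simp add: abs_mult)
  also have "\<dots> \<le> \<bar>a\<bar> * \<bar>b\<bar> * (nrm v * nrm w)"
    by (intro mult_left_mono Cauchy_Schwarz[OF v w]) simp
  finally show "(nrm (\<lambda>x. a *\<^sub>R v x + b *\<^sub>R w x))\<^sup>2 \<le> (\<bar>a\<bar> * nrm v + \<bar>b\<bar> * nrm w)\<^sup>2"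
    using nrm_square[OF lincomb_closed[OF v w]] form_lincomb_self[OF v w, of a b]
      nrm_square[OF v] nrm_square[OF w]
    by (simp add: power2_sum power_mult_distrib algebra_simps)
qed (use nrm_nonneg v w in simp)

lemma nrm_zero: "nrm (\<lambda>_. 0) = 0"
  using form_lincomb[OF zero_closed zero_closed zero_closed, of 0 0] by (simp add: nrm_def)

lemma nrm_sum:
  assumes "\<And>i. i \<in> I \<Longrightarrow> w i \<in> S"
  shows "nrm (\<lambda>x. \<Sum>i\<in>I. a i *\<^sub>R w i x) \<le> (\<Sum>i\<in>I. \<bar>a i\<bar> * nrm (w i))"
  using assms
proof (induction I rule: infinite_finite_induct)
  case (insert i I)
  then show ?case
    using nrm_lincomb[of "w i" "\<lambda>x. \<Sum>i\<in>I. a i *\<^sub>R w i x" "a i" 1] sum_closed[of I w a] by simp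
qed (auto simp: nrm_zero)

lemma nrm_diff:
  "v \<in> S \<Longrightarrow> w \<in> S \<Longrightarrow> nrm (\<lambda>x. v x - w x) \<le> nrm v + nrm w"
  using nrm_lincomb[of v w 1 "-1"] by simp

lemma nrm_minus_commute: "v \<in> S \<Longrightarrow> w \<in> S \<Longrightarrow> nrm (\<lambda>x. v x - w x) = nrm (\<lambda>x. w x - v x)"
  using form_lincomb_self[of v w 1 "-1"] form_lincomb_self[of v w "-1" 1] by (simp add: nrm_def algebra_simps)

lemma nrm_triangle:
  assumes "u \<in> S" "v \<in> S" "w \<in> S"
  shows "nrm (\<lambda>x. u x - w x) \<le> nrm (\<lambda>x. u x - v x) + nrm (\<lambda>x. v x - w x)"
  using nrm_lincomb[OF diff_closed[OF assms(1,2)] diff_closed[OF assms(2,3)], of 1 1] by simp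

lemma form_tendsto:
  assumes "\<And>n. v n \<in> S" "v' \<in> S" "w \<in> S" "(\<lambda>n. nrm (\<lambda>x. v n x - v' x)) \<longlonglongrightarrow> 0"
  shows "(\<lambda>n. B (v n) w) \<longlonglongrightarrow> B v' w"
proof -
  have "(\<lambda>n. B (v n) w - B v' w) \<longlonglongrightarrow> 0"
  proof (rule Lim_null_comparison)
    show "\<forall>\<^sub>F n in sequentially. norm (B (v n) w - B v' w) \<le> nrm (\<lambda>x. v n x - v' x) * nrm w"
      using Cauchy_Schwarz[OF diff_closed[OF assms(1,2)] assms(3)]
        form_lincomb[OF assms(1,2,3), where a = 1 and b = "-1"] by simp
    show "(\<lambda>n. nrm (\<lambda>x. v n x - v' x) * nrm w) \<longlonglongrightarrow> 0"
      using tendsto_mult_left_zero[OF assms(4)] .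
  qed
  then show ?thesis by (simp add: LIM_zero_iff)
qed

end

section \<open>Square integrable functions and weak derivatives\<close>

locale bounded_open =
  fixes \<Omega> :: "(real ^ 'n::finite) set"
  assumes open_dom: "open \<Omega>" and bounded_dom: "bounded \<Omega>" and nonempty_dom: "\<Omega> \<noteq> {}"
begin

abbreviation MU :: "(real ^ 'n) measure" where "MU \<equiv> lebesgue_on \<Omega>"

lemma dom_measurable [measurable, simp]: "\<Omega> \<in> sets lebesgue"
  using open_dom by auto

lemma finite_measure_MU: "finite_measure MU"
  by (rule finite_measure_lebesgue_on) (simp add: lmeasurable_open bounded_dom open_dom)

lemma measurable_MU: "f \<in> borel_measurable borel \<Longrightarrow> f \<in> borel_measurable MU"
  by (intro measurable_restrict_space1 measurable_completion) simp

lemma L2_mult_integrable: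
  assumes "f \<in> L2_space \<Omega>" "g \<in> L2_space \<Omega>"
  shows "integrable MU (\<lambda>x. f x * g x)"
proof (rule Bochner_Integration.integrable_bound)
  show "integrable MU (\<lambda>x. (f x)\<^sup>2 + (g x)\<^sup>2)" using assms by (auto simp: L2_space_def)
  show "(\<lambda>x. f x * g x) \<in> borel_measurable MU" using assms by (auto simp: L2_space_def)
  have "\<bar>a * b\<bar> \<le> \<bar>a\<^sup>2 + b\<^sup>2\<bar>" for a b :: real
  proof -
    have "2 * \<bar>a\<bar> * \<bar>b\<bar> \<le> a\<^sup>2 + b\<^sup>2" using sum_squares_bound[of "\<bar>a\<bar>" "\<bar>b\<bar>"] by simp
    moreover have "0 \<le> \<bar>a\<bar> * \<bar>b\<bar>" by simp
    ultimately show ?thesis unfolding abs_mult by linarith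
  qed
  then show "AE x in MU. norm (f x * g x) \<le> norm ((f x)\<^sup>2 + (g x)\<^sup>2)" by simp
qed

lemma L2_bounded:
  assumes "f \<in> borel_measurable MU" "\<And>x. x \<in> \<Omega> \<Longrightarrow> \<bar>f x\<bar> \<le> B"
  shows "f \<in> L2_space \<Omega>"
proof -
  interpret finite_measure MU by (rule finite_measure_MU)
  have "(f x)\<^sup>2 \<le> B\<^sup>2" if "x \<in> \<Omega>" for x
    using assms(2)[OF that] by (simp add: abs_le_square_iff[symmetric])
  then have "integrable MU (\<lambda>x. (f x)\<^sup>2)"
    by (intro integrable_const_bound[where B = "B\<^sup>2"]) (use assms in auto)
  then show ?thesis using assms by (simp add: L2_space_def)
qed

lemma L2_const: "(\<lambda>_. c) \<in> L2_space \<Omega>"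
  by (rule L2_bounded[where B = "\<bar>c\<bar>"]) auto

lemma L2_integrable:
  assumes "f \<in> L2_space \<Omega>"
  shows "integrable MU f"
  using L2_mult_integrable[OF assms L2_const[of 1]] by simp

lemma L2_lincomb:
  assumes "f \<in> L2_space \<Omega>" "g \<in> L2_space \<Omega>"
  shows "(\<lambda>x. a * f x + b * g x) \<in> L2_space \<Omega>"
proof -
  have "integrable MU (\<lambda>x. a\<^sup>2 * (f x * f x) + 2 * a * b * (f x * g x) + b\<^sup>2 * (g x * g x))"
    using assms by (intro Bochner_Integration.integrable_add integrable_mult_right L2_mult_integrable)
  also have "(\<lambda>x. a\<^sup>2 * (f x * f x) + 2 * a * b * (f x * g x) + b\<^sup>2 * (g x * g x)) = (\<lambda>x. (a * f x + b * g x)\<^sup>2)"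
    by (simp add: power2_eq_square algebra_simps fun_eq_iff)
  finally show ?thesis using assms by (auto simp: L2_space_def)
qed

sublocale L2: semi_inner_space "L2_space \<Omega>" "L2_inner \<Omega>"
proof
  fix u v w :: "real ^ 'n \<Rightarrow> real" and a b :: real
  show "(\<lambda>_. 0) \<in> L2_space \<Omega>" by (rule L2_const)
  show "u \<in> L2_space \<Omega> \<Longrightarrow> v \<in> L2_space \<Omega> \<Longrightarrow> (\<lambda>x. a *\<^sub>R u x + b *\<^sub>R v x) \<in> L2_space \<Omega>"
    using L2_lincomb by simp
  show "L2_inner \<Omega> v w = L2_inner \<Omega> w v" by (simp add: L2_inner_def mult.commute)
  show "0 \<le> L2_inner \<Omega> v v" by (simp add: L2_inner_def)
  assume *: "u \<in> L2_space \<Omega>" "v \<in> L2_space \<Omega>" "w \<in> L2_space \<Omega>"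
  have "L2_inner \<Omega> (\<lambda>x. a *\<^sub>R u x + b *\<^sub>R v x) w = (\<integral>x. a * (u x * w x) + b * (v x * w x) \<partial>MU)"
    by (simp add: L2_inner_def algebra_simps)
  also have "\<dots> = a * L2_inner \<Omega> u w + b * L2_inner \<Omega> v w"
    by (simp add: L2_inner_def L2_mult_integrable *)
  finally show "L2_inner \<Omega> (\<lambda>x. a *\<^sub>R u x + b *\<^sub>R v x) w = a * L2_inner \<Omega> u w + b * L2_inner \<Omega> v w" .
qed

lemma L2_nrm_eq: "L2.nrm = L2_norm \<Omega>"
  by (simp add: L2.nrm_def L2_norm_def fun_eq_iff)

lemma L2_inner_lincomb:
  "u \<in> L2_space \<Omega> \<Longrightarrow> v \<in> L2_space \<Omega> \<Longrightarrow> w \<in> L2_space \<Omega> \<Longrightarrow>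
    L2_inner \<Omega> (\<lambda>x. a * u x + b * v x) w = a * L2_inner \<Omega> u w + b * L2_inner \<Omega> v w"
  using L2.form_lincomb[of u v w a b] by simp

text \<open>
  Lebesgue measure is complete, so changes on a null set do not affect measurability.
\<close>

lemma borel_measurable_AE_MU:
  fixes f g :: "real ^ 'n \<Rightarrow> real"
  assumes "f \<in> borel_measurable MU" "AE x in MU. f x = g x"
  shows "g \<in> borel_measurable MU"
proof -
  have "(\<lambda>x. if x \<in> \<Omega> then f x else 0) \<in> borel_measurable lebesgue"
    using assms(1) by (simp add: borel_measurable_if)
  moreover have "AE x in lebesgue. x \<in> \<Omega> \<longrightarrow> f x = g x"
    using assms(2) by (simp add: AE_restrict_space_iff)
  then have "AE x in lebesgue. (if x \<in> \<Omega> then f x else 0) = (if x \<in> \<Omega> then g x else 0)"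
    by eventually_elim simp
  ultimately have "(\<lambda>x. if x \<in> \<Omega> then g x else 0) \<in> borel_measurable lebesgue"
    by (rule borel_measurable_AE)
  then show ?thesis by (simp add: borel_measurable_if)
qed

text \<open>
  If one of the two functions fails to be measurable then so does the other, and both integrals are
  \<open>0\<close> by convention.
\<close>

lemma integral_MU_cong_AE:
  fixes f g :: "real ^ 'n \<Rightarrow> real"
  assumes "AE x in MU. f x = g x"
  shows "integral\<^sup>L MU f = integral\<^sup>L MU g"
proof (cases "f \<in> borel_measurable MU")
  case True
  then show ?thesis using borel_measurable_AE_MU[OF True assms] assms by (intro integral_cong_AE)
next
  case False
  have "AE x in MU. g x = f x" using assms by eventually_elim simp
  then have "g \<notin> borel_measurable MU" using borel_measurable_AE_MU False by blast
  then have "\<not> integrable MU f" "\<not> integrable MU g" using False by (auto dest: borel_measurable_integrable)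
  then show ?thesis by (simp add: not_integrable_integral_eq)
qed

lemma L2_inner_cong_AE:
  assumes "AE x in MU. f x = f' x" "AE x in MU. g x = g' x"
  shows "L2_inner \<Omega> f g = L2_inner \<Omega> f' g'"
proof -
  have "AE x in MU. f x * g x = f' x * g' x" using assms by eventually_elim simp
  then show ?thesis unfolding L2_inner_def by (rule integral_MU_cong_AE)
qed

lemma L2_norm_cong_AE:
  assumes "AE x in MU. f x = f' x"
  shows "L2_norm \<Omega> f = L2_norm \<Omega> f'"
  using L2_inner_cong_AE[OF assms assms] by (simp add: L2_norm_def)

lemma L2_space_cong_AE:
  assumes "f \<in> L2_space \<Omega>" "AE x in MU. f x = g x"
  shows "g \<in> L2_space \<Omega>"
proof -
  have g: "g \<in> borel_measurable MU"
    using borel_measurable_AE_MU[OF _ assms(2)] assms(1) by (simp add: L2_space_def)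
  have "AE x in MU. (f x)\<^sup>2 = (g x)\<^sup>2"
    using assms(2) by eventually_elim simp
  then have "integrable MU (\<lambda>x. (g x)\<^sup>2)"
    using assms(1) g by (subst integrable_cong_AE[symmetric]) (auto simp: L2_space_def)
  then show ?thesis using g by (simp add: L2_space_def)
qed

lemma L2_norm_zero_AE:
  assumes "f \<in> L2_space \<Omega>" "L2_norm \<Omega> f = 0"
  shows "AE x in MU. f x = 0"
proof -
  have "integral\<^sup>L MU (\<lambda>x. (f x)\<^sup>2) = 0"
    using assms(2) by (simp add: L2_norm_def L2_inner_def power2_eq_square)
  then have "AE x in MU. (f x)\<^sup>2 = 0"
    using assms(1) by (subst (asm) integral_nonneg_eq_0_iff_AE) (auto simp: L2_space_def)
  then show ?thesis by simp
qed

subsection \<open>Integration by parts\<close>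

lemma test_function_measurable:
  "\<phi> \<in> test_functions \<Omega> \<Longrightarrow> \<phi> \<in> borel_measurable borel"
  by (rule borel_measurable_continuous_onI) (rule test_function_continuous)

lemma test_function_bounded:
  assumes "\<phi> \<in> test_functions \<Omega>"
  obtains B where "\<And>x. \<bar>\<phi> x\<bar> \<le> B" "B \<ge> 0"
proof -
  obtain K where K: "compact K" "K \<subseteq> \<Omega>" "\<And>x. x \<notin> K \<Longrightarrow> \<phi> x = 0"
    using assms by (rule test_functionE) auto
  have "compact (\<phi> ` K)"
    using K(1) test_function_continuous[OF assms] by (blast intro: compact_continuous_image continuous_on_subset)
  then obtain B where "\<forall>y\<in>\<phi> ` K. norm y \<le> B" "B > 0"
    using compact_imp_bounded bounded_pos by blast
  then have "\<bar>\<phi> x\<bar> \<le> B" for x using K(3)[of x] by (cases "x \<in> K") auto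
  then show ?thesis using that \<open>B > 0\<close> by (meson less_imp_le)
qed

lemma test_function_L2:
  assumes "\<phi> \<in> test_functions \<Omega>"
  shows "\<phi> \<in> L2_space \<Omega>"
proof -
  obtain B where "\<And>x. \<bar>\<phi> x\<bar> \<le> B" using test_function_bounded[OF assms] by metis
  then show ?thesis
    by (intro L2_bounded[of _ B] measurable_MU test_function_measurable[OF assms]) auto
qed

lemma test_function_integral:
  assumes "\<phi> \<in> test_functions \<Omega>"
  shows "integrable lborel \<phi>" and "integral\<^sup>L MU \<phi> = integral\<^sup>L lborel \<phi>"
proof -
  obtain K where K: "compact K" "K \<subseteq> \<Omega>" "\<And>x. x \<notin> K \<Longrightarrow> \<phi> x = 0"
    using assms by (rule test_functionE) auto
  have "integrable lborel (\<lambda>x. indicator K x *\<^sub>R \<phi> x)"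
    using K(1) continuous_on_subset[OF test_function_continuous[OF assms]] by (intro borel_integrable_compact) auto
  also have "(\<lambda>x. indicator K x *\<^sub>R \<phi> x) = \<phi>"
    using K(3) by (auto simp: indicator_def fun_eq_iff)
  finally show "integrable lborel \<phi>" .
  have "integral\<^sup>L MU \<phi> = integral\<^sup>L lebesgue (\<lambda>x. if x \<in> \<Omega> then \<phi> x else 0)"
    by (rule Lebesgue_Measure.integral_restrict_UNIV[symmetric]) simp
  also have "(\<lambda>x. if x \<in> \<Omega> then \<phi> x else 0) = \<phi>"
    using K(2,3) by (auto simp: fun_eq_iff)
  finally show "integral\<^sup>L MU \<phi> = integral\<^sup>L lborel \<phi>"
    using test_function_measurable[OF assms] by (simp add: integral_completion)
qed

text \<open>
  Translation invariance makes the integrals of all difference quotients vanish, and these converge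
  boundedly to the derivative.
\<close>

lemma integral_partial_deriv:
  assumes "\<phi> \<in> test_functions \<Omega>"
  shows "integral\<^sup>L MU (partial_deriv i \<phi>) = 0"
proof -
  define t where "t n = inverse (real (Suc n))" for n
  have t: "0 < t n" "t n \<le> 1" for n by (auto simp: t_def field_simps)
  have t_lim: "filterlim t (at 0) sequentially"
    unfolding filterlim_at using LIMSEQ_inverse_real_of_nat[folded t_def] t(1)
    by (auto intro!: always_eventually simp: less_imp_neq[symmetric])
  define s where "s n x = (\<phi> (x + t n *\<^sub>R axis i 1) - \<phi> x) / t n" for n x
  obtain K where K: "compact K" "K \<subseteq> \<Omega>" "\<And>x. x \<notin> K \<Longrightarrow> \<phi> x = 0"
    using assms by (rule test_functionE) auto
  obtain R where R: "\<And>x. x \<in> K \<Longrightarrow> norm x \<le> R"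
    using compact_imp_bounded[OF K(1)] by (auto simp: bounded_iff)
  obtain B where B: "\<And>x. \<bar>partial_deriv i \<phi> x\<bar> \<le> B" "B \<ge> 0"
    using test_function_bounded[OF test_function_partial[OF assms]] by blast
  have meas: "\<phi> \<in> borel_measurable borel" by (rule test_function_measurable[OF assms])
  have shift: "integrable lborel (\<lambda>x. \<phi> (x + c))" "(\<integral>x. \<phi> (x + c) \<partial>lborel) = (\<integral>x. \<phi> x \<partial>lborel)" for c
  proof -
    have "integrable (distr lborel borel ((+) c)) \<phi>" 
      using test_function_integral(1)[OF assms] by (simp only: lborel_distr_plus)
    then show "integrable lborel (\<lambda>x. \<phi> (x + c))"
      using meas by (subst (asm) integrable_distr_eq) (auto simp: add.commute)
    have "(\<integral>x. \<phi> x \<partial>distr lborel borel ((+) c)) = (\<integral>x. \<phi> (c + x) \<partial>lborel)"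
      by (rule integral_distr) (use meas in auto)
    then show "(\<integral>x. \<phi> (x + c) \<partial>lborel) = (\<integral>x. \<phi> x \<partial>lborel)"
      by (simp add: lborel_distr_plus add.commute)
  qed
  have "(\<lambda>n. \<integral>x. s n x \<partial>lborel) \<longlonglongrightarrow> (\<integral>x. partial_deriv i \<phi> x \<partial>lborel)"
  proof (rule integral_dominated_convergence)
    show "partial_deriv i \<phi> \<in> borel_measurable lborel"
      using test_function_measurable[OF test_function_partial[OF assms]] by simp
    show "s n \<in> borel_measurable lborel" for n
      using meas unfolding s_def by measurable
    show "integrable lborel (\<lambda>x. B * indicator (cball 0 (R + 1)) x :: real)"
      using emeasure_lborel_cball_finite[of 0 "R + 1"]
      by (intro integrable_mult_right integrable_real_indicator) auto
    show "AE x in lborel. (\<lambda>n. s n x) \<longlonglongrightarrow> partial_deriv i \<phi> x"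
    proof (rule AE_I2)
      fix x
      have "((\<lambda>h. (\<phi> (x + h *\<^sub>R axis i 1) - \<phi> x) / h) \<longlongrightarrow> partial_deriv i \<phi> x) (at 0)"
        using test_function_line_derivative[OF assms, of x i 0]
        by (simp add: has_field_derivative_iff)
      from filterlim_compose[OF this t_lim] show "(\<lambda>n. s n x) \<longlonglongrightarrow> partial_deriv i \<phi> x"
        by (simp add: s_def)
    qed
    show "AE x in lborel. norm (s n x) \<le> B * indicator (cball 0 (R + 1)) x" for n
    proof (rule AE_I2)
      fix x
      have le: "\<bar>s n x\<bar> \<le> B"
      proof -
        obtain z where "\<phi> (x + t n *\<^sub>R axis i 1) - \<phi> (x + 0 *\<^sub>R axis i 1)
            = (t n - 0) * partial_deriv i \<phi> (x + z *\<^sub>R axis i 1)"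
          using MVT2[OF t(1)[of n] test_function_line_derivative[OF assms, of x i]] by blast
        then have "s n x = partial_deriv i \<phi> (x + z *\<^sub>R axis i 1)"
          using t(1)[of n] by (simp add: s_def)
        then show ?thesis using B by simp
      qed
      show "norm (s n x) \<le> B * indicator (cball 0 (R + 1)) x"
      proof (cases "norm x \<le> R + 1")
        case True
        then show ?thesis using le by simp
      next
        case False
        have "norm x \<le> norm (x + t n *\<^sub>R axis i 1) + norm (t n *\<^sub>R axis i 1 :: real ^ 'n)"
          by (metis add_diff_cancel_right' norm_triangle_ineq4)
        also have "norm (t n *\<^sub>R axis i 1 :: real ^ 'n) \<le> 1" using t[of n] by simp
        finally have "x \<notin> K" "x + t n *\<^sub>R axis i 1 \<notin> K"
          using False R[of x] R[of "x + t n *\<^sub>R axis i 1"] by auto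
        then show ?thesis using K(3) False by (simp add: s_def)
      qed
    qed
  qed
  moreover have "(\<integral>x. s n x \<partial>lborel) = 0" for n
    using shift[of "t n *\<^sub>R axis i 1"] test_function_integral(1)[OF assms] by (simp add: s_def)
  ultimately have "(\<integral>x. partial_deriv i \<phi> x \<partial>lborel) = 0"
    by (simp add: LIMSEQ_const_iff)
  then show ?thesis
    using test_function_integral(2)[OF test_function_partial[OF assms]] by simp
qed

lemma test_function_has_weak_partial:
  assumes "\<phi> \<in> test_functions \<Omega>"
  shows "has_weak_partial \<Omega> i \<phi> (partial_deriv i \<phi>)"
  unfolding has_weak_partial_def
proof (intro conjI ballI)
  show "partial_deriv i \<phi> \<in> L2_space \<Omega>"
    by (rule test_function_L2[OF test_function_partial[OF assms]])
  fix \<psi> assume \<psi>: "\<psi> \<in> test_functions \<Omega>"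
  have "0 = integral\<^sup>L MU (partial_deriv i (\<lambda>x. \<phi> x * \<psi> x))"
    by (simp add: integral_partial_deriv[OF test_function_mult[OF assms \<psi>]])
  also have "\<dots> = (\<integral>x. \<phi> x * partial_deriv i \<psi> x + partial_deriv i \<phi> x * \<psi> x \<partial>MU)"
    by (rule Bochner_Integration.integral_cong) (simp_all add: partial_deriv_mult[OF assms \<psi>])
  also have "\<dots> = L2_inner \<Omega> \<phi> (partial_deriv i \<psi>) + L2_inner \<Omega> (partial_deriv i \<phi>) \<psi>"
    unfolding L2_inner_def
    by (intro Bochner_Integration.integral_add L2_mult_integrable test_function_L2 test_function_partial assms \<psi>)
  finally show "L2_inner \<Omega> \<phi> (partial_deriv i \<psi>) = - L2_inner \<Omega> (partial_deriv i \<phi>) \<psi>" by simp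
qed

subsection \<open>Uniqueness of weak derivatives\<close>

text \<open>
  Near a face at signed distance \<open>t\<close> the factor \<open>exp (- 1 / (n t))\<close> extends smoothly by zero, and it
  tends to \<open>1\<close> at every interior point as \<open>n\<close> grows.
\<close>

lemma box_bump:
  fixes a b :: "real ^ 'n"
  assumes "cbox a b \<subseteq> \<Omega>"
  obtains \<phi> where "\<And>n. \<phi> n \<in> test_functions \<Omega>" "\<And>n x. 0 \<le> \<phi> n x \<and> \<phi> n x \<le> (1 :: real)"
    "\<And>x. (\<lambda>n. \<phi> n x) \<longlonglongrightarrow> indicator (box a b) x"
proof -
  \<comment> \<open>The sign \<open>c\<close> selects the side: \<open>1\<close> at the lower and \<open>-1\<close> at the upper faces.\<close>
  define e where "e n c t = flat_exp 0 (real (Suc n) * (c * t))" for n c t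
  define \<phi> where "\<phi> n x = (\<Prod>i\<in>UNIV. e n 1 (x $ i - a $ i) * e n (-1) (x $ i - b $ i))" for n and x :: "real ^ 'n"
  have e01: "0 \<le> e n c t" "e n c t \<le> 1" for n c t by (auto simp: e_def flat_exp_def)
  have e_lim: "(\<lambda>n. e n c t) \<longlonglongrightarrow> (if c * t > 0 then 1 else 0)" for c t
  proof (cases "c * t > 0")
    case True
    have "(\<lambda>n. - (1 / (c * t)) * inverse (real (Suc n))) \<longlonglongrightarrow> - (1 / (c * t)) * 0"
      by (intro tendsto_mult tendsto_const LIMSEQ_inverse_real_of_nat)
    then have "(\<lambda>n. exp (- (1 / (c * t)) * inverse (real (Suc n)))) \<longlonglongrightarrow> exp (- (1 / (c * t)) * 0)"
      by (rule tendsto_exp)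
    moreover have "e n c t = exp (- (1 / (c * t)) * inverse (real (Suc n)))" for n
    proof -
      have "0 < real (Suc n) * (c * t)" using True by (metis mult_pos_pos of_nat_0_less_iff zero_less_Suc)
      then show ?thesis by (simp add: e_def flat_exp_def divide_inverse mult_ac del: of_nat_Suc)
    qed
    ultimately show ?thesis using True by simp
  next
    case False
    then have "e n c t = 0" for n
      by (simp add: e_def flat_exp_def zero_less_mult_iff del: of_nat_Suc)
    then show ?thesis using False by simp
  qed
  show ?thesis
  proof (rule that)
    fix n
    have smooth_e: "C_k k (\<lambda>x. e n c (x $ i - r))" for c r k and i :: 'n
    proof -
      have "real (Suc n) * (c * (x $ i - r)) = (real (Suc n) * c) * x $ i + (- (real (Suc n) * c * r))" for x
        by (simp only: right_diff_distrib mult.assoc)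
      then show ?thesis
        unfolding e_def by (simp only: C_k_flat_exp_compose C_k_affine_component)
    qed
    have "C_k k (\<phi> n)" for k
      unfolding \<phi>_def by (intro C_k_prod C_k_mult smooth_e)
    moreover have "\<phi> n x = 0" if outside: "x \<notin> cbox a b" for x
    proof -
      obtain i where "x $ i < a $ i \<or> b $ i < x $ i"
        using outside by (auto simp: mem_box_cart not_le)
      then have "e n 1 (x $ i - a $ i) * e n (-1) (x $ i - b $ i) = 0"
        by (auto simp: e_def flat_exp_def zero_less_mult_iff simp del: of_nat_Suc)
      then show ?thesis unfolding \<phi>_def by (intro prod_zero) auto
    qed
    ultimately show "\<phi> n \<in> test_functions \<Omega>"
      by (intro test_functionI[OF _ _ assms]) auto
  next
    fix n x
    show "0 \<le> \<phi> n x \<and> \<phi> n x \<le> 1"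
      unfolding \<phi>_def
      by (intro conjI prod_nonneg prod_le_1 mult_le_one mult_nonneg_nonneg ballI e01)
  next
    fix x
    define l where "l i = (if 1 * (x $ i - a $ i) > 0 then 1 else 0) * (if -1 * (x $ i - b $ i) > 0 then 1 else (0::real))" for i
    have "(\<lambda>n. e n 1 (x $ i - a $ i) * e n (-1) (x $ i - b $ i)) \<longlonglongrightarrow> l i" for i
      unfolding l_def by (rule tendsto_mult[OF e_lim e_lim])
    then have "(\<lambda>n. \<phi> n x) \<longlonglongrightarrow> (\<Prod>i\<in>UNIV. l i)"
      unfolding \<phi>_def by (rule tendsto_prod)
    also have "(\<Prod>i\<in>UNIV. l i) = indicator (box a b) x"
    proof (cases "x \<in> box a b")
      case True
      then have "l i = 1" for i by (simp add: mem_box_cart l_def)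
      then show ?thesis using True by simp
    next
      case False
      then obtain i where "\<not> (a $ i < x $ i \<and> x $ i < b $ i)" by (auto simp: mem_box_cart)
      then have "l i = 0" by (auto simp: l_def)
      then have "(\<Prod>i\<in>UNIV. l i) = 0" by (intro prod_zero) auto
      then show ?thesis using False by simp
    qed
    finally show "(\<lambda>n. \<phi> n x) \<longlonglongrightarrow> indicator (box a b) x" .
  qed
qed

text \<open>
  Smooth bumps converge to the indicator of a box, so the integral of \<open>g\<close> over every box inside the
  domain is zero. Its averages over shrinking boxes, which recover \<open>g\<close> almost everywhere, are zero too.
\<close>

lemma orthogonal_to_test_functions:
  assumes g: "g \<in> L2_space \<Omega>" and orth: "\<And>\<phi>. \<phi> \<in> test_functions \<Omega> \<Longrightarrow> L2_inner \<Omega> g \<phi> = 0"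
  shows "AE x in MU. g x = 0"
proof -
  define G where "G x = (if x \<in> \<Omega> then g x else 0)" for x
  have gi: "integrable MU g" using g by (rule L2_integrable)
  have "G = (\<lambda>x. indicator \<Omega> x *\<^sub>R g x)" by (auto simp: G_def indicator_def)
  then have "integrable lebesgue G" using gi by (simp add: integrable_restrict_space)
  then have "G absolutely_integrable_on UNIV" by (simp add: set_integrable_def)
  then have G_abs: "G absolutely_integrable_on S" if "S \<in> sets lebesgue" for S
    by (rule set_integrable_subset) (use that in auto)
  then have G_int: "G integrable_on cbox a b" for a b
    by (intro set_lebesgue_integral_eq_integral(1)) auto
  have zero: "integral (cbox a b) G = 0" if sub: "cbox a b \<subseteq> \<Omega>" for a b
  proof -
    obtain \<phi> where \<phi>: "\<And>n. \<phi> n \<in> test_functions \<Omega>" "\<And>n x. 0 \<le> \<phi> n x \<and> \<phi> n x \<le> (1 :: real)"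
      "\<And>x. (\<lambda>n. \<phi> n x) \<longlonglongrightarrow> indicator (box a b) x"
      using box_bump[OF sub] by metis
    have box: "box a b \<subseteq> \<Omega>" using sub box_subset_cbox by blast
    have "(\<lambda>n. L2_inner \<Omega> g (\<phi> n)) \<longlonglongrightarrow> (\<integral>x. g x * indicator (box a b) x \<partial>MU)"
      unfolding L2_inner_def
    proof (rule integral_dominated_convergence)
      show "integrable MU (\<lambda>x. \<bar>g x\<bar>)" using gi by simp
      show "AE x in MU. (\<lambda>n. g x * \<phi> n x) \<longlonglongrightarrow> g x * indicator (box a b) x"
        using \<phi>(3) by (auto intro!: tendsto_mult)
      show "AE x in MU. norm (g x * \<phi> n x) \<le> \<bar>g x\<bar>" for n
        using \<phi>(2) by (auto simp: abs_mult intro!: mult_right_le_one_le)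
      show "(\<lambda>x. g x * \<phi> n x) \<in> borel_measurable MU" for n
        using L2_mult_integrable[OF g test_function_L2[OF \<phi>(1)]] by blast
      show "(\<lambda>x. g x * indicator (box a b) x) \<in> borel_measurable MU"
        by (intro borel_measurable_times borel_measurable_integrable[OF gi] measurable_MU) auto
    qed
    then have "(\<integral>x. g x * indicator (box a b) x \<partial>MU) = 0"
      using orth[OF \<phi>(1)] by (simp add: LIMSEQ_const_iff)
    moreover have "(\<integral>x. g x * indicator (box a b) x \<partial>MU) = (\<integral>x. indicator (box a b) x *\<^sub>R G x \<partial>lebesgue)"
    proof -
      have "(\<lambda>x. if x \<in> \<Omega> then g x * indicator (box a b) x else 0) = (\<lambda>x. indicator (box a b) x *\<^sub>R G x)"
        using box by (auto simp: G_def indicator_def fun_eq_iff)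
      then show ?thesis
        using Lebesgue_Measure.integral_restrict_UNIV[OF dom_measurable, of "\<lambda>x. g x * indicator (box a b) x"]
        by simp
    qed
    moreover have "(\<integral>x. indicator (box a b) x *\<^sub>R G x \<partial>lebesgue) = integral (box a b) G"
      using set_lebesgue_integral_eq_integral(2)[OF G_abs[of "box a b"]]
      by (simp add: set_lebesgue_integral_def)
    ultimately show ?thesis by (simp add: integral_open_interval)
  qed
  obtain N where N: "negligible N" and
    lim: "\<And>x e. \<lbrakk>x \<notin> N; 0 < e\<rbrakk> \<Longrightarrow> \<exists>d>0. \<forall>h. 0 < h \<and> h < d \<longrightarrow>
      norm (integral (cbox x (x + h *\<^sub>R One)) G /\<^sub>R h ^ DIM(real ^ 'n) - G x) < e"
    using integrable_ccontinuous_explicit[OF G_int] by blast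
  have "g x = 0" if x: "x \<in> \<Omega>" "x \<notin> N" for x
  proof (rule ccontr)
    assume "g x \<noteq> 0"
    then have "0 < norm (G x)" using x by (simp add: G_def)
    from lim[OF x(2) this] obtain d where d: "d > 0"
      "\<And>h. 0 < h \<Longrightarrow> h < d \<Longrightarrow> norm (integral (cbox x (x + h *\<^sub>R One)) G /\<^sub>R h ^ DIM(real ^ 'n) - G x) < norm (G x)"
      by blast
    obtain r where r: "r > 0" "ball x r \<subseteq> \<Omega>" using open_dom x(1) openE by blast
    define c where "c = 1 + norm (One :: real ^ 'n)"
    have c: "c > 0" "norm (One :: real ^ 'n) \<le> c" unfolding c_def by (auto intro: add_pos_nonneg)
    define h where "h = min (d / 2) (r / (2 * c))"
    have h: "0 < h" "h < d" using d(1) r(1) c(1) by (auto simp: h_def min_less_iff_disj)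
    have hr: "h * norm (One :: real ^ 'n) < r"
    proof -
      have "h * norm (One :: real ^ 'n) \<le> r / (2 * c) * c"
        using c r(1) by (intro mult_mono) (auto simp: h_def)
      also have "\<dots> < r" using c r(1) by simp
      finally show ?thesis .
    qed
    have "cbox x (x + h *\<^sub>R One) \<subseteq> ball x r"
    proof
      fix y assume y: "y \<in> cbox x (x + h *\<^sub>R One)"
      have "norm (y - x) \<le> norm (h *\<^sub>R One :: real ^ 'n)"
        by (rule norm_le_componentwise) (use y h(1) in \<open>auto simp: mem_box inner_simps\<close>)
      then show "y \<in> ball x r" using hr h(1)
        by (simp add: dist_norm norm_minus_commute)
    qed
    then have "integral (cbox x (x + h *\<^sub>R One)) G = 0" using zero r(2) by blast
    then show False using d(2)[OF h] by simp
  qed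
  moreover have "AE x in lebesgue. x \<notin> N"
    using N by (simp add: negligible_iff_null_sets AE_not_in)
  ultimately have "AE x in lebesgue. x \<in> \<Omega> \<longrightarrow> g x = 0" by (auto elim: eventually_mono)
  then show ?thesis by (simp add: AE_restrict_space_iff)
qed

text \<open>
  This identifies \<open>weak_partial\<close>, which is a choice among all weak derivatives, almost everywhere.
\<close>

lemma has_weak_partial_unique:
  assumes "has_weak_partial \<Omega> i u g" "has_weak_partial \<Omega> i u h"
  shows "AE x in MU. g x = h x"
proof -
  have gh: "g \<in> L2_space \<Omega>" "h \<in> L2_space \<Omega>" using assms by (auto simp: has_weak_partial_def)
  have "AE x in MU. g x - h x = 0"
  proof (rule orthogonal_to_test_functions)
    show "(\<lambda>x. g x - h x) \<in> L2_space \<Omega>" using gh by (rule L2.diff_closed)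
    fix \<phi> assume \<phi>: "\<phi> \<in> test_functions \<Omega>"
    have "L2_inner \<Omega> g \<phi> = L2_inner \<Omega> h \<phi>" using assms \<phi> by (simp add: has_weak_partial_def)
    then show "L2_inner \<Omega> (\<lambda>x. g x - h x) \<phi> = 0"
      using L2_inner_lincomb[OF gh test_function_L2[OF \<phi>], of 1 "-1"] by simp
  qed
  then show ?thesis by simp
qed

end

section \<open>The Ladyzhenskaya inequality in two and three dimensions\<close>

interpretation lborel_product: product_sigma_finite "\<lambda>_ :: 'n. lborel :: real measure" ..

lemma measurable_vec_lambda [measurable]:
  "(vec_lambda :: ('n::finite \<Rightarrow> real) \<Rightarrow> real ^ 'n) \<in> borel_measurable (Pi\<^sub>M UNIV (\<lambda>_. lborel))"
proof (rule borel_measurable_euclidean_space[THEN iffD2], rule ballI)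
  fix b :: "real ^ 'n" assume "b \<in> Basis"
  then obtain i where "b = axis i 1" by (auto simp: Basis_vec_def)
  then show "(\<lambda>x. vec_lambda x \<bullet> b) \<in> borel_measurable (Pi\<^sub>M UNIV (\<lambda>_. lborel))"
    by (simp add: inner_axis)
qed

text \<open>
  It allows integrals over the space to be iterated over the coordinates in any order.
\<close>

lemma lborel_eq_distr_vec_lambda:
  "(lborel :: (real ^ 'n::finite) measure) = distr (Pi\<^sub>M UNIV (\<lambda>_. lborel)) borel vec_lambda"
proof (rule lborel_eqI)
  fix l u :: "real ^ 'n" assume le: "\<And>b. b \<in> Basis \<Longrightarrow> l \<bullet> b \<le> u \<bullet> b"
  have le': "l $ i \<le> u $ i" for i using le[of "axis i 1"] by (simp add: inner_axis)
  have "emeasure (distr (Pi\<^sub>M UNIV (\<lambda>_. lborel)) borel vec_lambda) (box l u)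
      = emeasure (Pi\<^sub>M UNIV (\<lambda>_::'n. lborel :: real measure)) (\<Pi>\<^sub>E i\<in>UNIV. {l $ i <..< u $ i})"
    by (subst emeasure_distr) (auto simp: space_PiM mem_box_cart PiE_def Pi_def intro!: arg_cong2[where f = emeasure])
  also have "\<dots> = (\<Prod>i\<in>UNIV. ennreal (u $ i - l $ i))"
    by (subst lborel_product.emeasure_PiM) (auto simp: le')
  also have "\<dots> = ennreal (\<Prod>i\<in>UNIV. u $ i - l $ i)" by (intro prod_ennreal) (simp add: le')
  also have "(\<Prod>i\<in>UNIV. u $ i - l $ i) = (\<Prod>b\<in>Basis. (u - l) \<bullet> b)"
  proof -
    have "(Basis :: (real ^ 'n) set) = range (\<lambda>i. axis i 1)" by (auto simp: Basis_vec_def)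
    moreover have "inj (\<lambda>i :: 'n. axis i (1 :: real))" by (auto simp: inj_on_def axis_eq_axis)
    ultimately have "(\<Prod>b\<in>Basis. (u - l) \<bullet> b) = (\<Prod>i\<in>UNIV. (u - l) \<bullet> axis i 1)"
      by (metis (no_types, lifting) prod.reindex_cong)
    then show ?thesis by (simp add: inner_axis)
  qed
  finally show "emeasure (distr (Pi\<^sub>M UNIV (\<lambda>_. lborel)) borel vec_lambda) (box l u)
      = ennreal (\<Prod>b\<in>Basis. (u - l) \<bullet> b)" .
qed simp

lemma nn_integral_lborel_vec:
  fixes f :: "real ^ 'n::finite \<Rightarrow> ennreal"
  assumes "f \<in> borel_measurable borel"
  shows "(\<integral>\<^sup>+x. f x \<partial>lborel) = (\<integral>\<^sup>+x. f (vec_lambda x) \<partial>Pi\<^sub>M UNIV (\<lambda>_. lborel))"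
  using assms by (subst lborel_eq_distr_vec_lambda) (simp add: nn_integral_distr)

lemma nn_integral_lborel_plane:
  fixes f :: "real ^ 'n::finite \<Rightarrow> ennreal" and i j :: 'n
  assumes [measurable]: "f \<in> borel_measurable borel" and ij: "UNIV = {i, j}" "i \<noteq> j"
  shows "(\<integral>\<^sup>+x. f x \<partial>lborel) = (\<integral>\<^sup>+a. \<integral>\<^sup>+b. f (0 + a *\<^sub>R axis i 1 + b *\<^sub>R axis j 1) \<partial>lborel \<partial>lborel)"
proof -
  have [measurable]: "(\<lambda>x. f (vec_lambda x)) \<in> borel_measurable (Pi\<^sub>M {i, j} (\<lambda>_. lborel))"
    unfolding ij(1)[symmetric] by measurable
  have "(\<integral>\<^sup>+x. f x \<partial>lborel) = (\<integral>\<^sup>+x. f (vec_lambda x) \<partial>Pi\<^sub>M {i, j} (\<lambda>_. lborel))"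
    by (simp add: nn_integral_lborel_vec flip: ij(1))
  also have "\<dots> = (\<integral>\<^sup>+a. \<integral>\<^sup>+x. f (vec_lambda (x(i := a))) \<partial>Pi\<^sub>M {j} (\<lambda>_. lborel) \<partial>lborel)"
    by (subst lborel_product.product_nn_integral_insert_rev) (use ij in auto)
  also have "\<dots> = (\<integral>\<^sup>+a. \<integral>\<^sup>+b. f (vec_lambda ((\<lambda>_. undefined)(j := b, i := a))) \<partial>lborel \<partial>lborel)"
  proof (rule nn_integral_cong)
    fix a :: real
    have [measurable]: "(\<lambda>x. f (vec_lambda (x(i := a)))) \<in> borel_measurable (Pi\<^sub>M {j} (\<lambda>_. lborel))"
      using ij(2) by measurable
    show "(\<integral>\<^sup>+x. f (vec_lambda (x(i := a))) \<partial>Pi\<^sub>M {j} (\<lambda>_. lborel))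
        = (\<integral>\<^sup>+b. f (vec_lambda ((\<lambda>_. undefined)(j := b, i := a))) \<partial>lborel)"
      by (subst lborel_product.product_nn_integral_insert_rev)
        (auto simp: lborel_product.nn_integral_empty)
  qed
  also have "\<dots> = (\<integral>\<^sup>+a. \<integral>\<^sup>+b. f (0 + a *\<^sub>R axis i 1 + b *\<^sub>R axis j 1) \<partial>lborel \<partial>lborel)"
  proof -
    have "vec_lambda ((\<lambda>_. undefined)(j := b, i := a)) = 0 + a *\<^sub>R axis i 1 + b *\<^sub>R axis j 1" for a b :: real
      unfolding vec_eq_iff using ij by (auto simp: axis_def)
    then show ?thesis by simp
  qed
  finally show ?thesis .
qed

lemma nn_integral_lborel_space:
  fixes f :: "real ^ 'n::finite \<Rightarrow> ennreal" and i j k :: 'n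
  assumes [measurable]: "f \<in> borel_measurable borel"
    and ijk: "UNIV = {i, j, k}" "i \<noteq> j" "i \<noteq> k" "j \<noteq> k"
  shows "(\<integral>\<^sup>+x. f x \<partial>lborel) =
    (\<integral>\<^sup>+c. \<integral>\<^sup>+a. \<integral>\<^sup>+b. f (c *\<^sub>R axis k 1 + a *\<^sub>R axis i 1 + b *\<^sub>R axis j 1) \<partial>lborel \<partial>lborel \<partial>lborel)"
proof -
  have UN: "UNIV = {k, i, j}" using ijk by auto
  have [measurable]: "(\<lambda>x. f (vec_lambda x)) \<in> borel_measurable (Pi\<^sub>M {k, i, j} (\<lambda>_. lborel))"
    unfolding UN[symmetric] by measurable
  have "(\<integral>\<^sup>+x. f x \<partial>lborel) = (\<integral>\<^sup>+x. f (vec_lambda x) \<partial>Pi\<^sub>M {k, i, j} (\<lambda>_. lborel))"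
    by (simp add: nn_integral_lborel_vec flip: UN)
  also have "\<dots> = (\<integral>\<^sup>+c. \<integral>\<^sup>+x. f (vec_lambda (x(k := c))) \<partial>Pi\<^sub>M {i, j} (\<lambda>_. lborel) \<partial>lborel)"
    by (subst lborel_product.product_nn_integral_insert_rev) (use ijk in auto)
  also have "\<dots> = (\<integral>\<^sup>+c. \<integral>\<^sup>+a. \<integral>\<^sup>+b. f (vec_lambda ((\<lambda>_. undefined)(j := b, i := a, k := c))) \<partial>lborel \<partial>lborel \<partial>lborel)"
  proof (rule nn_integral_cong)
    fix c :: real
    have [measurable]: "(\<lambda>x. f (vec_lambda (x(k := c)))) \<in> borel_measurable (Pi\<^sub>M {i, j} (\<lambda>_. lborel))"
      using ijk by measurable
    have "(\<integral>\<^sup>+x. f (vec_lambda (x(k := c))) \<partial>Pi\<^sub>M {i, j} (\<lambda>_. lborel))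
        = (\<integral>\<^sup>+a. \<integral>\<^sup>+x. f (vec_lambda (x(i := a, k := c))) \<partial>Pi\<^sub>M {j} (\<lambda>_. lborel) \<partial>lborel)"
      by (subst lborel_product.product_nn_integral_insert_rev) (use ijk in auto)
    also have "\<dots> = (\<integral>\<^sup>+a. \<integral>\<^sup>+b. f (vec_lambda ((\<lambda>_. undefined)(j := b, i := a, k := c))) \<partial>lborel \<partial>lborel)"
    proof (rule nn_integral_cong)
      fix a :: real
      have [measurable]: "(\<lambda>x. f (vec_lambda (x(i := a, k := c)))) \<in> borel_measurable (Pi\<^sub>M {j} (\<lambda>_. lborel))"
        using ijk by measurable
      show "(\<integral>\<^sup>+x. f (vec_lambda (x(i := a, k := c))) \<partial>Pi\<^sub>M {j} (\<lambda>_. lborel))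
          = (\<integral>\<^sup>+b. f (vec_lambda ((\<lambda>_. undefined)(j := b, i := a, k := c))) \<partial>lborel)"
        by (subst lborel_product.product_nn_integral_insert_rev)
          (auto simp: lborel_product.nn_integral_empty)
    qed
    finally show "(\<integral>\<^sup>+x. f (vec_lambda (x(k := c))) \<partial>Pi\<^sub>M {i, j} (\<lambda>_. lborel))
        = (\<integral>\<^sup>+a. \<integral>\<^sup>+b. f (vec_lambda ((\<lambda>_. undefined)(j := b, i := a, k := c))) \<partial>lborel \<partial>lborel)" .
  qed
  also have "\<dots> = (\<integral>\<^sup>+c. \<integral>\<^sup>+a. \<integral>\<^sup>+b. f (c *\<^sub>R axis k 1 + a *\<^sub>R axis i 1 + b *\<^sub>R axis j 1) \<partial>lborel \<partial>lborel \<partial>lborel)"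
  proof -
    have "vec_lambda ((\<lambda>_. undefined)(j := b, i := a, k := c)) = c *\<^sub>R axis k 1 + a *\<^sub>R axis i 1 + b *\<^sub>R axis j 1"
      for a b c :: real
      unfolding vec_eq_iff using ijk by (auto simp: axis_def)
    then show ?thesis by simp
  qed
  finally show ?thesis .
qed

text \<open>
  The fundamental theorem of calculus for \<open>\<phi>\<^sup>2\<close> along a line, started at a point outside the support.
\<close>

lemma test_function_line_bound:
  assumes "\<phi> \<in> test_functions \<Omega>"
  shows "ennreal ((\<phi> (q + a *\<^sub>R axis i 1))\<^sup>2) \<le>
    (\<integral>\<^sup>+s. ennreal \<bar>2 * \<phi> (q + s *\<^sub>R axis i 1) * partial_deriv i \<phi> (q + s *\<^sub>R axis i 1)\<bar> \<partial>lborel)"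
proof -
  define F where "F s = (\<phi> (q + s *\<^sub>R axis i 1))\<^sup>2" for s
  define f where "f s = 2 * \<phi> (q + s *\<^sub>R axis i 1) * partial_deriv i \<phi> (q + s *\<^sub>R axis i 1)" for s
  obtain K where K: "compact K" "K \<subseteq> \<Omega>" "\<And>x. x \<notin> K \<Longrightarrow> \<phi> x = 0"
    using assms by (rule test_functionE) auto
  obtain R where R: "\<And>x. x \<in> K \<Longrightarrow> norm x \<le> R"
    using compact_imp_bounded[OF K(1)] by (auto simp: bounded_iff)
  \<comment> \<open>A parameter to the left of \<open>a\<close> whose point on the line is outside the support.\<close>
  define s0 where "s0 = - (\<bar>R\<bar> + norm q + \<bar>a\<bar> + 1)"
  have s0: "s0 \<le> a" unfolding s0_def using norm_ge_zero[of q] by linarith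
  have "F s0 = 0"
  proof -
    have "norm (s0 *\<^sub>R axis i 1 :: real ^ 'a) \<le> norm (q + s0 *\<^sub>R axis i 1) + norm q"
      by (metis add_diff_cancel_left' norm_triangle_ineq4)
    moreover have "norm (s0 *\<^sub>R axis i 1 :: real ^ 'a) = \<bar>s0\<bar>" by simp
    moreover have "\<bar>s0\<bar> = \<bar>R\<bar> + norm q + \<bar>a\<bar> + 1"
      unfolding s0_def using norm_ge_zero[of q] by linarith
    ultimately have "norm (q + s0 *\<^sub>R axis i 1) > R" by linarith
    then have "q + s0 *\<^sub>R axis i 1 \<notin> K" using R by force
    then show ?thesis using K(3) by (simp add: F_def)
  qed
  have cont: "continuous_on UNIV f"
    unfolding f_def
    by (intro continuous_intros continuous_on_compose2[OF test_function_continuous[OF assms]]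
        continuous_on_compose2[OF test_function_continuous[OF test_function_partial[OF assms]]]) auto
  have der: "(F has_real_derivative f s) (at s)" for s
  proof -
    have "((\<lambda>t. \<phi> (q + t *\<^sub>R axis i 1)) has_real_derivative partial_deriv i \<phi> (q + s *\<^sub>R axis i 1)) (at s)"
      by (rule test_function_line_derivative[OF assms])
    from DERIV_power[OF this, of 2] show ?thesis by (simp add: F_def[abs_def] f_def mult_ac)
  qed
  have "(\<integral>s. f s * indicator {s0..a} s \<partial>lborel) = F a - F s0"
    by (rule integral_FTC_Icc_real[OF s0]) (use der cont in \<open>auto simp: continuous_on_eq_continuous_at\<close>)
  then have "F a = (\<integral>s. f s * indicator {s0..a} s \<partial>lborel)" using \<open>F s0 = 0\<close> by simp
  then have "ennreal (F a) \<le> ennreal (norm (\<integral>s. f s * indicator {s0..a} s \<partial>lborel))"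
    by (intro ennreal_leI) simp
  also have "\<dots> \<le> (\<integral>\<^sup>+s. ennreal (norm (f s * indicator {s0..a} s)) \<partial>lborel)"
    by (rule integral_norm_bound_ennreal)
      (intro borel_integrable_atLeastAtMost, use cont in \<open>auto simp: continuous_on_eq_continuous_at\<close>)
  also have "\<dots> \<le> (\<integral>\<^sup>+s. ennreal \<bar>f s\<bar> \<partial>lborel)"
    by (rule nn_integral_mono) (auto simp: indicator_def)
  finally show ?thesis by (simp add: F_def f_def)
qed

lemma ennreal_mult_le_square_sum: "x * y \<le> x\<^sup>2 + (y :: ennreal)\<^sup>2"
proof (cases "x \<le> y")
  case True
  then have "x * y \<le> y\<^sup>2" by (simp add: power2_eq_square mult_right_mono)
  then show ?thesis by (simp add: add_increasing)
next
  case False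
  then have "x * y \<le> x\<^sup>2" by (simp add: power2_eq_square mult_left_mono)
  then show ?thesis by (simp add: add_increasing2)
qed

text \<open>
  The two one-dimensional bounds for \<open>\<phi>\<^sup>2\<close>, along the lines in direction \<open>i\<close> and in direction \<open>j\<close>,
  are multiplied: each factor is constant in one of the two variables, so that the double integral
  of the product is the product of two double integrals. The Cauchy-Schwarz inequality bounds these.
\<close>

lemma ladyzhenskaya_slice:
  fixes \<phi> :: "real ^ 'n::finite \<Rightarrow> real" and i j :: 'n
  assumes \<phi>: "\<phi> \<in> test_functions \<Omega>"
  defines "y \<equiv> \<lambda>p a b. p + a *\<^sub>R axis i 1 + b *\<^sub>R axis j 1"
  shows "(\<integral>\<^sup>+a. \<integral>\<^sup>+b. ennreal (\<phi> (y p a b) ^ 4) \<partial>lborel \<partial>lborel) \<le>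
    4 * (\<integral>\<^sup>+a. \<integral>\<^sup>+b. ennreal ((\<phi> (y p a b))\<^sup>2) \<partial>lborel \<partial>lborel) *
     ((\<integral>\<^sup>+a. \<integral>\<^sup>+b. ennreal ((partial_deriv i \<phi> (y p a b))\<^sup>2) \<partial>lborel \<partial>lborel) +
      (\<integral>\<^sup>+a. \<integral>\<^sup>+b. ennreal ((partial_deriv j \<phi> (y p a b))\<^sup>2) \<partial>lborel \<partial>lborel))"
proof -
  have [measurable]: "\<phi> \<in> borel_measurable borel"
    by (rule borel_measurable_continuous_onI[OF test_function_continuous[OF \<phi>]])
  have [measurable]: "partial_deriv l \<phi> \<in> borel_measurable borel" for l
    by (rule borel_measurable_continuous_onI[OF test_function_continuous[OF test_function_partial[OF \<phi>]]])
  define B where "B l x = ennreal \<bar>2 * \<phi> x * partial_deriv l \<phi> x\<bar>" for l x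
  have [measurable]: "B l \<in> borel_measurable borel" for l unfolding B_def by measurable
  have [measurable]: "(\<lambda>(a, b). y p a b) \<in> lborel \<Otimes>\<^sub>M lborel \<rightarrow>\<^sub>M borel" unfolding y_def by measurable
  have [measurable]: "(\<lambda>b. y p a b) \<in> lborel \<rightarrow>\<^sub>M borel" for a unfolding y_def by measurable
  have [measurable]: "(\<lambda>a. y p a b) \<in> lborel \<rightarrow>\<^sub>M borel" for b unfolding y_def by measurable
  let ?I = "\<lambda>f. \<integral>\<^sup>+a. \<integral>\<^sup>+b. f (y p a b) \<partial>lborel \<partial>lborel"
  have CS: "(?I (B l))\<^sup>2 \<le> 4 * ?I (\<lambda>x. ennreal ((\<phi> x)\<^sup>2)) * ?I (\<lambda>x. ennreal ((partial_deriv l \<phi> x)\<^sup>2))" for l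
  proof -
    have prod: "?I f = (\<integral>\<^sup>+z. f (y p (fst z) (snd z)) \<partial>(lborel \<Otimes>\<^sub>M lborel))"
      if [measurable]: "f \<in> borel_measurable borel" for f
      by (subst lborel.nn_integral_fst[symmetric]) (simp_all add: case_prod_unfold[symmetric])
    let ?f = "\<lambda>z. ennreal \<bar>2 * \<phi> (y p (fst z) (snd z))\<bar>"
    let ?g = "\<lambda>z. ennreal \<bar>partial_deriv l \<phi> (y p (fst z) (snd z))\<bar>"
    have [measurable]: "(\<lambda>z. y p (fst z) (snd z)) \<in> lborel \<Otimes>\<^sub>M lborel \<rightarrow>\<^sub>M borel" unfolding y_def by measurable
    have "(\<integral>\<^sup>+z. ?f z * ?g z \<partial>(lborel \<Otimes>\<^sub>M lborel))\<^sup>2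
      \<le> (\<integral>\<^sup>+z. ?f z ^ 2 \<partial>(lborel \<Otimes>\<^sub>M lborel)) * (\<integral>\<^sup>+z. ?g z ^ 2 \<partial>(lborel \<Otimes>\<^sub>M lborel))"
      by (rule Cauchy_Schwarz_nn_integral) measurable
    moreover have "?f z * ?g z = B l (y p (fst z) (snd z))" for z
      by (simp add: B_def abs_mult ennreal_mult)
    moreover have "?f z ^ 2 = 4 * ennreal ((\<phi> (y p (fst z) (snd z)))\<^sup>2)" for z
      by (simp add: ennreal_power power_mult_distrib abs_mult ennreal_mult)
    moreover have "?g z ^ 2 = ennreal ((partial_deriv l \<phi> (y p (fst z) (snd z)))\<^sup>2)" for z
      by (simp add: ennreal_power)
    moreover have "?I (B l) = (\<integral>\<^sup>+z. B l (y p (fst z) (snd z)) \<partial>(lborel \<Otimes>\<^sub>M lborel))"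
      by (rule prod) measurable
    moreover have "?I (\<lambda>x. ennreal ((\<phi> x)\<^sup>2)) = (\<integral>\<^sup>+z. ennreal ((\<phi> (y p (fst z) (snd z)))\<^sup>2) \<partial>(lborel \<Otimes>\<^sub>M lborel))"
      by (rule prod) measurable
    moreover have "?I (\<lambda>x. ennreal ((partial_deriv l \<phi> x)\<^sup>2))
        = (\<integral>\<^sup>+z. ennreal ((partial_deriv l \<phi> (y p (fst z) (snd z)))\<^sup>2) \<partial>(lborel \<Otimes>\<^sub>M lborel))"
      by (rule prod) measurable
    ultimately show ?thesis by (simp add: nn_integral_cmult)
  qed
  have "?I (\<lambda>x. ennreal (\<phi> x ^ 4)) \<le> (\<integral>\<^sup>+a. \<integral>\<^sup>+b. (\<integral>\<^sup>+s. B i (y p s b) \<partial>lborel) * (\<integral>\<^sup>+t. B j (y p a t) \<partial>lborel) \<partial>lborel \<partial>lborel)"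
  proof (intro nn_integral_mono)
    fix a b :: real
    have "ennreal ((\<phi> (y p a b))\<^sup>2) \<le> (\<integral>\<^sup>+s. B i (y p s b) \<partial>lborel)"
      using test_function_line_bound[OF \<phi>, of "p + b *\<^sub>R axis j 1" a i]
      by (simp add: y_def B_def algebra_simps)
    moreover have "ennreal ((\<phi> (y p a b))\<^sup>2) \<le> (\<integral>\<^sup>+t. B j (y p a t) \<partial>lborel)"
      using test_function_line_bound[OF \<phi>, of "p + a *\<^sub>R axis i 1" b j]
      by (simp add: y_def B_def algebra_simps)
    moreover have "ennreal (\<phi> (y p a b) ^ 4) = ennreal ((\<phi> (y p a b))\<^sup>2) * ennreal ((\<phi> (y p a b))\<^sup>2)"
      by (simp add: ennreal_mult[symmetric] flip: power_add)
    ultimately show "ennreal (\<phi> (y p a b) ^ 4) \<le> (\<integral>\<^sup>+s. B i (y p s b) \<partial>lborel) * (\<integral>\<^sup>+t. B j (y p a t) \<partial>lborel)"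
      by (simp add: mult_mono)
  qed
  also have "\<dots> = (\<integral>\<^sup>+b. \<integral>\<^sup>+s. B i (y p s b) \<partial>lborel \<partial>lborel) * ?I (B j)"
    by (simp add: nn_integral_multc nn_integral_cmult)
  also have "(\<integral>\<^sup>+b. \<integral>\<^sup>+s. B i (y p s b) \<partial>lborel \<partial>lborel) = ?I (B i)"
    by (rule lborel_pair.Fubini') measurable
  also have "?I (B i) * ?I (B j) \<le> (?I (B i))\<^sup>2 + (?I (B j))\<^sup>2"
    by (rule ennreal_mult_le_square_sum)
  also have "\<dots> \<le> 4 * ?I (\<lambda>x. ennreal ((\<phi> x)\<^sup>2)) * ?I (\<lambda>x. ennreal ((partial_deriv i \<phi> x)\<^sup>2))
    + 4 * ?I (\<lambda>x. ennreal ((\<phi> x)\<^sup>2)) * ?I (\<lambda>x. ennreal ((partial_deriv j \<phi> x)\<^sup>2))"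
    by (intro add_mono CS)
  finally show ?thesis by (simp add: distrib_left)
qed

text \<open>
  In the plane there is only one slice. In space, the slice estimate is integrated over the direction \<open>k\<close>
  normal to the slices: by the line bound in direction \<open>k\<close>, the integral of \<open>\<phi>\<^sup>2\<close> over a slice is at most a
  constant independent of the slice, and the remaining factor integrates to derivatives over the
  whole space.
\<close>

lemma ladyzhenskaya:
  fixes \<phi> :: "real ^ 'n::finite \<Rightarrow> real"
  assumes \<phi>: "\<phi> \<in> test_functions \<Omega>" and dim: "CARD('n) = 2 \<or> CARD('n) = 3"
  shows "(\<integral>\<^sup>+x. ennreal (\<phi> x ^ 4) \<partial>lborel) \<le>
    4 * ((\<integral>\<^sup>+x. ennreal ((\<phi> x)\<^sup>2) \<partial>lborel) +
      (\<Sum>l\<in>UNIV. \<integral>\<^sup>+x. ennreal ((partial_deriv l \<phi> x)\<^sup>2) \<partial>lborel))\<^sup>2"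
proof -
  have m1 [measurable]: "\<phi> \<in> borel_measurable borel"
    by (rule borel_measurable_continuous_onI[OF test_function_continuous[OF \<phi>]])
  have m2 [measurable]: "partial_deriv l \<phi> \<in> borel_measurable borel" for l
    by (rule borel_measurable_continuous_onI[OF test_function_continuous[OF test_function_partial[OF \<phi>]]])
  define N where "N = (\<integral>\<^sup>+x. ennreal ((\<phi> x)\<^sup>2) \<partial>lborel)"
  define D where "D l = (\<integral>\<^sup>+x. ennreal ((partial_deriv l \<phi> x)\<^sup>2) \<partial>lborel)" for l
  define S where "S = N + sum D UNIV"
  show ?thesis
    using dim
  proof
    assume "CARD('n) = 2"
    then obtain i j :: 'n where ij: "UNIV = {i, j}" "i \<noteq> j" by (auto simp: card_2_iff)
    have "(\<integral>\<^sup>+x. ennreal (\<phi> x ^ 4) \<partial>lborel) \<le> 4 * N * (D i + D j)"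
      using ladyzhenskaya_slice[OF \<phi>, of 0 i j] unfolding N_def D_def
      by (simp add: nn_integral_lborel_plane[OF _ ij])
    also have "\<dots> \<le> 4 * S * S"
      unfolding S_def by (intro mult_mono order_refl) (auto simp: ij add_increasing)
    finally show ?thesis by (simp only: S_def N_def D_def[abs_def] power2_eq_square mult.assoc)
  next
    assume "CARD('n) = 3"
    then obtain i j k :: 'n where ijk: "UNIV = {i, j, k}" "i \<noteq> j" "i \<noteq> k" "j \<noteq> k"
      by (auto simp: card_3_iff)
    let ?y = "\<lambda>c a b. c *\<^sub>R axis k 1 + a *\<^sub>R axis i 1 + b *\<^sub>R axis j (1 :: real) :: real ^ 'n"
    let ?I = "\<lambda>c f. \<integral>\<^sup>+a. \<integral>\<^sup>+b. f (?y c a b) \<partial>lborel \<partial>lborel"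
    define B where "B x = ennreal \<bar>2 * \<phi> x * partial_deriv k \<phi> x\<bar>" for x
    have [measurable]: "B \<in> borel_measurable borel" unfolding B_def by measurable
    have K: "?I c (\<lambda>x. ennreal ((\<phi> x)\<^sup>2)) \<le> N + D k" for c
    proof -
      have "?I c (\<lambda>x. ennreal ((\<phi> x)\<^sup>2)) \<le> (\<integral>\<^sup>+a. \<integral>\<^sup>+b. \<integral>\<^sup>+s. B (?y s a b) \<partial>lborel \<partial>lborel \<partial>lborel)"
      proof (intro nn_integral_mono)
        fix a b :: real
        show "ennreal ((\<phi> (?y c a b))\<^sup>2) \<le> (\<integral>\<^sup>+s. B (?y s a b) \<partial>lborel)"
          using test_function_line_bound[OF \<phi>, of "a *\<^sub>R axis i 1 + b *\<^sub>R axis j 1" c k]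
          by (simp add: B_def algebra_simps)
      qed
      also have "\<dots> = (\<integral>\<^sup>+a. \<integral>\<^sup>+s. \<integral>\<^sup>+b. B (?y s a b) \<partial>lborel \<partial>lborel \<partial>lborel)"
        by (intro nn_integral_cong lborel_pair.Fubini') measurable
      also have "\<dots> = (\<integral>\<^sup>+s. \<integral>\<^sup>+a. \<integral>\<^sup>+b. B (?y s a b) \<partial>lborel \<partial>lborel \<partial>lborel)"
        by (intro lborel_pair.Fubini') measurable
      also have "\<dots> = (\<integral>\<^sup>+x. B x \<partial>lborel)"
        by (rule nn_integral_lborel_space[OF _ ijk, symmetric]) measurable
      also have "\<dots> \<le> (\<integral>\<^sup>+x. ennreal ((\<phi> x)\<^sup>2) + ennreal ((partial_deriv k \<phi> x)\<^sup>2) \<partial>lborel)"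
      proof (rule nn_integral_mono)
        fix x
        have "\<bar>2 * \<phi> x * partial_deriv k \<phi> x\<bar> \<le> (\<phi> x)\<^sup>2 + (partial_deriv k \<phi> x)\<^sup>2"
          using sum_squares_bound[of "\<bar>\<phi> x\<bar>" "\<bar>partial_deriv k \<phi> x\<bar>"] by (simp add: abs_mult)
        then show "B x \<le> ennreal ((\<phi> x)\<^sup>2) + ennreal ((partial_deriv k \<phi> x)\<^sup>2)"
          unfolding B_def by (simp add: ennreal_leI flip: ennreal_plus)
      qed
      also have "\<dots> = N + D k" by (simp add: nn_integral_add N_def D_def)
      finally show ?thesis .
    qed
    have "(\<integral>\<^sup>+x. ennreal (\<phi> x ^ 4) \<partial>lborel) = (\<integral>\<^sup>+c. ?I c (\<lambda>x. ennreal (\<phi> x ^ 4)) \<partial>lborel)"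
      by (rule nn_integral_lborel_space[OF _ ijk]) measurable
    also have "\<dots> \<le> (\<integral>\<^sup>+c. 4 * (N + D k) * (?I c (\<lambda>x. ennreal ((partial_deriv i \<phi> x)\<^sup>2))
        + ?I c (\<lambda>x. ennreal ((partial_deriv j \<phi> x)\<^sup>2))) \<partial>lborel)"
      by (intro nn_integral_mono order_trans[OF ladyzhenskaya_slice[OF \<phi>]] mult_right_mono mult_left_mono K) auto
    also have "\<dots> = 4 * (N + D k) * (D i + D j)"
    proof -
      have "D l = (\<integral>\<^sup>+c. ?I c (\<lambda>x. ennreal ((partial_deriv l \<phi> x)\<^sup>2)) \<partial>lborel)" for l
        unfolding D_def by (rule nn_integral_lborel_space[OF _ ijk]) measurable
      then show ?thesis by (simp add: nn_integral_cmult nn_integral_add)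
    qed
    also have "\<dots> \<le> 4 * S * S"
      unfolding S_def using ijk(2-)
      by (intro mult_mono order_refl) (auto simp: ijk(1) add_increasing add_ac)
    finally show ?thesis by (simp only: S_def N_def D_def[abs_def] power2_eq_square mult.assoc)
  qed
qed

section \<open>The spaces of velocity fields\<close>

context bounded_open
begin

lemma weak_partial_has_weak_partial:
  "u \<in> H1 \<Omega> \<Longrightarrow> has_weak_partial \<Omega> i u (weak_partial \<Omega> i u)"
  by (simp add: weak_partial_def H1_def someI_ex)

lemma weak_partial_L2: "u \<in> H1 \<Omega> \<Longrightarrow> weak_partial \<Omega> i u \<in> L2_space \<Omega>"
  using weak_partial_has_weak_partial by (auto simp: has_weak_partial_def)

lemma weak_partial_AE:
  assumes "has_weak_partial \<Omega> i u g"
  shows "AE x in MU. weak_partial \<Omega> i u x = g x"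
proof -
  have "has_weak_partial \<Omega> i u (weak_partial \<Omega> i u)"
    using someI[of "has_weak_partial \<Omega> i u", OF assms] by (simp add: weak_partial_def)
  then show ?thesis using assms by (rule has_weak_partial_unique)
qed

lemma has_weak_partial_lincomb:
  assumes "u \<in> L2_space \<Omega>" "v \<in> L2_space \<Omega>" "has_weak_partial \<Omega> i u g" "has_weak_partial \<Omega> i v h"
  shows "has_weak_partial \<Omega> i (\<lambda>x. a * u x + b * v x) (\<lambda>x. a * g x + b * h x)"
proof -
  have gh: "g \<in> L2_space \<Omega>" "h \<in> L2_space \<Omega>" using assms by (auto simp: has_weak_partial_def)
  have "L2_inner \<Omega> (\<lambda>x. a * u x + b * v x) (partial_deriv i \<phi>) = - L2_inner \<Omega> (\<lambda>x. a * g x + b * h x) \<phi>"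
    if \<phi>: "\<phi> \<in> test_functions \<Omega>" for \<phi>
  proof -
    have "L2_inner \<Omega> u (partial_deriv i \<phi>) = - L2_inner \<Omega> g \<phi>" "L2_inner \<Omega> v (partial_deriv i \<phi>) = - L2_inner \<Omega> h \<phi>"
      using assms(3,4) \<phi> by (auto simp: has_weak_partial_def)
    then show ?thesis
      by (simp add: L2_inner_lincomb assms gh test_function_L2 test_function_partial \<phi>)
  qed
  then show ?thesis using gh by (simp add: has_weak_partial_def L2_lincomb)
qed

lemma H1_L2: "u \<in> H1 \<Omega> \<Longrightarrow> u \<in> L2_space \<Omega>"
  by (simp add: H1_def)

lemma H1_lincomb:
  assumes "u \<in> H1 \<Omega>" "v \<in> H1 \<Omega>"
  shows "(\<lambda>x. a * u x + b * v x) \<in> H1 \<Omega>"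
proof -
  have "has_weak_partial \<Omega> i (\<lambda>x. a * u x + b * v x)
      (\<lambda>x. a * weak_partial \<Omega> i u x + b * weak_partial \<Omega> i v x)" for i
    by (intro has_weak_partial_lincomb H1_L2 weak_partial_has_weak_partial assms)
  then show ?thesis using L2_lincomb[OF assms[THEN H1_L2]] unfolding H1_def by blast
qed

lemma weak_partial_lincomb:
  assumes "u \<in> H1 \<Omega>" "v \<in> H1 \<Omega>"
  shows "AE x in MU. weak_partial \<Omega> i (\<lambda>x. a * u x + b * v x) x = a * weak_partial \<Omega> i u x + b * weak_partial \<Omega> i v x"
  by (intro weak_partial_AE has_weak_partial_lincomb H1_L2 weak_partial_has_weak_partial assms)

lemma has_weak_partial_cong:
  assumes "AE x in MU. u x = v x"
  shows "has_weak_partial \<Omega> i u = has_weak_partial \<Omega> i v"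
proof -
  have "L2_inner \<Omega> u \<psi> = L2_inner \<Omega> v \<psi>" for \<psi>
    by (rule L2_inner_cong_AE[OF assms]) simp
  then show ?thesis by (simp add: has_weak_partial_def fun_eq_iff)
qed

text \<open>
  An honest equality of functions: almost equal functions have the same set of weak derivatives, from
  which the choice operator picks the same element.
\<close>

lemma weak_partial_cong:
  assumes "AE x in MU. u x = v x"
  shows "weak_partial \<Omega> i u = weak_partial \<Omega> i v"
  unfolding weak_partial_def has_weak_partial_cong[OF assms] ..

lemma H10_cong:
  assumes u: "u \<in> H10 \<Omega>" and eq: "AE x in MU. u x = v x"
  shows "v \<in> H10 \<Omega>"
proof -
  have "v \<in> H1 \<Omega>"
    using u L2_space_cong_AE[OF _ eq] by (auto simp: H10_def H1_def has_weak_partial_cong[OF eq])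
  moreover have "L2_norm \<Omega> (\<lambda>x. \<phi> x - u x) = L2_norm \<Omega> (\<lambda>x. \<phi> x - v x)" for \<phi>
    by (rule L2_norm_cong_AE) (use eq in \<open>eventually_elim, simp\<close>)
  ultimately show ?thesis
    using u by (simp add: H10_def weak_partial_cong[OF eq])
qed

lemma H10_H1: "u \<in> H10 \<Omega> \<Longrightarrow> u \<in> H1 \<Omega>"
  by (simp add: H10_def)

lemma H10_L2: "u \<in> H10 \<Omega> \<Longrightarrow> u \<in> L2_space \<Omega>"
  by (simp add: H10_def H1_def)

lemma H10_lincomb:
  assumes u: "u \<in> H10 \<Omega>" and v: "v \<in> H10 \<Omega>"
  shows "(\<lambda>x. a * u x + b * v x) \<in> H10 \<Omega>"
proof -
  obtain \<phi> where \<phi>: "\<And>n. \<phi> n \<in> test_functions \<Omega>" "(\<lambda>n. L2_norm \<Omega> (\<lambda>x. \<phi> n x - u x)) \<longlonglongrightarrow> 0"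
    "\<And>i. (\<lambda>n. L2_norm \<Omega> (\<lambda>x. partial_deriv i (\<phi> n) x - weak_partial \<Omega> i u x)) \<longlonglongrightarrow> 0"
    using u by (auto simp: H10_def)
  obtain \<psi> where \<psi>: "\<And>n. \<psi> n \<in> test_functions \<Omega>" "(\<lambda>n. L2_norm \<Omega> (\<lambda>x. \<psi> n x - v x)) \<longlonglongrightarrow> 0"
    "\<And>i. (\<lambda>n. L2_norm \<Omega> (\<lambda>x. partial_deriv i (\<psi> n) x - weak_partial \<Omega> i v x)) \<longlonglongrightarrow> 0"
    using v by (auto simp: H10_def)
  \<comment> \<open>Used for the functions and for each of their partial derivatives.\<close>
  have comb: "(\<lambda>n. L2_norm \<Omega> (\<lambda>x. (a * f n x + b * h n x) - (a * f' x + b * h' x))) \<longlonglongrightarrow> 0"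
    if "\<And>n. f n \<in> L2_space \<Omega>" "\<And>n. h n \<in> L2_space \<Omega>" "f' \<in> L2_space \<Omega>" "h' \<in> L2_space \<Omega>"
      "(\<lambda>n. L2_norm \<Omega> (\<lambda>x. f n x - f' x)) \<longlonglongrightarrow> 0" "(\<lambda>n. L2_norm \<Omega> (\<lambda>x. h n x - h' x)) \<longlonglongrightarrow> 0"
    for f h f' h'
  proof (rule Lim_null_comparison)
    show "\<forall>\<^sub>F n in sequentially. norm (L2_norm \<Omega> (\<lambda>x. (a * f n x + b * h n x) - (a * f' x + b * h' x)))
        \<le> \<bar>a\<bar> * L2_norm \<Omega> (\<lambda>x. f n x - f' x) + \<bar>b\<bar> * L2_norm \<Omega> (\<lambda>x. h n x - h' x)"
    proof (rule always_eventually, rule allI)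
      fix n
      have "(\<lambda>x. (a * f n x + b * h n x) - (a * f' x + b * h' x)) = (\<lambda>x. a *\<^sub>R (f n x - f' x) + b *\<^sub>R (h n x - h' x))"
        by (simp add: algebra_simps)
      then show "norm (L2_norm \<Omega> (\<lambda>x. (a * f n x + b * h n x) - (a * f' x + b * h' x)))
        \<le> \<bar>a\<bar> * L2_norm \<Omega> (\<lambda>x. f n x - f' x) + \<bar>b\<bar> * L2_norm \<Omega> (\<lambda>x. h n x - h' x)"
        using L2.nrm_lincomb[OF L2.diff_closed[OF that(1,3)] L2.diff_closed[OF that(2,4)], of a n b n]
          L2.nrm_nonneg[OF L2.lincomb_closed[OF L2.diff_closed[OF that(1,3)] L2.diff_closed[OF that(2,4)]], of a n b n]
        by (simp add: L2_nrm_eq)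
    qed
    show "(\<lambda>n. \<bar>a\<bar> * L2_norm \<Omega> (\<lambda>x. f n x - f' x) + \<bar>b\<bar> * L2_norm \<Omega> (\<lambda>x. h n x - h' x)) \<longlonglongrightarrow> 0"
      using tendsto_add[OF tendsto_mult_right_zero[OF that(5), of "\<bar>a\<bar>"] tendsto_mult_right_zero[OF that(6), of "\<bar>b\<bar>"]]
      by simp
  qed
  have H: "u \<in> H1 \<Omega>" "v \<in> H1 \<Omega>" using u v by (auto intro: H10_H1)
  show ?thesis
    unfolding H10_def mem_Collect_eq
  proof (intro conjI exI allI)
    show "(\<lambda>x. a * u x + b * v x) \<in> H1 \<Omega>" by (rule H1_lincomb[OF H])
    show "(\<lambda>x. a * \<phi> n x + b * \<psi> n x) \<in> test_functions \<Omega>" for n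
      by (rule test_function_lincomb[OF \<phi>(1) \<psi>(1)])
    show "(\<lambda>n. L2_norm \<Omega> (\<lambda>x. a * \<phi> n x + b * \<psi> n x - (a * u x + b * v x))) \<longlonglongrightarrow> 0"
      by (intro comb \<phi>(2) \<psi>(2) test_function_L2 \<phi>(1) \<psi>(1) H10_L2 u v)
    fix i
    have "L2_norm \<Omega> (\<lambda>x. partial_deriv i (\<lambda>x. a * \<phi> n x + b * \<psi> n x) x - weak_partial \<Omega> i (\<lambda>x. a * u x + b * v x) x)
      = L2_norm \<Omega> (\<lambda>x. (a * partial_deriv i (\<phi> n) x + b * partial_deriv i (\<psi> n) x)
          - (a * weak_partial \<Omega> i u x + b * weak_partial \<Omega> i v x))" for n
      by (rule L2_norm_cong_AE)
        (use weak_partial_lincomb[OF H, of i a b] in \<open>eventually_elim, simp add: partial_deriv_lincomb[OF \<phi>(1) \<psi>(1)]\<close>)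
    then show "(\<lambda>n. L2_norm \<Omega> (\<lambda>x. partial_deriv i (\<lambda>x. a * \<phi> n x + b * \<psi> n x) x
        - weak_partial \<Omega> i (\<lambda>x. a * u x + b * v x) x)) \<longlonglongrightarrow> 0"
      by (simp only:) (intro comb \<phi>(3) \<psi>(3) test_function_L2 test_function_partial \<phi>(1) \<psi>(1) weak_partial_L2 H)
  qed
qed

lemma test_function_weak_partial:
  "\<phi> \<in> test_functions \<Omega> \<Longrightarrow> AE x in MU. weak_partial \<Omega> i \<phi> x = partial_deriv i \<phi> x"
  by (intro weak_partial_AE test_function_has_weak_partial)

lemma test_function_H10:
  assumes "\<phi> \<in> test_functions \<Omega>"
  shows "\<phi> \<in> H10 \<Omega>"
  unfolding H10_def mem_Collect_eq
proof (intro conjI exI allI)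
  show "\<phi> \<in> H1 \<Omega>"
    using test_function_L2[OF assms] test_function_has_weak_partial[OF assms] by (auto simp: H1_def)
  show "\<phi> \<in> test_functions \<Omega>" by (rule assms)
  show "(\<lambda>n. L2_norm \<Omega> (\<lambda>x. \<phi> x - \<phi> x)) \<longlonglongrightarrow> 0"
    using L2.nrm_zero by (simp add: L2_nrm_eq)
  fix i
  have "L2_norm \<Omega> (\<lambda>x. partial_deriv i \<phi> x - weak_partial \<Omega> i \<phi> x) = L2_norm \<Omega> (\<lambda>_. 0)"
    by (rule L2_norm_cong_AE) (use test_function_weak_partial[OF assms, of i] in \<open>eventually_elim, simp\<close>)
  then show "(\<lambda>n. L2_norm \<Omega> (\<lambda>x. partial_deriv i \<phi> x - weak_partial \<Omega> i \<phi> x)) \<longlonglongrightarrow> 0"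
    using L2.nrm_zero by (simp add: L2_nrm_eq)
qed

lemma zero_test_function: "(\<lambda>_. 0) \<in> test_functions \<Omega>"
  by (rule test_functionI[of _ "{}"]) (auto simp: C_k_const)

sublocale X: function_subspace "X_space \<Omega>"
proof
  show "(\<lambda>_. 0) \<in> X_space \<Omega>"
    using test_function_H10[OF zero_test_function] by (simp add: X_space_def)
  show "(\<lambda>x. a *\<^sub>R v x + b *\<^sub>R w x) \<in> X_space \<Omega>" if "v \<in> X_space \<Omega>" "w \<in> X_space \<Omega>" for v w a b
    using that H10_lincomb by (simp add: X_space_def)
qed

lemma X_component: "v \<in> X_space \<Omega> \<Longrightarrow> (\<lambda>x. v x $ j) \<in> H10 \<Omega>"
  by (simp add: X_space_def)

lemma X_weak_partial_L2: "v \<in> X_space \<Omega> \<Longrightarrow> weak_partial \<Omega> i (\<lambda>x. v x $ j) \<in> L2_space \<Omega>"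
  by (intro weak_partial_L2 H10_H1 X_component)

lemma X_weak_partial_lincomb:
  assumes "v \<in> X_space \<Omega>" "w \<in> X_space \<Omega>"
  shows "AE x in MU. weak_partial \<Omega> i (\<lambda>x. (a *\<^sub>R v x + b *\<^sub>R w x) $ j) x
    = a * weak_partial \<Omega> i (\<lambda>x. v x $ j) x + b * weak_partial \<Omega> i (\<lambda>x. w x $ j) x"
  using weak_partial_lincomb[OF H10_H1[OF X_component[OF assms(1)]] H10_H1[OF X_component[OF assms(2)]]]
  by simp

lemma component_cong: "AE x in MU. v x = w x \<Longrightarrow> AE x in MU. v x $ j = w x $ j"
  by (auto elim: eventually_mono)

lemma X_cong: "v \<in> X_space \<Omega> \<Longrightarrow> AE x in MU. v x = w x \<Longrightarrow> w \<in> X_space \<Omega>"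
  unfolding X_space_def using H10_cong[OF _ component_cong] by blast

lemma X_weak_partial_cong: "AE x in MU. v x = w x \<Longrightarrow> weak_partial \<Omega> i (\<lambda>x. v x $ j) = weak_partial \<Omega> i (\<lambda>x. w x $ j)"
  by (intro weak_partial_cong component_cong)

lemma grad_inner_cong: "AE x in MU. v x = w x \<Longrightarrow> grad_inner \<Omega> v z = grad_inner \<Omega> w z"
  unfolding grad_inner_def by (simp add: X_weak_partial_cong)

sublocale X: semi_inner_space "X_space \<Omega>" "grad_inner \<Omega>"
proof
  fix u v w :: "real ^ 'n \<Rightarrow> real ^ 'n" and a b :: real
  show "grad_inner \<Omega> v w = grad_inner \<Omega> w v"
    unfolding grad_inner_def L2_inner_def by (simp add: mult.commute)
  show "0 \<le> grad_inner \<Omega> v v"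
    unfolding grad_inner_def L2_inner_def by (intro sum_nonneg Bochner_Integration.integral_nonneg) simp
  assume X: "u \<in> X_space \<Omega>" "v \<in> X_space \<Omega>" "w \<in> X_space \<Omega>"
  have "L2_inner \<Omega> (weak_partial \<Omega> i (\<lambda>x. (a *\<^sub>R u x + b *\<^sub>R v x) $ j)) (weak_partial \<Omega> i (\<lambda>x. w x $ j))
    = a * L2_inner \<Omega> (weak_partial \<Omega> i (\<lambda>x. u x $ j)) (weak_partial \<Omega> i (\<lambda>x. w x $ j))
    + b * L2_inner \<Omega> (weak_partial \<Omega> i (\<lambda>x. v x $ j)) (weak_partial \<Omega> i (\<lambda>x. w x $ j))" for i j
    using L2_inner_cong_AE[OF X_weak_partial_lincomb[OF X(1,2), of i a b j], of "weak_partial \<Omega> i (\<lambda>x. w x $ j)" "weak_partial \<Omega> i (\<lambda>x. w x $ j)"]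
    by (simp add: L2_inner_lincomb X_weak_partial_L2 X)
  then show "grad_inner \<Omega> (\<lambda>x. a *\<^sub>R u x + b *\<^sub>R v x) w = a * grad_inner \<Omega> u w + b * grad_inner \<Omega> v w"
    unfolding grad_inner_def by (simp add: sum.distrib sum_distrib_left)
qed

lemma X_nrm_eq: "X.nrm = grad_norm \<Omega>"
  by (simp add: X.nrm_def grad_norm_def fun_eq_iff)

subsection \<open>Divergence-free fields\<close>

lemma weak_div_L2: "v \<in> X_space \<Omega> \<Longrightarrow> weak_div \<Omega> v \<in> L2_space \<Omega>"
  unfolding weak_div_def[abs_def]
  using L2.sum_closed[of UNIV "\<lambda>i. weak_partial \<Omega> i (\<lambda>y. v y $ i)" "\<lambda>_. 1"] X_weak_partial_L2 by simp

lemma weak_div_cong: "AE x in MU. v x = w x \<Longrightarrow> weak_div \<Omega> v = weak_div \<Omega> w"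
  unfolding weak_div_def[abs_def] by (simp add: X_weak_partial_cong)

lemma weak_div_lincomb:
  assumes "v \<in> X_space \<Omega>" "w \<in> X_space \<Omega>"
  shows "AE x in MU. weak_div \<Omega> (\<lambda>x. a *\<^sub>R v x + b *\<^sub>R w x) x = a * weak_div \<Omega> v x + b * weak_div \<Omega> w x"
proof -
  have "AE x in MU. \<forall>i\<in>UNIV. weak_partial \<Omega> i (\<lambda>x. (a *\<^sub>R v x + b *\<^sub>R w x) $ i) x
    = a * weak_partial \<Omega> i (\<lambda>x. v x $ i) x + b * weak_partial \<Omega> i (\<lambda>x. w x $ i) x"
    by (rule AE_finite_allI) (auto intro: X_weak_partial_lincomb[OF assms, simplified])
  then show ?thesis
    by eventually_elim (simp add: weak_div_def sum.distrib sum_distrib_left)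
qed

lemma V_cong: "v \<in> V_space \<Omega> \<Longrightarrow> AE x in MU. v x = w x \<Longrightarrow> w \<in> V_space \<Omega>"
  unfolding V_space_def using X_cong weak_div_cong by fastforce

lemma V_X: "v \<in> V_space \<Omega> \<Longrightarrow> v \<in> X_space \<Omega>"
  by (simp add: V_space_def)

lemma V_lincomb:
  assumes "v \<in> V_space \<Omega>" "w \<in> V_space \<Omega>"
  shows "(\<lambda>x. a *\<^sub>R v x + b *\<^sub>R w x) \<in> V_space \<Omega>"
proof -
  have "L2_inner \<Omega> (weak_div \<Omega> (\<lambda>x. a *\<^sub>R v x + b *\<^sub>R w x)) q = 0" if "q \<in> Q_space \<Omega>" for q
  proof -
    have q: "q \<in> L2_space \<Omega>" using that by (simp add: Q_space_def)
    have "L2_inner \<Omega> (weak_div \<Omega> (\<lambda>x. a *\<^sub>R v x + b *\<^sub>R w x)) q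
        = L2_inner \<Omega> (\<lambda>x. a * weak_div \<Omega> v x + b * weak_div \<Omega> w x) q"
      by (rule L2_inner_cong_AE[OF weak_div_lincomb]) (use assms in \<open>auto intro: V_X\<close>)
    also have "\<dots> = a * L2_inner \<Omega> (weak_div \<Omega> v) q + b * L2_inner \<Omega> (weak_div \<Omega> w) q"
      by (intro L2_inner_lincomb weak_div_L2 V_X assms q)
    also have "\<dots> = 0" using assms that by (simp add: V_space_def)
    finally show ?thesis .
  qed
  then show ?thesis
    using X.lincomb_closed[OF V_X[OF assms(1)] V_X[OF assms(2)]] by (simp add: V_space_def)
qed

lemma H10_weak_partial_integral:
  assumes "u \<in> H10 \<Omega>"
  shows "L2_inner \<Omega> (weak_partial \<Omega> i u) (\<lambda>_. c) = 0"
proof -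
  obtain \<phi> where \<phi>: "\<And>n. \<phi> n \<in> test_functions \<Omega>"
    "\<And>i. (\<lambda>n. L2_norm \<Omega> (\<lambda>x. partial_deriv i (\<phi> n) x - weak_partial \<Omega> i u x)) \<longlonglongrightarrow> 0"
    using assms by (auto simp: H10_def)
  have "(\<lambda>n. L2_inner \<Omega> (partial_deriv i (\<phi> n)) (\<lambda>_. c)) \<longlonglongrightarrow> L2_inner \<Omega> (weak_partial \<Omega> i u) (\<lambda>_. c)"
    by (intro L2.form_tendsto test_function_L2 test_function_partial \<phi>(1) weak_partial_L2 H10_H1 assms L2_const)
      (use \<phi>(2) in \<open>simp add: L2_nrm_eq\<close>)
  moreover have "L2_inner \<Omega> (partial_deriv i (\<phi> n)) (\<lambda>_. c) = 0" for n
    using integral_partial_deriv[OF \<phi>(1)] by (simp add: L2_inner_def)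
  ultimately show ?thesis by (simp add: LIMSEQ_const_iff)
qed

text \<open>
  Subtracting its mean turns a square integrable function into an admissible pressure; the constant
  itself is orthogonal to every divergence, by the vanishing of the field at the boundary.
\<close>

lemma V_div_orthogonal:
  assumes v: "v \<in> V_space \<Omega>" and h: "h \<in> L2_space \<Omega>"
  shows "L2_inner \<Omega> (weak_div \<Omega> v) h = 0"
proof -
  have vX: "v \<in> X_space \<Omega>" using v by (rule V_X)
  define c where "c = integral\<^sup>L MU h / measure MU \<Omega>"
  have "measure MU \<Omega> > 0"
  proof -
    have "\<not> negligible \<Omega>" using open_not_negligible open_dom nonempty_dom by blast
    then have "measure lebesgue \<Omega> \<noteq> 0"
      using lmeasurable_open[OF bounded_dom open_dom] negligible_iff_measure0 by blast
    then show ?thesis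
      using measure_nonneg[of lebesgue \<Omega>] by (simp add: measure_restrict_space less_le)
  qed
  then have "integral\<^sup>L MU (\<lambda>x. h x - c) = 0"
    using finite_measure.integrable_const[OF finite_measure_MU, of c]
    by (simp add: Bochner_Integration.integral_diff[OF L2_integrable[OF h]] c_def)
  moreover have hc: "(\<lambda>x. h x - c) \<in> L2_space \<Omega>" by (rule L2.diff_closed[OF h L2_const])
  ultimately have "(\<lambda>x. h x - c) \<in> Q_space \<Omega>" by (simp add: Q_space_def)
  then have "L2_inner \<Omega> (weak_div \<Omega> v) (\<lambda>x. h x - c) = 0" using v by (simp add: V_space_def)
  moreover have "L2_inner \<Omega> (weak_div \<Omega> v) (\<lambda>_. c) = 0"
  proof -
    have "L2_inner \<Omega> (\<lambda>x. \<Sum>i\<in>UNIV. 1 *\<^sub>R weak_partial \<Omega> i (\<lambda>y. v y $ i) x) (\<lambda>_. c)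
      = (\<Sum>i\<in>UNIV. 1 * L2_inner \<Omega> (weak_partial \<Omega> i (\<lambda>y. v y $ i)) (\<lambda>_. c))"
      by (rule L2.linear_sum[of "\<lambda>f. L2_inner \<Omega> f (\<lambda>_. c)"])
        (auto intro: L2_inner_lincomb L2_const X_weak_partial_L2 vX)
    then show ?thesis
      using H10_weak_partial_integral[OF X_component[OF vX]] by (simp add: weak_div_def[abs_def])
  qed
  moreover have "L2_inner \<Omega> (weak_div \<Omega> v) (\<lambda>x. h x - c)
      = L2_inner \<Omega> (weak_div \<Omega> v) h - L2_inner \<Omega> (weak_div \<Omega> v) (\<lambda>_. c)"
    using L2.form_lincomb_right[OF h L2_const weak_div_L2[OF vX], of 1 "-1" c] by simp
  ultimately show ?thesis by simp
qed

sublocale V: semi_inner_space "V_space \<Omega>" "grad_inner \<Omega>"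
proof
  have "(\<lambda>_. 0) \<in> X_space \<Omega>" by (rule X.zero_closed)
  moreover have "AE x in MU. weak_div \<Omega> (\<lambda>_. 0) x = 0"
    using weak_div_lincomb[OF X.zero_closed X.zero_closed, of 0 0] by simp
  then have "L2_inner \<Omega> (weak_div \<Omega> (\<lambda>_. 0)) q = 0" for q
    using L2_inner_cong_AE[of "weak_div \<Omega> (\<lambda>_. 0)" "\<lambda>_. 0" q q] by (simp add: L2_inner_def)
  ultimately show "(\<lambda>_. 0) \<in> V_space \<Omega>" by (simp add: V_space_def)
qed (blast intro: V_lincomb X.form_sym X.form_lincomb X.form_nonneg V_X)+

lemma V_nrm_eq: "V.nrm = grad_norm \<Omega>"
  by (simp add: V.nrm_def grad_norm_def fun_eq_iff)

end

section \<open>The convective term\<close>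

context bounded_open
begin

lemma test_function_nn_integral:
  assumes "\<phi> \<in> test_functions \<Omega>" "\<And>x. \<phi> x \<ge> 0"
  shows "(\<integral>\<^sup>+x. ennreal (\<phi> x) \<partial>lborel) = ennreal (integral\<^sup>L MU \<phi>)"
  using nn_integral_eq_integral[OF test_function_integral(1)[OF assms(1)]] assms(2)
    test_function_integral(2)[OF assms(1)] by simp

lemma ladyzhenskaya_integral:
  assumes \<phi>: "\<phi> \<in> test_functions \<Omega>" and dim: "CARD('n) = 2 \<or> CARD('n) = 3"
  shows "(\<integral>x. \<phi> x ^ 4 \<partial>MU) \<le> 4 * ((L2_norm \<Omega> \<phi>)\<^sup>2 + (\<Sum>l\<in>UNIV. (L2_norm \<Omega> (partial_deriv l \<phi>))\<^sup>2))\<^sup>2"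
proof -
  have sq: "(\<integral>\<^sup>+x. ennreal ((\<psi> x)\<^sup>2) \<partial>lborel) = ennreal ((L2_norm \<Omega> \<psi>)\<^sup>2)"
    if \<psi>: "\<psi> \<in> test_functions \<Omega>" for \<psi>
    using test_function_nn_integral[OF test_function_mult[OF \<psi> \<psi>]] L2.nrm_square[OF test_function_L2[OF \<psi>]]
    by (simp add: L2_nrm_eq L2_inner_def power2_eq_square)
  have "(\<lambda>x. \<phi> x ^ 4) = (\<lambda>x. (\<phi> x * \<phi> x) * (\<phi> x * \<phi> x))"
    by (simp add: power4_eq_xxxx mult.assoc)
  then have four: "(\<lambda>x. \<phi> x ^ 4) \<in> test_functions \<Omega>"
    using test_function_mult[OF test_function_mult[OF \<phi> \<phi>] test_function_mult[OF \<phi> \<phi>]] by simp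
  have "ennreal (\<integral>x. \<phi> x ^ 4 \<partial>MU) = (\<integral>\<^sup>+x. ennreal (\<phi> x ^ 4) \<partial>lborel)"
    using test_function_nn_integral[OF four] by simp
  also have "\<dots> \<le> 4 * (ennreal ((L2_norm \<Omega> \<phi>)\<^sup>2) + (\<Sum>l\<in>UNIV. ennreal ((L2_norm \<Omega> (partial_deriv l \<phi>))\<^sup>2)))\<^sup>2"
    using ladyzhenskaya[OF \<phi> dim] sq[OF \<phi>] sq[OF test_function_partial[OF \<phi>]] by simp
  also have "\<dots> = ennreal (4 * ((L2_norm \<Omega> \<phi>)\<^sup>2 + (\<Sum>l\<in>UNIV. (L2_norm \<Omega> (partial_deriv l \<phi>))\<^sup>2))\<^sup>2)"
  proof -
    have "(\<Sum>l\<in>UNIV. ennreal ((L2_norm \<Omega> (partial_deriv l \<phi>))\<^sup>2)) = ennreal (\<Sum>l\<in>UNIV. (L2_norm \<Omega> (partial_deriv l \<phi>))\<^sup>2)"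
      by (rule sum_ennreal) simp
    then show ?thesis
      by (simp add: ennreal_plus[symmetric] sum_nonneg ennreal_power ennreal_mult' del: ennreal_plus)
  qed
  finally show ?thesis
    by (subst (asm) ennreal_le_iff) auto
qed

text \<open>
  The approximating test functions are bounded in \<open>H1\<close>, hence their fourth powers have bounded
  integrals by the Ladyzhenskaya inequality; a subsequence converges almost everywhere, and the bound
  passes to the limit by the lemma of Fatou.
\<close>

lemma H10_fourth_power_integrable:
  assumes u: "u \<in> H10 \<Omega>" and dim: "CARD('n) = 2 \<or> CARD('n) = 3"
  shows "integrable MU (\<lambda>x. u x ^ 4)"
proof -
  obtain \<phi> where \<phi>: "\<And>n. \<phi> n \<in> test_functions \<Omega>" "(\<lambda>n. L2_norm \<Omega> (\<lambda>x. \<phi> n x - u x)) \<longlonglongrightarrow> 0"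
    "\<And>i. (\<lambda>n. L2_norm \<Omega> (\<lambda>x. partial_deriv i (\<phi> n) x - weak_partial \<Omega> i u x)) \<longlonglongrightarrow> 0"
    using u by (auto simp: H10_def)
  have uL2: "u \<in> L2_space \<Omega>" using u by (rule H10_L2)
  have bdd: "\<exists>c. \<forall>n. (L2_norm \<Omega> (f n))\<^sup>2 \<le> c"
    if f: "\<And>n. f n \<in> L2_space \<Omega>" "h \<in> L2_space \<Omega>" and lim: "(\<lambda>n. L2_norm \<Omega> (\<lambda>x. f n x - h x)) \<longlonglongrightarrow> 0" for f h
  proof -
    obtain K where K: "\<And>n. norm (L2_norm \<Omega> (\<lambda>x. f n x - h x)) \<le> K"
      using convergent_imp_Bseq[OF convergentI[OF lim]] by (auto simp: Bseq_def)
    have "L2_norm \<Omega> (f n) \<le> K + L2_norm \<Omega> h" for n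
      using L2.nrm_lincomb[OF L2.diff_closed[OF f] f(2), of 1 n 1] K[of n] by (simp add: L2_nrm_eq)
    then have "(L2_norm \<Omega> (f n))\<^sup>2 \<le> (K + L2_norm \<Omega> h)\<^sup>2" for n
      using L2.nrm_nonneg[OF f(1), of n] by (intro power_mono) (auto simp: L2_nrm_eq)
    then show ?thesis by blast
  qed
  obtain c0 where c0: "\<And>n. (L2_norm \<Omega> (\<phi> n))\<^sup>2 \<le> c0"
    using bdd[OF test_function_L2[OF \<phi>(1)] uL2 \<phi>(2)] by blast
  have "\<forall>i. \<exists>c. \<forall>n. (L2_norm \<Omega> (partial_deriv i (\<phi> n)))\<^sup>2 \<le> c"
    using bdd[OF test_function_L2[OF test_function_partial[OF \<phi>(1)]] weak_partial_L2[OF H10_H1[OF u]] \<phi>(3)] by blast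
  then obtain c where c: "\<And>i n. (L2_norm \<Omega> (partial_deriv i (\<phi> n)))\<^sup>2 \<le> c i" by metis
  define C where "C = 4 * (c0 + sum c UNIV)\<^sup>2"
  have int4: "integrable MU (\<lambda>x. \<phi> n x ^ 4)" for n
    using L2_mult_integrable[OF test_function_L2[OF test_function_mult[OF \<phi>(1) \<phi>(1)]] test_function_L2[OF test_function_mult[OF \<phi>(1) \<phi>(1)]], of n n n n]
    by (simp add: power4_eq_xxxx mult.assoc)
  have bound: "(\<integral>x. \<phi> n x ^ 4 \<partial>MU) \<le> C" for n
  proof -
    have "(L2_norm \<Omega> (\<phi> n))\<^sup>2 + (\<Sum>l\<in>UNIV. (L2_norm \<Omega> (partial_deriv l (\<phi> n)))\<^sup>2) \<le> c0 + sum c UNIV"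
      by (intro add_mono sum_mono c0 c)
    then have "4 * ((L2_norm \<Omega> (\<phi> n))\<^sup>2 + (\<Sum>l\<in>UNIV. (L2_norm \<Omega> (partial_deriv l (\<phi> n)))\<^sup>2))\<^sup>2 \<le> C"
      unfolding C_def by (intro mult_left_mono power_mono add_nonneg_nonneg sum_nonneg) auto
    with ladyzhenskaya_integral[OF \<phi>(1) dim, of n] show ?thesis by linarith
  qed
  have "\<exists>r::nat \<Rightarrow> nat. strict_mono r \<and> (AE x in MU. (\<lambda>n. (\<phi> (r n) x - u x)\<^sup>2) \<longlonglongrightarrow> 0)"
  proof (rule tendsto_L1_AE_subseq)
    show "integrable MU (\<lambda>x. (\<phi> n x - u x)\<^sup>2)" for n
      using L2.diff_closed[OF test_function_L2[OF \<phi>(1)] uL2] by (simp add: L2_space_def)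
    have "(\<lambda>n. (L2_norm \<Omega> (\<lambda>x. \<phi> n x - u x))\<^sup>2) \<longlonglongrightarrow> 0\<^sup>2"
      by (rule tendsto_power[OF \<phi>(2)])
    moreover have "(L2_norm \<Omega> (\<lambda>x. \<phi> n x - u x))\<^sup>2 = (\<integral>x. norm ((\<phi> n x - u x)\<^sup>2) \<partial>MU)" for n
      using L2.nrm_square[OF L2.diff_closed[OF test_function_L2[OF \<phi>(1)] uL2], of n]
      by (simp add: L2_nrm_eq L2_inner_def power2_eq_square)
    ultimately show "(\<lambda>n. \<integral>x. norm ((\<phi> n x - u x)\<^sup>2) \<partial>MU) \<longlonglongrightarrow> 0" by simp
  qed
  then obtain r :: "nat \<Rightarrow> nat" where r: "AE x in MU. (\<lambda>n. (\<phi> (r n) x - u x)\<^sup>2) \<longlonglongrightarrow> 0" by blast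
  have lim: "AE x in MU. (\<lambda>n. \<phi> (r n) x ^ 4) \<longlonglongrightarrow> u x ^ 4"
    using r
  proof eventually_elim
    case (elim x)
    have "(\<lambda>n. sqrt ((\<phi> (r n) x - u x)\<^sup>2)) \<longlonglongrightarrow> sqrt 0" by (rule tendsto_real_sqrt[OF elim])
    then have "(\<lambda>n. \<phi> (r n) x - u x) \<longlonglongrightarrow> 0" by (simp add: tendsto_rabs_zero_iff)
    then have "(\<lambda>n. \<phi> (r n) x) \<longlonglongrightarrow> u x" by (simp add: LIM_zero_iff)
    then show ?case by (rule tendsto_power)
  qed
  have meas: "u \<in> borel_measurable MU" using uL2 by (simp add: L2_space_def)
  have "(\<integral>\<^sup>+x. ennreal (u x ^ 4) \<partial>MU) = (\<integral>\<^sup>+x. liminf (\<lambda>n. ennreal (\<phi> (r n) x ^ 4)) \<partial>MU)"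
  proof (rule nn_integral_cong_AE)
    show "AE x in MU. ennreal (u x ^ 4) = liminf (\<lambda>n. ennreal (\<phi> (r n) x ^ 4))"
      using lim
    proof eventually_elim
      case (elim x)
      from tendsto_ennrealI[OF elim] show ?case
        by (intro lim_imp_Liminf[symmetric]) auto
    qed
  qed
  also have "\<dots> \<le> liminf (\<lambda>n. \<integral>\<^sup>+x. ennreal (\<phi> (r n) x ^ 4) \<partial>MU)"
    by (rule nn_integral_liminf) (use int4 in \<open>auto dest: borel_measurable_integrable\<close>)
  also have "\<dots> \<le> ennreal C"
  proof -
    have "(\<integral>\<^sup>+x. ennreal (\<phi> (r n) x ^ 4) \<partial>MU) \<le> ennreal C" for n
      using nn_integral_eq_integral[OF int4, of "r n"] bound[of "r n"] by (simp add: ennreal_leI)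
    then show ?thesis by (intro Liminf_le) (auto intro: always_eventually)
  qed
  finally have "(\<integral>\<^sup>+x. ennreal (u x ^ 4) \<partial>MU) < \<infinity>"
    using ennreal_less_top le_less_trans by fastforce
  then show ?thesis
    by (intro integrableI_nonneg) (use meas in auto)
qed

lemma H10_mult_L2:
  assumes "u \<in> H10 \<Omega>" "v \<in> H10 \<Omega>" and dim: "CARD('n) = 2 \<or> CARD('n) = 3"
  shows "(\<lambda>x. u x * v x) \<in> L2_space \<Omega>"
proof -
  have m: "u \<in> borel_measurable MU" "v \<in> borel_measurable MU"
    using H10_L2 assms by (auto simp: L2_space_def)
  have "integrable MU (\<lambda>x. (u x * v x)\<^sup>2)"
  proof (rule Bochner_Integration.integrable_bound)
    show "integrable MU (\<lambda>x. u x ^ 4 + v x ^ 4)"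
      by (intro Bochner_Integration.integrable_add H10_fourth_power_integrable assms)
    show "(\<lambda>x. (u x * v x)\<^sup>2) \<in> borel_measurable MU" using m by measurable
    have "(a * b)\<^sup>2 \<le> a ^ 4 + b ^ 4" for a b :: real
    proof -
      have "2 * (a\<^sup>2 * b\<^sup>2) \<le> a ^ 4 + b ^ 4"
        using sum_squares_bound[of "a\<^sup>2" "b\<^sup>2"] by (simp add: mult.assoc flip: power_mult)
      moreover have "0 \<le> a\<^sup>2 * b\<^sup>2" by simp
      ultimately show ?thesis unfolding power_mult_distrib by linarith
    qed
    then show "AE x in MU. norm ((u x * v x)\<^sup>2) \<le> norm (u x ^ 4 + v x ^ 4)" by simp
  qed
  then show ?thesis using m by (simp add: L2_space_def)
qed

lemma convection_form_cong:
  assumes "AE x in MU. v x = v' x" "AE x in MU. w x = w' x"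
  shows "convection_form \<Omega> v w z = convection_form \<Omega> v' w' z"
  unfolding convection_form_def
proof (rule integral_MU_cong_AE)
  show "AE x in MU. convect \<Omega> v w x \<bullet> z x = convect \<Omega> v' w' x \<bullet> z x"
    using assms(1) by eventually_elim (simp add: convect_def X_weak_partial_cong[OF assms(2)])
qed

lemma residual_cong:
  assumes "AE x in MU. v x = w x"
  shows "residual \<Omega> \<nu> f v = residual \<Omega> \<nu> f w"
  unfolding residual_def grad_inner_cong[OF assms] convection_form_cong[OF assms assms] ..

text \<open>
  The derivative is continuous, so it vanishes everywhere; the function is then constant along the lines
  in that direction, and these leave the compact support.
\<close>

lemma test_function_zero:
  assumes \<psi>: "\<psi> \<in> test_functions \<Omega>" and zero: "L2_norm \<Omega> (partial_deriv i \<psi>) = 0"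
  shows "\<psi> x = 0"
proof -
  have \<psi>': "partial_deriv i \<psi> \<in> test_functions \<Omega>" by (rule test_function_partial[OF \<psi>])
  define S where "S = {x. partial_deriv i \<psi> x \<noteq> 0}"
  have "S \<subseteq> \<Omega>" 
    using \<psi>' closure_subset[of S] by (auto simp: S_def test_functions_def)
  have "AE x in MU. partial_deriv i \<psi> x = 0"
    by (rule L2_norm_zero_AE[OF test_function_L2[OF \<psi>'] zero])
  then have "AE x in lebesgue. x \<in> \<Omega> \<longrightarrow> partial_deriv i \<psi> x = 0" by (simp add: AE_restrict_space_iff)
  then have "AE x in lebesgue. x \<notin> S"
    by (rule eventually_mono) (use \<open>S \<subseteq> \<Omega>\<close> in \<open>auto simp: S_def\<close>)
  then have "S \<in> null_sets lebesgue" by (simp add: completion.AE_iff_null_sets)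
  then have "negligible S" by (simp add: negligible_iff_null_sets)
  moreover have "open S"
    unfolding S_def
    by (rule open_Collect_neq[OF test_function_continuous[OF \<psi>'] continuous_on_const])
  ultimately have "S = {}" using open_not_negligible by blast
  then have "((\<lambda>t. \<psi> (x + t *\<^sub>R axis i 1)) has_real_derivative 0) (at t)" for t
    using test_function_line_derivative[OF \<psi>, of x i t] by (simp add: S_def)
  then have "\<psi> (x + t *\<^sub>R axis i 1) = \<psi> (x + 0 *\<^sub>R axis i 1)" for t
    using DERIV_isconst_all[of "\<lambda>t. \<psi> (x + t *\<^sub>R axis i 1)" t 0] by blast
  then have const: "\<psi> (x + t *\<^sub>R axis i 1) = \<psi> x" for t by simp
  obtain L where L: "compact L" "\<And>x. x \<notin> L \<Longrightarrow> \<psi> x = 0"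
    using \<psi> by (rule test_functionE) auto
  obtain R where R: "\<And>x. x \<in> L \<Longrightarrow> norm x \<le> R"
    using compact_imp_bounded[OF L(1)] by (auto simp: bounded_iff)
  define t where "t = \<bar>R\<bar> + norm x + 1"
  have "norm (t *\<^sub>R axis i 1 :: real ^ 'n) \<le> norm (x + t *\<^sub>R axis i 1) + norm x"
    by (metis add_diff_cancel_left' norm_triangle_ineq4)
  moreover have "norm (t *\<^sub>R axis i 1 :: real ^ 'n) = \<bar>t\<bar>" by simp
  moreover have "\<bar>t\<bar> = \<bar>R\<bar> + norm x + 1" unfolding t_def using norm_ge_zero[of x] by linarith
  ultimately have "norm (x + t *\<^sub>R axis i 1) > R" by linarith
  then have "x + t *\<^sub>R axis i 1 \<notin> L" using R by force
  then show ?thesis using L(2) const[of t] by simp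
qed

text \<open>
  A radial bump times the rotation field of a coordinate plane is divergence-free, since the rotation field is
  tangent to the spheres on which the bump is constant. The dual norms need such a field: they are
  suprema of real sets, and the supremum of the empty set is an unspecified number.
\<close>

lemma divergence_free_field:
  assumes "CARD('n) \<ge> 2"
  obtains z where "z \<in> V_space \<Omega>" "grad_norm \<Omega> z > 0"
proof -
  obtain p r :: 'n where pr: "p \<noteq> r"
    using assms by (metis UNIV_I card_2_iff' card_le_Suc0_iff_eq finite_class.finite_UNIV not_less_eq_eq numeral_2_eq_2)
  obtain a where a: "a \<in> \<Omega>" using nonempty_dom by blast
  obtain \<rho> where \<rho>: "\<rho> > 0" "cball a \<rho> \<subseteq> \<Omega>" using open_contains_cball open_dom a by blast
  define q where "q x = \<rho>\<^sup>2 - (x - a) \<bullet> (x - a)" for x :: "real ^ 'n"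
  define E where "E x = flat_exp 0 (q x)" for x
  define E' where "E' x = flat_exp 2 (q x)" for x
  have q_smooth: "C_k k q" for k
  proof -
    have "C_k k (\<lambda>x. 1 * \<rho>\<^sup>2 + (-1) * (\<Sum>i\<in>UNIV. (1 * x $ i + - a $ i) * (1 * x $ i + - a $ i)))"
      by (intro C_k_lincomb C_k_const C_k_sum C_k_mult C_k_affine_component)
    moreover have "q = (\<lambda>x. 1 * \<rho>\<^sup>2 + (-1) * (\<Sum>i\<in>UNIV. (1 * x $ i + - a $ i) * (1 * x $ i + - a $ i)))"
      by (simp add: q_def inner_vec_def fun_eq_iff)
    ultimately show ?thesis by simp
  qed
  have E: "E \<in> test_functions \<Omega>"
  proof (rule test_functionI[OF _ _ \<rho>(2)])
    show "C_k k E" for k unfolding E_def[abs_def] by (rule C_k_flat_exp_compose[OF q_smooth])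
    show "E x = 0" if "x \<notin> cball a \<rho>" for x
    proof -
      have "\<rho> < norm (x - a)" using that by (simp add: dist_norm norm_minus_commute)
      then have "\<rho>\<^sup>2 < (norm (x - a))\<^sup>2" using \<rho>(1) by (intro power_strict_mono) auto
      then show ?thesis by (simp add: E_def flat_exp_def q_def power2_norm_eq_inner)
    qed
  qed simp
  have E_der: "(E has_derivative (\<lambda>h. E' x * (- 2 * ((x - a) \<bullet> h)))) (at x)" for x
  proof -
    have "(q has_derivative (\<lambda>h. - 2 * ((x - a) \<bullet> h))) (at x)"
      unfolding q_def by (auto intro!: derivative_eq_intros simp: inner_commute)
    from has_derivative_compose[OF this flat_exp_deriv[unfolded has_field_derivative_def, of 0]]
    show ?thesis by (simp add: E_def[abs_def] E'_def numeral_2_eq_2)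
  qed
  define A where "A i x = x $ i - a $ i" for i and x :: "real ^ 'n"
  have A_smooth: "C_k k (A i)" for k i
    using C_k_affine_component[of k 1 i "- a $ i"] by (simp add: A_def[abs_def])
  define z where "z x = (\<chi> j. if j = p then - (A r x * E x) else if j = r then A p x * E x else 0)" for x
  have AE_test: "(\<lambda>x. A i x * E x) \<in> test_functions \<Omega>" for i
    by (rule test_function_mult_smooth[OF E A_smooth])
  have z_p: "(\<lambda>x. z x $ p) = (\<lambda>x. (-1) * (A r x * E x) + 0 * (A r x * E x))" and z_r: "(\<lambda>x. z x $ r) = (\<lambda>x. A p x * E x)"
    and z_0: "\<And>j. j \<noteq> p \<Longrightarrow> j \<noteq> r \<Longrightarrow> (\<lambda>x. z x $ j) = (\<lambda>_. 0)"
    using pr by (auto simp: z_def)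
  have z_test: "(\<lambda>x. z x $ j) \<in> test_functions \<Omega>" for j
  proof -
    consider "j = p" | "j = r" | "j \<noteq> p" "j \<noteq> r" by blast
    then show ?thesis
    proof cases
      case 1
      show ?thesis unfolding 1 z_p by (rule test_function_lincomb[OF AE_test AE_test])
    next
      case 2
      show ?thesis unfolding 2 z_r by (rule AE_test)
    next
      case 3
      show ?thesis unfolding z_0[OF 3] by (rule zero_test_function)
    qed
  qed
  then have zX: "z \<in> X_space \<Omega>" by (simp add: X_space_def test_function_H10)
  have AE_der: "partial_deriv i (\<lambda>x. A j x * E x) x = - 2 * E' x * A j x * A i x" if "i \<noteq> j" for i j x
  proof -
    have "((\<lambda>x. A j x * E x) has_derivative (\<lambda>h. A j x * (E' x * (- 2 * ((x - a) \<bullet> h))) + h $ j * E x)) (at x)"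
      unfolding A_def
      by (intro has_derivative_mult E_der) (auto intro!: derivative_eq_intros bounded_linear_imp_has_derivative bounded_linear_vec_nth)
    moreover have "(axis i 1 :: real ^ 'n) $ j = 0" using that by (simp add: axis_def)
    ultimately show ?thesis by (simp add: partial_deriv_eq inner_axis A_def)
  qed
  have "AE x in MU. \<forall>i\<in>UNIV. weak_partial \<Omega> i (\<lambda>y. z y $ i) x = partial_deriv i (\<lambda>y. z y $ i) x"
    by (rule AE_finite_allI) (auto intro: test_function_weak_partial[OF z_test])
  then have "AE x in MU. weak_div \<Omega> z x = 0"
  proof eventually_elim
    case (elim x)
    have "weak_div \<Omega> z x = (\<Sum>i\<in>UNIV. partial_deriv i (\<lambda>y. z y $ i) x)"
      unfolding weak_div_def using elim by simp
    also have "\<dots> = (\<Sum>i\<in>{p, r}. partial_deriv i (\<lambda>y. z y $ i) x)"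
    proof (rule sum.mono_neutral_right)
      show "\<forall>i\<in>UNIV - {p, r}. partial_deriv i (\<lambda>y. z y $ i) x = 0"
        using partial_deriv_eq[OF has_derivative_const] by (auto simp: z_0)
    qed auto
    also have "\<dots> = 0"
      using pr by (simp add: z_p[unfolded] z_r partial_deriv_lincomb[OF AE_test AE_test, of p "-1" r 0 r, simplified] AE_der)
    finally show ?case .
  qed
  then have "L2_inner \<Omega> (weak_div \<Omega> z) h = 0" for h
    using L2_inner_cong_AE[of "weak_div \<Omega> z" "\<lambda>_. 0" h h] by (simp add: L2_inner_def)
  then have zV: "z \<in> V_space \<Omega>" using zX by (simp add: V_space_def)
  have "grad_norm \<Omega> z \<noteq> 0"
  proof
    assume "grad_norm \<Omega> z = 0"
    then have "grad_inner \<Omega> z z = 0" by (simp add: grad_norm_def)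
    then have "L2_inner \<Omega> (weak_partial \<Omega> p (\<lambda>x. z x $ r)) (weak_partial \<Omega> p (\<lambda>x. z x $ r)) = 0"
    proof -
      let ?T = "\<lambda>i j. L2_inner \<Omega> (weak_partial \<Omega> i (\<lambda>x. z x $ j)) (weak_partial \<Omega> i (\<lambda>x. z x $ j))"
      have nonneg: "0 \<le> ?T i j" for i j by (rule L2.form_nonneg[OF X_weak_partial_L2[OF zX]])
      have "?T p r \<le> (\<Sum>j\<in>UNIV. ?T p j)" by (rule member_le_sum) (simp_all add: nonneg)
      also have "\<dots> \<le> (\<Sum>i\<in>UNIV. \<Sum>j\<in>UNIV. ?T i j)"
        by (rule member_le_sum[of p]) (simp_all add: nonneg sum_nonneg)
      also have "\<dots> = 0" using \<open>grad_inner \<Omega> z z = 0\<close> by (simp only: grad_inner_def)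
      finally show ?thesis using nonneg[of p r] by simp
    qed
    then have "L2_norm \<Omega> (weak_partial \<Omega> p (\<lambda>x. z x $ r)) = 0" by (simp add: L2_norm_def)
    then have "L2_norm \<Omega> (partial_deriv p (\<lambda>x. z x $ r)) = 0"
      using L2_norm_cong_AE[OF test_function_weak_partial[OF z_test]] by simp
    then have "z (a + (\<rho> / 2) *\<^sub>R axis p 1) $ r = 0" by (rule test_function_zero[OF z_test])
    moreover have "z (a + (\<rho> / 2) *\<^sub>R axis p 1) $ r \<noteq> 0"
    proof -
      have "q (a + (\<rho> / 2) *\<^sub>R axis p 1) = \<rho>\<^sup>2 - (\<rho> / 2) * (\<rho> / 2)"
        by (simp add: q_def inner_axis_axis)
      also have "\<dots> > 0" using \<rho>(1) by (simp add: power2_eq_square field_simps)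
      finally show ?thesis
        using \<rho>(1) pr by (simp add: z_def A_def E_def flat_exp_def)
    qed
    ultimately show False by simp
  qed
  then have "grad_norm \<Omega> z > 0"
    using X.nrm_nonneg[OF zX] by (simp add: X_nrm_eq)
  with zV show ?thesis by (rule that)
qed

end

text \<open>
  In dimension two or three, the products of two components are square integrable and the convective
  term is an absolutely convergent integral.
\<close>

locale flow_domain = bounded_open \<Omega> for \<Omega> :: "(real ^ 'n::finite) set" +
  assumes dim: "CARD('n) = 2 \<or> CARD('n) = 3"
begin

lemma X_mult_L2:
  "v \<in> X_space \<Omega> \<Longrightarrow> w \<in> X_space \<Omega> \<Longrightarrow> (\<lambda>x. v x $ i * w x $ j) \<in> L2_space \<Omega>"
  by (intro H10_mult_L2 X_component dim)

lemma convection_form_eq: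
  assumes "v \<in> X_space \<Omega>" "w \<in> X_space \<Omega>" "z \<in> X_space \<Omega>"
  shows "convection_form \<Omega> v w z =
    (\<Sum>i\<in>UNIV. \<Sum>j\<in>UNIV. L2_inner \<Omega> (weak_partial \<Omega> i (\<lambda>y. w y $ j)) (\<lambda>x. v x $ i * z x $ j))"
proof -
  have "convect \<Omega> v w x \<bullet> z x = (\<Sum>i\<in>UNIV. \<Sum>j\<in>UNIV. weak_partial \<Omega> i (\<lambda>y. w y $ j) x * (v x $ i * z x $ j))" for x
    unfolding convect_def inner_vec_def
    by (subst sum.swap) (simp add: sum_distrib_left sum_distrib_right mult_ac)
  then have "convection_form \<Omega> v w z
      = (\<integral>x. (\<Sum>i\<in>UNIV. \<Sum>j\<in>UNIV. weak_partial \<Omega> i (\<lambda>y. w y $ j) x * (v x $ i * z x $ j)) \<partial>MU)"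
    by (simp add: convection_form_def)
  also have "\<dots> = (\<Sum>i\<in>UNIV. \<Sum>j\<in>UNIV. (\<integral>x. weak_partial \<Omega> i (\<lambda>y. w y $ j) x * (v x $ i * z x $ j) \<partial>MU))"
    by (subst Bochner_Integration.integral_sum;
        (intro Bochner_Integration.integrable_sum L2_mult_integrable X_weak_partial_L2 X_mult_L2 assms
          | intro sum.cong refl Bochner_Integration.integral_sum L2_mult_integrable X_weak_partial_L2 X_mult_L2 assms))
  finally show ?thesis by (simp add: L2_inner_def)
qed

lemma convection_form_lincomb1:
  assumes X: "u \<in> X_space \<Omega>" "v \<in> X_space \<Omega>" "w \<in> X_space \<Omega>" "z \<in> X_space \<Omega>"
  shows "convection_form \<Omega> (\<lambda>x. r *\<^sub>R u x + s *\<^sub>R v x) w z = r * convection_form \<Omega> u w z + s * convection_form \<Omega> v w z"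
proof -
  have "L2_inner \<Omega> (weak_partial \<Omega> i (\<lambda>y. w y $ j)) (\<lambda>x. (r *\<^sub>R u x + s *\<^sub>R v x) $ i * z x $ j)
    = r * L2_inner \<Omega> (weak_partial \<Omega> i (\<lambda>y. w y $ j)) (\<lambda>x. u x $ i * z x $ j)
    + s * L2_inner \<Omega> (weak_partial \<Omega> i (\<lambda>y. w y $ j)) (\<lambda>x. v x $ i * z x $ j)" for i j
    using L2.form_lincomb_right[OF X_mult_L2[OF X(1,4), of i j] X_mult_L2[OF X(2,4), of i j] X_weak_partial_L2[OF X(3), of i j], of r s]
    by (simp add: distrib_right mult.assoc)
  then show ?thesis
    by (simp add: convection_form_eq X X.lincomb_closed sum.distrib sum_distrib_left del: vector_add_component vector_scaleR_component)
qed

lemma convection_form_lincomb2: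
  assumes X: "u \<in> X_space \<Omega>" "v \<in> X_space \<Omega>" "w \<in> X_space \<Omega>" "z \<in> X_space \<Omega>"
  shows "convection_form \<Omega> w (\<lambda>x. r *\<^sub>R u x + s *\<^sub>R v x) z = r * convection_form \<Omega> w u z + s * convection_form \<Omega> w v z"
proof -
  have "L2_inner \<Omega> (weak_partial \<Omega> i (\<lambda>y. (r *\<^sub>R u y + s *\<^sub>R v y) $ j)) (\<lambda>x. w x $ i * z x $ j)
    = r * L2_inner \<Omega> (weak_partial \<Omega> i (\<lambda>y. u y $ j)) (\<lambda>x. w x $ i * z x $ j)
    + s * L2_inner \<Omega> (weak_partial \<Omega> i (\<lambda>y. v y $ j)) (\<lambda>x. w x $ i * z x $ j)" for i j
    using L2_inner_cong_AE[OF X_weak_partial_lincomb[OF X(1,2), of i r s j], of "\<lambda>x. w x $ i * z x $ j" "\<lambda>x. w x $ i * z x $ j"]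
      L2_inner_lincomb[OF X_weak_partial_L2[OF X(1), of i j] X_weak_partial_L2[OF X(2), of i j] X_mult_L2[OF X(3,4), of i j], of r s]
    by simp
  then show ?thesis
    by (simp add: convection_form_eq X X.lincomb_closed sum.distrib sum_distrib_left del: vector_add_component vector_scaleR_component)
qed

lemma convection_form_lincomb3:
  assumes X: "u \<in> X_space \<Omega>" "v \<in> X_space \<Omega>" "w \<in> X_space \<Omega>" "z \<in> X_space \<Omega>"
  shows "convection_form \<Omega> w z (\<lambda>x. r *\<^sub>R u x + s *\<^sub>R v x) = r * convection_form \<Omega> w z u + s * convection_form \<Omega> w z v"
proof -
  have "L2_inner \<Omega> (weak_partial \<Omega> i (\<lambda>y. z y $ j)) (\<lambda>x. w x $ i * (r *\<^sub>R u x + s *\<^sub>R v x) $ j)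
    = r * L2_inner \<Omega> (weak_partial \<Omega> i (\<lambda>y. z y $ j)) (\<lambda>x. w x $ i * u x $ j)
    + s * L2_inner \<Omega> (weak_partial \<Omega> i (\<lambda>y. z y $ j)) (\<lambda>x. w x $ i * v x $ j)" for i j
    using L2.form_lincomb_right[OF X_mult_L2[OF X(3,1), of i j] X_mult_L2[OF X(3,2), of i j] X_weak_partial_L2[OF X(4), of i j], of r s]
    by (simp add: distrib_left mult_ac)
  then show ?thesis
    by (simp add: convection_form_eq X X.lincomb_closed sum.distrib sum_distrib_left del: vector_add_component vector_scaleR_component)
qed

text \<open>
  For smooth \<open>z\<close>, twice the integrand is \<open>v \<cdot> \<nabla>\<bar>z\<bar>\<^sup>2\<close>, which integrates to zero because \<open>v\<close> is
  divergence-free.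
\<close>

lemma convection_form_skew_smooth:
  assumes v: "v \<in> V_space \<Omega>" and z: "\<And>j. (\<lambda>x. z x $ j) \<in> test_functions \<Omega>"
  shows "convection_form \<Omega> v z z = 0"
proof -
  have vX: "v \<in> X_space \<Omega>" using v by (rule V_X)
  have zX: "z \<in> X_space \<Omega>" using z by (simp add: X_space_def test_function_H10)
  have sq: "(\<lambda>x. z x $ j * z x $ j) \<in> test_functions \<Omega>" for j by (rule test_function_mult[OF z z])
  have eq: "L2_inner \<Omega> (weak_partial \<Omega> i (\<lambda>y. z y $ j)) (\<lambda>x. v x $ i * z x $ j)
    = - (1 / 2) * L2_inner \<Omega> (weak_partial \<Omega> i (\<lambda>x. v x $ i)) (\<lambda>x. z x $ j * z x $ j)" for i j
  proof -
    have "L2_inner \<Omega> (weak_partial \<Omega> i (\<lambda>y. z y $ j)) (\<lambda>x. v x $ i * z x $ j)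
        = L2_inner \<Omega> (partial_deriv i (\<lambda>y. z y $ j)) (\<lambda>x. v x $ i * z x $ j)"
      by (rule L2_inner_cong_AE[OF test_function_weak_partial[OF z]]) simp
    also have "\<dots> = (1 / 2) * L2_inner \<Omega> (\<lambda>x. v x $ i) (partial_deriv i (\<lambda>x. z x $ j * z x $ j))"
      by (simp add: L2_inner_def partial_deriv_mult[OF z z] mult_ac flip: mult_2)
    also have "L2_inner \<Omega> (\<lambda>x. v x $ i) (partial_deriv i (\<lambda>x. z x $ j * z x $ j))
        = - L2_inner \<Omega> (weak_partial \<Omega> i (\<lambda>x. v x $ i)) (\<lambda>x. z x $ j * z x $ j)"
      using weak_partial_has_weak_partial[OF H10_H1[OF X_component[OF vX]], of i i] sq[of j]
      by (simp add: has_weak_partial_def)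
    finally show ?thesis by simp
  qed
  have "convection_form \<Omega> v z z = (\<Sum>j\<in>UNIV. \<Sum>i\<in>UNIV. - (1 / 2) * L2_inner \<Omega> (weak_partial \<Omega> i (\<lambda>x. v x $ i)) (\<lambda>x. z x $ j * z x $ j))"
    unfolding convection_form_eq[OF vX zX zX] eq by (rule sum.swap)
  also have "\<dots> = (\<Sum>j\<in>UNIV. - (1 / 2) * L2_inner \<Omega> (weak_div \<Omega> v) (\<lambda>x. z x $ j * z x $ j))"
  proof (rule sum.cong[OF refl])
    fix j
    have "L2_inner \<Omega> (\<lambda>x. \<Sum>i\<in>UNIV. 1 *\<^sub>R weak_partial \<Omega> i (\<lambda>y. v y $ i) x) (\<lambda>x. z x $ j * z x $ j)
      = (\<Sum>i\<in>UNIV. 1 * L2_inner \<Omega> (weak_partial \<Omega> i (\<lambda>y. v y $ i)) (\<lambda>x. z x $ j * z x $ j))"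
      by (rule L2.linear_sum[of "\<lambda>f. L2_inner \<Omega> f (\<lambda>x. z x $ j * z x $ j)"])
        (auto intro: L2_inner_lincomb test_function_L2[OF sq] X_weak_partial_L2 vX)
    then show "(\<Sum>i\<in>UNIV. - (1 / 2) * L2_inner \<Omega> (weak_partial \<Omega> i (\<lambda>x. v x $ i)) (\<lambda>x. z x $ j * z x $ j))
        = - (1 / 2) * L2_inner \<Omega> (weak_div \<Omega> v) (\<lambda>x. z x $ j * z x $ j)"
      by (simp add: weak_div_def[abs_def] sum_negf sum_divide_distrib)
  qed
  also have "\<dots> = 0" by (simp add: V_div_orthogonal[OF v test_function_L2[OF sq]])
  finally show ?thesis .
qed

text \<open>
  The approximations of the components are assembled to fields, in the norm with respect to which the
  convective term is continuous.
\<close>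

lemma X_approximation:
  assumes z: "z \<in> X_space \<Omega>"
  obtains \<Phi> where "\<And>n j. (\<lambda>x. \<Phi> n x $ j) \<in> test_functions \<Omega>"
    "(\<lambda>n. grad_norm \<Omega> (\<lambda>x. z x - \<Phi> n x)) \<longlonglongrightarrow> 0"
proof -
  have "\<forall>j. \<exists>\<phi>. (\<forall>n. \<phi> n \<in> test_functions \<Omega>) \<and>
     (\<forall>i. (\<lambda>n. L2_norm \<Omega> (\<lambda>x. partial_deriv i (\<phi> n) x - weak_partial \<Omega> i (\<lambda>x. z x $ j) x)) \<longlonglongrightarrow> 0)"
  proof
    fix j
    show "\<exists>\<phi>. (\<forall>n. \<phi> n \<in> test_functions \<Omega>) \<and>
      (\<forall>i. (\<lambda>n. L2_norm \<Omega> (\<lambda>x. partial_deriv i (\<phi> n) x - weak_partial \<Omega> i (\<lambda>x. z x $ j) x)) \<longlonglongrightarrow> 0)"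
      using X_component[OF z, of j] unfolding H10_def mem_Collect_eq by blast
  qed
  from choice[OF this] obtain \<phi> where \<phi>': "\<forall>j. (\<forall>n. \<phi> j n \<in> test_functions \<Omega>) \<and>
     (\<forall>i. (\<lambda>n. L2_norm \<Omega> (\<lambda>x. partial_deriv i (\<phi> j n) x - weak_partial \<Omega> i (\<lambda>x. z x $ j) x)) \<longlonglongrightarrow> 0)"
    ..
  then have \<phi>: "\<phi> j n \<in> test_functions \<Omega>"
    "(\<lambda>n. L2_norm \<Omega> (\<lambda>x. partial_deriv i (\<phi> j n) x - weak_partial \<Omega> i (\<lambda>x. z x $ j) x)) \<longlonglongrightarrow> 0" for i j n
    by auto
  define \<Phi> where "\<Phi> n x = (\<chi> j. \<phi> j n x)" for n x
  have comp: "(\<lambda>x. \<Phi> n x $ j) = \<phi> j n" for n j by (simp add: \<Phi>_def)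
  have \<Phi>X: "\<Phi> n \<in> X_space \<Omega>" for n by (simp add: X_space_def comp test_function_H10 \<phi>(1))
  have "grad_inner \<Omega> (\<lambda>x. z x - \<Phi> n x) (\<lambda>x. z x - \<Phi> n x)
    = (\<Sum>i\<in>UNIV. \<Sum>j\<in>UNIV. (L2_norm \<Omega> (\<lambda>x. partial_deriv i (\<phi> j n) x - weak_partial \<Omega> i (\<lambda>x. z x $ j) x))\<^sup>2)" for n
    unfolding grad_inner_def
  proof (intro sum.cong refl)
    fix i j
    have L2: "weak_partial \<Omega> i (\<lambda>x. (z x - \<Phi> n x) $ j) \<in> L2_space \<Omega>"
      by (intro X_weak_partial_L2 X.diff_closed z \<Phi>X)
    have "L2_norm \<Omega> (weak_partial \<Omega> i (\<lambda>x. (z x - \<Phi> n x) $ j))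
        = L2_norm \<Omega> (\<lambda>x. weak_partial \<Omega> i (\<lambda>x. z x $ j) x - partial_deriv i (\<phi> j n) x)"
    proof (rule L2_norm_cong_AE)
      have "AE x in MU. weak_partial \<Omega> i (\<lambda>x. (z x - \<Phi> n x) $ j) x
          = weak_partial \<Omega> i (\<lambda>x. z x $ j) x - weak_partial \<Omega> i (\<phi> j n) x"
        using X_weak_partial_lincomb[OF z \<Phi>X, of i 1 "-1" n j] by (simp add: comp)
      then show "AE x in MU. weak_partial \<Omega> i (\<lambda>x. (z x - \<Phi> n x) $ j) x
          = weak_partial \<Omega> i (\<lambda>x. z x $ j) x - partial_deriv i (\<phi> j n) x"
        using test_function_weak_partial[OF \<phi>(1), of i j n] by eventually_elim simp
    qed
    also have "\<dots> = L2_norm \<Omega> (\<lambda>x. partial_deriv i (\<phi> j n) x - weak_partial \<Omega> i (\<lambda>x. z x $ j) x)"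
      using L2.nrm_minus_commute[OF X_weak_partial_L2[OF z] test_function_L2[OF test_function_partial[OF \<phi>(1)]]]
      by (simp add: L2_nrm_eq)
    finally show "L2_inner \<Omega> (weak_partial \<Omega> i (\<lambda>x. (z x - \<Phi> n x) $ j)) (weak_partial \<Omega> i (\<lambda>x. (z x - \<Phi> n x) $ j))
        = (L2_norm \<Omega> (\<lambda>x. partial_deriv i (\<phi> j n) x - weak_partial \<Omega> i (\<lambda>x. z x $ j) x))\<^sup>2"
      using L2.nrm_square[OF L2] by (simp add: L2_nrm_eq)
  qed
  moreover have "(\<lambda>n. \<Sum>i\<in>UNIV. \<Sum>j\<in>UNIV. (L2_norm \<Omega> (\<lambda>x. partial_deriv i (\<phi> j n) x - weak_partial \<Omega> i (\<lambda>x. z x $ j) x))\<^sup>2)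
      \<longlonglongrightarrow> (\<Sum>i\<in>(UNIV :: 'n set). \<Sum>j\<in>(UNIV :: 'n set). 0\<^sup>2)"
    by (intro tendsto_sum tendsto_power \<phi>(2))
  ultimately have "(\<lambda>n. grad_inner \<Omega> (\<lambda>x. z x - \<Phi> n x) (\<lambda>x. z x - \<Phi> n x)) \<longlonglongrightarrow> 0" by simp
  then have "(\<lambda>n. grad_norm \<Omega> (\<lambda>x. z x - \<Phi> n x)) \<longlonglongrightarrow> sqrt 0"
    unfolding grad_norm_def by (rule tendsto_real_sqrt)
  then show ?thesis using that[of \<Phi>] by (simp add: comp \<phi>(1))
qed

lemma convection_form_bound:
  assumes M: "convection_constant \<Omega> M" and X: "v \<in> X_space \<Omega>" "w \<in> X_space \<Omega>" "z \<in> X_space \<Omega>"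
  shows "\<bar>convection_form \<Omega> v w z\<bar> \<le> M * grad_norm \<Omega> v * grad_norm \<Omega> w * grad_norm \<Omega> z"
proof -
  have "convection_form \<Omega> v w (\<lambda>x. - z x) = - convection_form \<Omega> v w z"
    using convection_form_lincomb3[OF X(3,3,1,2), of "-1" 0] by simp
  moreover have "grad_norm \<Omega> (\<lambda>x. - z x) = grad_norm \<Omega> z"
    using X.form_lincomb_self[OF X(3,3), of "-1" 0] by (simp add: grad_norm_def)
  moreover have "convection_form \<Omega> v w y \<le> M * grad_norm \<Omega> v * grad_norm \<Omega> w * grad_norm \<Omega> y"
    if "y \<in> X_space \<Omega>" for y
    using M X(1,2) that by (auto simp: convection_constant_def)
  ultimately show ?thesis using X(3) X.uminus_closed[OF X(3)] by (smt (verit))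
qed

text \<open>
  On a field of positive gradient norm, a negative constant would bound an absolute value by a negative
  number.
\<close>

lemma convection_constant_nonneg:
  assumes M: "convection_constant \<Omega> M"
  shows "M \<ge> 0"
proof -
  obtain z where z: "z \<in> V_space \<Omega>" "grad_norm \<Omega> z > 0"
    by (rule divergence_free_field) (use dim in auto)
  have "0 \<le> M * grad_norm \<Omega> z * grad_norm \<Omega> z * grad_norm \<Omega> z"
    using convection_form_bound[OF M V_X V_X V_X, OF z(1) z(1) z(1)] by linarith
  then show ?thesis using z(2) by (simp add: zero_le_mult_iff)
qed

text \<open>
  By density: \<open>b(v,z,z) = b(v,z-\<Phi>,z) + b(v,\<Phi>,z-\<Phi>)\<close> for every smooth \<open>\<Phi>\<close>, and the right-hand side is
  small when \<open>\<Phi>\<close> is close to \<open>z\<close> in the gradient norm.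
\<close>

lemma convection_form_skew:
  assumes M: "convection_constant \<Omega> M" and v: "v \<in> V_space \<Omega>" and z: "z \<in> X_space \<Omega>"
  shows "convection_form \<Omega> v z z = 0"
proof -
  have vX: "v \<in> X_space \<Omega>" using v by (rule V_X)
  obtain \<Phi> where \<Phi>: "\<And>n j. (\<lambda>x. \<Phi> n x $ j) \<in> test_functions \<Omega>"
    "(\<lambda>n. grad_norm \<Omega> (\<lambda>x. z x - \<Phi> n x)) \<longlonglongrightarrow> 0"
    using X_approximation[OF z] by blast
  have \<Phi>X: "\<Phi> n \<in> X_space \<Omega>" for n by (simp add: X_space_def test_function_H10 \<Phi>(1))
  define d where "d n = grad_norm \<Omega> (\<lambda>x. z x - \<Phi> n x)" for n
  have M0: "M \<ge> 0" by (rule convection_constant_nonneg[OF M])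
  have nonneg: "grad_norm \<Omega> w \<ge> 0" if "w \<in> X_space \<Omega>" for w
    using X.nrm_nonneg[OF that] by (simp add: X_nrm_eq)
  have bound: "\<bar>convection_form \<Omega> v z z\<bar> \<le> M * grad_norm \<Omega> v * (d n * (2 * grad_norm \<Omega> z + d n))" for n
  proof -
    let ?e = "\<lambda>x. z x - \<Phi> n x"
    have e: "?e \<in> X_space \<Omega>" by (rule X.diff_closed[OF z \<Phi>X])
    have "convection_form \<Omega> v ?e z = convection_form \<Omega> v z z - convection_form \<Omega> v (\<Phi> n) z"
      using convection_form_lincomb2[OF z \<Phi>X[of n] vX z, of 1 "-1"] by simp
    moreover have "convection_form \<Omega> v (\<Phi> n) ?e = convection_form \<Omega> v (\<Phi> n) z - convection_form \<Omega> v (\<Phi> n) (\<Phi> n)"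
      using convection_form_lincomb3[OF z \<Phi>X[of n] vX \<Phi>X[of n], of 1 "-1"] by simp
    ultimately have "convection_form \<Omega> v z z = convection_form \<Omega> v ?e z + convection_form \<Omega> v (\<Phi> n) ?e"
      using convection_form_skew_smooth[OF v \<Phi>(1)] by simp
    then have "\<bar>convection_form \<Omega> v z z\<bar> \<le> \<bar>convection_form \<Omega> v ?e z\<bar> + \<bar>convection_form \<Omega> v (\<Phi> n) ?e\<bar>"
      by linarith
    also have "\<dots> \<le> M * grad_norm \<Omega> v * d n * grad_norm \<Omega> z + M * grad_norm \<Omega> v * grad_norm \<Omega> (\<Phi> n) * d n"
      unfolding d_def by (intro add_mono convection_form_bound[OF M] vX e z \<Phi>X)
    also have "\<dots> \<le> M * grad_norm \<Omega> v * d n * grad_norm \<Omega> z + M * grad_norm \<Omega> v * (grad_norm \<Omega> z + d n) * d n"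
    proof -
      have "grad_norm \<Omega> (\<Phi> n) \<le> grad_norm \<Omega> z + d n"
        using X.nrm_diff[OF z e] by (simp add: X_nrm_eq d_def)
      then show ?thesis
        using M0 nonneg[OF vX] nonneg[OF e] by (intro add_left_mono mult_right_mono mult_left_mono) (auto simp: d_def)
    qed
    finally show ?thesis by (simp add: algebra_simps)
  qed
  have "(\<lambda>n. M * grad_norm \<Omega> v * (d n * (2 * grad_norm \<Omega> z + d n))) \<longlonglongrightarrow> M * grad_norm \<Omega> v * (0 * (2 * grad_norm \<Omega> z + 0))"
    using \<Phi>(2) unfolding d_def[symmetric] by (intro tendsto_intros)
  then have "\<bar>convection_form \<Omega> v z z\<bar> \<le> M * grad_norm \<Omega> v * (0 * (2 * grad_norm \<Omega> z + 0))"
    by (rule LIMSEQ_le_const) (use bound in blast)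
  then show ?thesis by simp
qed

end

section \<open>Residual estimates for the Picard iteration\<close>

text \<open>
  An abstract form of the equations: \<open>A\<close> is the viscous form, \<open>b\<close> the convective form, \<open>F\<close> the
  force with bound \<open>L\<close>, and \<open>D\<close> the dual norm, of which only the properties of a finite supremum over
  a nonempty symmetric set are kept.
\<close>

locale picard_setting = semi_inner_space V A
  for V :: "('b \<Rightarrow> 'c::real_vector) set" and A +
  fixes b :: "('b \<Rightarrow> 'c) \<Rightarrow> ('b \<Rightarrow> 'c) \<Rightarrow> ('b \<Rightarrow> 'c) \<Rightarrow> real"
    and F :: "('b \<Rightarrow> 'c) \<Rightarrow> real" and D :: "(('b \<Rightarrow> 'c) \<Rightarrow> real) \<Rightarrow> real"
    and \<nu> M L \<kappa> :: real
  assumes nu_pos: "\<nu> > 0" and M_nonneg: "M \<ge> 0" and L_nonneg: "L \<ge> 0"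
    and kappa_def: "\<kappa> = M / \<nu>\<^sup>2 * L" and kappa_less: "\<kappa> < 1"
    and b_lincomb1: "\<lbrakk>u \<in> V; v \<in> V; w \<in> V; z \<in> V\<rbrakk> \<Longrightarrow>
          b (\<lambda>x. r *\<^sub>R u x + s *\<^sub>R v x) w z = r * b u w z + s * b v w z"
    and b_lincomb2: "\<lbrakk>u \<in> V; v \<in> V; w \<in> V; z \<in> V\<rbrakk> \<Longrightarrow>
          b w (\<lambda>x. r *\<^sub>R u x + s *\<^sub>R v x) z = r * b w u z + s * b w v z"
    and b_lincomb3: "\<lbrakk>u \<in> V; v \<in> V; w \<in> V; z \<in> V\<rbrakk> \<Longrightarrow>
          b w z (\<lambda>x. r *\<^sub>R u x + s *\<^sub>R v x) = r * b w z u + s * b w z v"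
    and b_skew: "\<lbrakk>v \<in> V; z \<in> V\<rbrakk> \<Longrightarrow> b v z z = 0"
    and b_bound: "\<lbrakk>v \<in> V; w \<in> V; z \<in> V\<rbrakk> \<Longrightarrow> \<bar>b v w z\<bar> \<le> M * nrm v * nrm w * nrm z"
    and F_lincomb: "\<lbrakk>u \<in> V; v \<in> V\<rbrakk> \<Longrightarrow> F (\<lambda>x. r *\<^sub>R u x + s *\<^sub>R v x) = r * F u + s * F v"
    and F_bound: "z \<in> V \<Longrightarrow> \<bar>F z\<bar> \<le> L * nrm z"
    and D_upper: "\<lbrakk>\<And>z. z \<in> V \<Longrightarrow> \<bar>G z\<bar> \<le> K * nrm z; z \<in> V\<rbrakk> \<Longrightarrow> G z \<le> D G * nrm z"
    and D_least: "\<lbrakk>\<And>z. z \<in> V \<Longrightarrow> G z \<le> K * nrm z; K \<ge> 0\<rbrakk> \<Longrightarrow> D G \<le> K"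
    and D_nonneg: "\<lbrakk>\<And>z. z \<in> V \<Longrightarrow> \<bar>G z\<bar> \<le> K * nrm z; \<And>z. z \<in> V \<Longrightarrow> G (\<lambda>x. - z x) = - G z\<rbrakk> \<Longrightarrow> D G \<ge> 0"
begin

definition g :: "('b \<Rightarrow> 'c) \<Rightarrow> ('b \<Rightarrow> 'c) \<Rightarrow> real" where
  "g v z = \<nu> * A v z + b v v z - F z"

definition picard :: "('b \<Rightarrow> 'c) \<Rightarrow> ('b \<Rightarrow> 'c) \<Rightarrow> bool" where
  "picard v w \<longleftrightarrow> w \<in> V \<and> (\<forall>z\<in>V. \<nu> * A w z + b v w z = F z)"

lemma A_diff: "\<lbrakk>u \<in> V; v \<in> V; z \<in> V\<rbrakk> \<Longrightarrow> A (\<lambda>x. u x - v x) z = A u z - A v z"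
  using form_lincomb[of u v z 1 "-1"] by simp

lemma b_diff1: "\<lbrakk>u \<in> V; v \<in> V; w \<in> V; z \<in> V\<rbrakk> \<Longrightarrow> b (\<lambda>x. u x - v x) w z = b u w z - b v w z"
  using b_lincomb1[of u v w z 1 "-1"] by simp

lemma b_diff2: "\<lbrakk>u \<in> V; v \<in> V; w \<in> V; z \<in> V\<rbrakk> \<Longrightarrow> b w (\<lambda>x. u x - v x) z = b w u z - b w v z"
  using b_lincomb2[of u v w z 1 "-1"] by simp

lemma kappa_nonneg: "\<kappa> \<ge> 0"
  using M_nonneg L_nonneg by (simp add: kappa_def)

lemma g_bound:
  assumes "v \<in> V" "z \<in> V"
  shows "\<bar>g v z\<bar> \<le> (\<nu> * nrm v + M * nrm v * nrm v + L) * nrm z"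
proof -
  have "\<bar>g v z\<bar> \<le> \<nu> * \<bar>A v z\<bar> + \<bar>b v v z\<bar> + \<bar>F z\<bar>"
  proof -
    have "\<bar>\<nu> * A v z\<bar> = \<nu> * \<bar>A v z\<bar>" using nu_pos by (simp add: abs_mult)
    then show ?thesis unfolding g_def by linarith
  qed
  also have "\<dots> \<le> \<nu> * (nrm v * nrm z) + M * nrm v * nrm v * nrm z + L * nrm z"
    using nu_pos assms by (intro add_mono mult_left_mono Cauchy_Schwarz b_bound F_bound) auto
  finally show ?thesis by (simp add: algebra_simps)
qed

lemma g_uminus: "v \<in> V \<Longrightarrow> z \<in> V \<Longrightarrow> g v (\<lambda>x. - z x) = - g v z"
  unfolding g_def
  using form_lincomb_right[of z z v "-1" 0] b_lincomb3[of z z v v "-1" 0] F_lincomb[of z z "-1" 0]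
  by simp

lemma g_le: "v \<in> V \<Longrightarrow> z \<in> V \<Longrightarrow> g v z \<le> D (g v) * nrm z"
  by (rule D_upper[OF g_bound])

lemma D_g_nonneg: "v \<in> V \<Longrightarrow> D (g v) \<ge> 0"
  by (rule D_nonneg[OF g_bound g_uminus])

lemma picard_closed: "picard v w \<Longrightarrow> w \<in> V"
  by (simp add: picard_def)

text \<open>
  Energy estimates have this form: a squared norm is bounded by a multiple of the norm.
\<close>

lemma le_of_square_le: "0 \<le> x \<Longrightarrow> 0 \<le> c \<Longrightarrow> x\<^sup>2 \<le> c * x \<Longrightarrow> x \<le> (c :: real)"
  by (cases "x = 0") (auto simp: power2_eq_square)

text \<open>
  Subtracting the Picard equation turns \<open>g v\<close> into \<open>\<nu> A (v - w) + b v (v - w)\<close>. Tested with \<open>v - w\<close>, the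
  convective part drops out by skew-symmetry.
\<close>

lemma picard_increment:
  assumes v: "v \<in> V" and vw: "picard v w"
  shows "nrm (\<lambda>x. v x - w x) \<le> D (g v) / \<nu>"
proof -
  define e where "e = (\<lambda>x. v x - w x)"
  have w: "w \<in> V" using vw by (rule picard_closed)
  have e: "e \<in> V" unfolding e_def using v w by (rule diff_closed)
  have "\<nu> * A e e = \<nu> * A v e - \<nu> * A w e"
    using A_diff[OF v w e] by (simp add: e_def right_diff_distrib)
  moreover have "b v e e = b v v e - b v w e"
    using b_diff2[OF v w v e] by (simp add: e_def)
  moreover have "\<nu> * A w e + b v w e = F e" using vw e by (simp add: picard_def)
  ultimately have "\<nu> * A e e + b v e e = g v e" by (simp add: g_def algebra_simps)
  then have "\<nu> * (nrm e)\<^sup>2 = g v e" using b_skew[OF v e] nrm_square[OF e] by simp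
  then have "(nrm e)\<^sup>2 \<le> D (g v) / \<nu> * nrm e"
    using g_le[OF v e] nu_pos by (simp add: field_simps)
  then show ?thesis
    using le_of_square_le[of "nrm e" "D (g v) / \<nu>"] nrm_nonneg[OF e] D_g_nonneg[OF v] nu_pos
    by (simp add: e_def)
qed

text \<open>
  The Picard equation tested with its own solution.
\<close>

lemma picard_norm:
  assumes v: "v \<in> V" and vw: "picard v w"
  shows "nrm w \<le> L / \<nu>"
proof -
  have w: "w \<in> V" using vw by (rule picard_closed)
  have "\<nu> * (nrm w)\<^sup>2 = F w"
    using vw w b_skew[OF v w] nrm_square[OF w] by (auto simp: picard_def)
  then have "(nrm w)\<^sup>2 \<le> L / \<nu> * nrm w"
    using F_bound[OF w] nu_pos by (simp add: field_simps)
  then show ?thesis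
    using le_of_square_le[of "nrm w" "L / \<nu>"] nrm_nonneg[OF w] L_nonneg nu_pos by simp
qed

text \<open>
  The difference of the two equations, tested with \<open>e = w - w'\<close>, is \<open>\<nu> A e e = - b (v - v') w' e\<close> by
  skew-symmetry.
\<close>

lemma picard_contraction:
  assumes v: "v \<in> V" "v' \<in> V" and vw: "picard v w" "picard v' w'"
  shows "nrm (\<lambda>x. w x - w' x) \<le> \<kappa> * nrm (\<lambda>x. v x - v' x)"
proof -
  define e where "e = (\<lambda>x. w x - w' x)"
  define d where "d = (\<lambda>x. v x - v' x)"
  have w: "w \<in> V" "w' \<in> V" using vw by (auto intro: picard_closed)
  have e: "e \<in> V" and d: "d \<in> V"
    unfolding e_def d_def using v w by (auto intro: diff_closed)
  have "\<nu> * A e e = \<nu> * A w e - \<nu> * A w' e"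
    using A_diff[OF w e] by (simp add: e_def right_diff_distrib)
  moreover have "b v e e = b v w e - b v w' e"
    using b_diff2[OF w v(1) e] by (simp add: e_def)
  moreover have "b d w' e = b v w' e - b v' w' e"
    using b_diff1[OF v w(2) e] by (simp add: d_def)
  moreover have "\<nu> * A w e + b v w e = F e" "\<nu> * A w' e + b v' w' e = F e"
    using vw e by (auto simp: picard_def)
  ultimately have "\<nu> * A e e = - b d w' e"
    using b_skew[OF v(1) e] by (simp add: algebra_simps)
  then have "\<nu> * (nrm e)\<^sup>2 \<le> M * nrm d * nrm w' * nrm e"
    using b_bound[OF d w(2) e] nrm_square[OF e] by simp
  also have "\<dots> \<le> M * nrm d * (L / \<nu>) * nrm e"
    using picard_norm[OF v(2) vw(2)] M_nonneg nrm_nonneg[OF d] nrm_nonneg[OF e]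
    by (intro mult_right_mono mult_left_mono) auto
  finally have "(nrm e)\<^sup>2 \<le> (\<kappa> * nrm d) * nrm e"
    using nu_pos by (simp add: kappa_def field_simps power2_eq_square)
  then show ?thesis
    using le_of_square_le[of "nrm e" "\<kappa> * nrm d"] nrm_nonneg[OF e] nrm_nonneg[OF d] kappa_nonneg
    by (simp add: e_def d_def)
qed

text \<open>
  By the Picard equation, \<open>g w\<close> reduces to \<open>b (w - v) w\<close>.
\<close>

lemma residual_picard:
  assumes v: "v \<in> V" and vw: "picard v w"
  shows "D (g w) \<le> \<kappa> * D (g v)"
proof (rule D_least)
  have w: "w \<in> V" using vw by (rule picard_closed)
  define e where "e = (\<lambda>x. w x - v x)"
  have e: "e \<in> V" unfolding e_def using w v by (rule diff_closed)
  have ne: "nrm e \<le> D (g v) / \<nu>"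
    using picard_increment[OF v vw] nrm_minus_commute[OF v w] by (simp add: e_def)
  show "g w z \<le> \<kappa> * D (g v) * nrm z" if z: "z \<in> V" for z
  proof -
    have "b e w z = b w w z - b v w z"
      using b_diff1[OF w v w z] by (simp add: e_def)
    then have "g w z = b e w z"
      using vw z by (auto simp: g_def picard_def algebra_simps)
    also have "\<dots> \<le> M * nrm e * nrm w * nrm z"
      using b_bound[OF e w z] by simp
    also have "\<dots> \<le> M * (D (g v) / \<nu>) * (L / \<nu>) * nrm z"
      using ne picard_norm[OF v vw] M_nonneg nrm_nonneg[OF e] nrm_nonneg[OF w] nrm_nonneg[OF z]
        D_g_nonneg[OF v] nu_pos
      by (intro mult_right_mono mult_mono mult_left_mono) auto
    also have "\<dots> = \<kappa> * D (g v) * nrm z"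
      by (simp add: kappa_def field_simps power2_eq_square)
    finally show ?thesis .
  qed
  show "0 \<le> \<kappa> * D (g v)" using kappa_nonneg D_g_nonneg[OF v] by simp
qed

text \<open>
  From \<open>v\<close> to \<open>w\<close>, on to \<open>w'\<close>, and back to \<open>v'\<close>: the outer distances are bounded by residuals, and the
  middle one is absorbed because the Picard map is a contraction.
\<close>

lemma distance_residual:
  assumes v: "v \<in> V" "v' \<in> V" and vw: "picard v w" "picard v' w'"
  shows "nrm (\<lambda>x. v x - v' x) \<le> (D (g v) + D (g v')) / (\<nu> * (1 - \<kappa>))"
proof -
  have w: "w \<in> V" "w' \<in> V" using vw by (auto intro: picard_closed)
  have "nrm (\<lambda>x. v x - v' x) \<le> nrm (\<lambda>x. v x - w x) + nrm (\<lambda>x. w x - v' x)"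
    using nrm_triangle v w by blast
  also have "nrm (\<lambda>x. w x - v' x) \<le> nrm (\<lambda>x. w x - w' x) + nrm (\<lambda>x. w' x - v' x)"
    using nrm_triangle v w by blast
  finally have "nrm (\<lambda>x. v x - v' x) \<le> nrm (\<lambda>x. v x - w x) + nrm (\<lambda>x. w x - w' x) + nrm (\<lambda>x. v' x - w' x)"
    using nrm_minus_commute[OF v(2) w(2)] by simp
  also have "\<dots> \<le> D (g v) / \<nu> + \<kappa> * nrm (\<lambda>x. v x - v' x) + D (g v') / \<nu>"
    by (intro add_mono picard_increment picard_contraction v vw)
  finally have "(1 - \<kappa>) * nrm (\<lambda>x. v x - v' x) \<le> (D (g v) + D (g v')) / \<nu>"
    by (simp add: algebra_simps add_divide_distrib)
  then have "nrm (\<lambda>x. v x - v' x) \<le> (D (g v) + D (g v')) / \<nu> / (1 - \<kappa>)"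
    using kappa_less by (metis diff_gt_0_iff_gt mult.commute pos_le_divide_eq)
  then show ?thesis by simp
qed

text \<open>
  For a bilinear form \<open>b\<close> and weights with sum \<open>1\<close>, the mean of \<open>b(w\<^sub>i,w\<^sub>i)\<close> exceeds \<open>b(u,u)\<close> at the mean
  \<open>u\<close> by the variance; all other parts of the residual are affine.
\<close>

lemma residual_affine_combination:
  assumes I: "finite I" "(\<Sum>i\<in>I. \<alpha> i) = 1" and w: "\<And>i. i \<in> I \<Longrightarrow> w i \<in> V" and z: "z \<in> V"
    and u: "u = (\<lambda>x. \<Sum>i\<in>I. \<alpha> i *\<^sub>R w i x)"
  shows "g u z = (\<Sum>i\<in>I. \<alpha> i * g (w i) z)
     - (\<Sum>i\<in>I. \<alpha> i * b (\<lambda>x. w i x - u x) (\<lambda>x. w i x - u x) z)"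
proof -
  have uV: "u \<in> V" unfolding u by (rule sum_closed[OF w])
  have Au: "A u z = (\<Sum>i\<in>I. \<alpha> i * A (w i) z)"
    unfolding u by (rule linear_sum[of "\<lambda>y. A y z"]) (auto intro: form_lincomb z w)
  have b1: "b u u z = (\<Sum>i\<in>I. \<alpha> i * b (w i) u z)"
    by (subst (1) u) (rule linear_sum[of "\<lambda>y. b y u z"], auto intro: b_lincomb1 z w uV)
  have b2: "b u u z = (\<Sum>i\<in>I. \<alpha> i * b u (w i) z)"
    by (subst (2) u) (rule linear_sum[of "\<lambda>y. b u y z"], auto intro: b_lincomb2 z w uV)
  have bd: "b (\<lambda>x. w i x - u x) (\<lambda>x. w i x - u x) z = b (w i) (w i) z - b (w i) u z - b u (w i) z + b u u z"
    if "i \<in> I" for i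
  proof -
    have d: "(\<lambda>x. w i x - u x) \<in> V" using w[OF that] uV by (rule diff_closed)
    show ?thesis
      using b_diff1[OF w[OF that] uV d z] b_diff2[OF w[OF that] uV w[OF that] z]
        b_diff2[OF w[OF that] uV uV z]
      by simp
  qed
  have "(\<Sum>i\<in>I. \<alpha> i * b (\<lambda>x. w i x - u x) (\<lambda>x. w i x - u x) z)
     = (\<Sum>i\<in>I. \<alpha> i * b (w i) (w i) z - \<alpha> i * b (w i) u z - \<alpha> i * b u (w i) z + \<alpha> i * b u u z)"
    by (rule sum.cong) (auto simp: bd algebra_simps)
  also have "\<dots> = (\<Sum>i\<in>I. \<alpha> i * b (w i) (w i) z) - b u u z"
    using b1 b2 I(2) by (simp add: sum.distrib sum_subtractf flip: sum_distrib_right)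
  finally have *: "(\<Sum>i\<in>I. \<alpha> i * b (\<lambda>x. w i x - u x) (\<lambda>x. w i x - u x) z)
    = (\<Sum>i\<in>I. \<alpha> i * b (w i) (w i) z) - b u u z" .
  have "(\<Sum>i\<in>I. \<alpha> i * g (w i) z)
      = (\<Sum>i\<in>I. \<nu> * (\<alpha> i * A (w i) z) + \<alpha> i * b (w i) (w i) z - \<alpha> i * F z)"
    by (rule sum.cong) (auto simp: g_def algebra_simps)
  also have "\<dots> = \<nu> * A u z + (\<Sum>i\<in>I. \<alpha> i * b (w i) (w i) z) - F z"
    using Au I(2) by (simp add: sum.distrib sum_subtractf flip: sum_distrib_right sum_distrib_left)
  finally show ?thesis using * by (simp add: g_def)
qed

lemma combination_bound:
  assumes w: "\<And>i. i \<in> I \<Longrightarrow> w i \<in> V" and z: "z \<in> V"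
  shows "\<bar>\<Sum>i\<in>I. \<alpha> i * g (w i) z\<bar>
    \<le> (\<Sum>i\<in>I. \<bar>\<alpha> i\<bar> * (\<nu> * nrm (w i) + M * nrm (w i) * nrm (w i) + L)) * nrm z"
proof -
  have "\<bar>\<Sum>i\<in>I. \<alpha> i * g (w i) z\<bar> \<le> (\<Sum>i\<in>I. \<bar>\<alpha> i\<bar> * \<bar>g (w i) z\<bar>)"
    using sum_abs[of "\<lambda>i. \<alpha> i * g (w i) z" I] by (simp add: abs_mult)
  also have "\<dots> \<le> (\<Sum>i\<in>I. \<bar>\<alpha> i\<bar> * ((\<nu> * nrm (w i) + M * nrm (w i) * nrm (w i) + L) * nrm z))"
    by (intro sum_mono mult_left_mono g_bound w z) auto
  finally show ?thesis by (simp add: sum_distrib_right mult.assoc)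
qed

lemma combination_nonneg:
  assumes w: "\<And>i. i \<in> I \<Longrightarrow> w i \<in> V"
  shows "D (\<lambda>z. \<Sum>i\<in>I. \<alpha> i * g (w i) z) \<ge> 0"
  by (rule D_nonneg[OF combination_bound[OF w]]) (auto simp: g_uminus w sum_negf)

text \<open>
  The distances from \<open>w i\<close> to the combination \<open>u\<close> are controlled by those to an arbitrary reference
  field \<open>c\<close>, because the weights of \<open>u - c\<close> are bounded.
\<close>

lemma affine_combination_residual_le:
  fixes a r N :: real
  assumes I: "finite I" "(\<Sum>i\<in>I. \<alpha> i) = 1" and w: "\<And>i. i \<in> I \<Longrightarrow> w i \<in> V"
    and u: "u = (\<lambda>x. \<Sum>i\<in>I. \<alpha> i *\<^sub>R w i x)"
    and a: "\<And>i. i \<in> I \<Longrightarrow> \<bar>\<alpha> i\<bar> \<le> a"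
    and c: "c \<in> V" "\<And>i. i \<in> I \<Longrightarrow> nrm (\<lambda>x. w i x - c x) \<le> r"
    and N: "N = real (card I)"
  shows "D (g u) \<le> D (\<lambda>z. \<Sum>i\<in>I. \<alpha> i * g (w i) z) + N * a * M * ((1 + N * a) * r)\<^sup>2"
proof (rule D_least)
  have uV: "u \<in> V" unfolding u by (rule sum_closed[OF w])
  obtain i0 where i0: "i0 \<in> I" using I(2) by (cases "I = {}") auto
  have a0: "a \<ge> 0" using a[OF i0] by simp
  have r0: "r \<ge> 0" using c(2)[OF i0] nrm_nonneg[OF diff_closed[OF w[OF i0] c(1)]] by simp
  have "(\<lambda>x. u x - c x) = (\<lambda>x. \<Sum>i\<in>I. \<alpha> i *\<^sub>R (w i x - c x))"
    using I by (simp add: u scaleR_diff_right sum_subtractf flip: scaleR_left.sum)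
  then have "nrm (\<lambda>x. u x - c x) \<le> (\<Sum>i\<in>I. \<bar>\<alpha> i\<bar> * nrm (\<lambda>x. w i x - c x))"
    using nrm_sum[of I "\<lambda>i x. w i x - c x" \<alpha>] diff_closed[OF w c(1)] by simp
  also have "\<dots> \<le> (\<Sum>i\<in>I. a * r)"
    using a c(2) a0 nrm_nonneg[OF diff_closed[OF w c(1)]] by (intro sum_mono mult_mono) auto
  finally have uc: "nrm (\<lambda>x. u x - c x) \<le> N * a * r" by (simp add: N)
  have wu: "nrm (\<lambda>x. w i x - u x) \<le> (1 + N * a) * r" if "i \<in> I" for i
    using nrm_triangle[OF w[OF that] c(1) uV] nrm_minus_commute[OF uV c(1)] c(2)[OF that] uc
    by (simp add: algebra_simps)
  let ?K = "N * a * M * ((1 + N * a) * r)\<^sup>2"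
  show "g u z \<le> (D (\<lambda>z. \<Sum>i\<in>I. \<alpha> i * g (w i) z) + ?K) * nrm z" if z: "z \<in> V" for z
  proof -
    have "- (\<Sum>i\<in>I. \<alpha> i * b (\<lambda>x. w i x - u x) (\<lambda>x. w i x - u x) z)
        \<le> (\<Sum>i\<in>I. \<bar>\<alpha> i\<bar> * \<bar>b (\<lambda>x. w i x - u x) (\<lambda>x. w i x - u x) z\<bar>)"
      using sum_abs[of "\<lambda>i. \<alpha> i * b (\<lambda>x. w i x - u x) (\<lambda>x. w i x - u x) z" I] by (simp add: abs_mult)
    also have "\<dots> \<le> (\<Sum>i\<in>I. a * (M * ((1 + N * a) * r) * ((1 + N * a) * r) * nrm z))"
    proof (intro sum_mono mult_mono)
      fix i assume i: "i \<in> I"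
      have d: "(\<lambda>x. w i x - u x) \<in> V" using w[OF i] uV by (rule diff_closed)
      have "\<bar>b (\<lambda>x. w i x - u x) (\<lambda>x. w i x - u x) z\<bar>
          \<le> M * nrm (\<lambda>x. w i x - u x) * nrm (\<lambda>x. w i x - u x) * nrm z"
        by (rule b_bound[OF d d z])
      also have "\<dots> \<le> M * ((1 + N * a) * r) * ((1 + N * a) * r) * nrm z"
        using wu[OF i] M_nonneg nrm_nonneg[OF d] nrm_nonneg[OF z] a0 r0
        by (intro mult_right_mono mult_mono mult_left_mono) auto
      finally show "\<bar>b (\<lambda>x. w i x - u x) (\<lambda>x. w i x - u x) z\<bar>
          \<le> M * ((1 + N * a) * r) * ((1 + N * a) * r) * nrm z" .
    qed (use a a0 in auto)
    also have "\<dots> = ?K * nrm z" by (simp add: power2_eq_square N)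
    finally have "- (\<Sum>i\<in>I. \<alpha> i * b (\<lambda>x. w i x - u x) (\<lambda>x. w i x - u x) z) \<le> ?K * nrm z" .
    moreover have "(\<Sum>i\<in>I. \<alpha> i * g (w i) z) \<le> D (\<lambda>z. \<Sum>i\<in>I. \<alpha> i * g (w i) z) * nrm z"
      by (rule D_upper[OF combination_bound z]) (rule w)
    ultimately show ?thesis
      using residual_affine_combination[OF I w z u] by (simp add: distrib_right)
  qed
  show "0 \<le> D (\<lambda>z. \<Sum>i\<in>I. \<alpha> i * g (w i) z) + ?K"
    using combination_nonneg[of I w \<alpha>] w a0 M_nonneg N by simp
qed

text \<open>
  The reference field is the current iterate \<open>w k\<close>. Its distance to its Picard image \<open>w n\<close> and to the
  earlier iterates is at most \<open>2 / (\<nu> (1 - \<kappa>))\<close> times the sum of the residual norms, whose square is bounded by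
  the sum of squares via the Cauchy-Schwarz inequality.
\<close>

lemma ngmres_step:
  fixes a N :: real
  assumes J: "finite J" "k \<in> J" "n \<notin> J"
    and w: "\<And>i. i \<in> J \<Longrightarrow> w i \<in> V" "\<And>i. i \<in> J \<Longrightarrow> picard (w i) (q i)" "w n = q k"
    and \<alpha>: "(\<Sum>i\<in>insert n J. \<alpha> i) = 1" "\<And>i. i \<in> insert n J \<Longrightarrow> \<bar>\<alpha> i\<bar> \<le> a"
    and u: "u = (\<lambda>x. \<Sum>i\<in>insert n J. \<alpha> i *\<^sub>R w i x)"
    and N: "N = real (card (insert n J))"
  shows "D (g u) \<le> D (\<lambda>z. \<Sum>i\<in>insert n J. \<alpha> i * g (w i) z)
    + N * a * M * ((1 + N * a) * (2 / (\<nu> * (1 - \<kappa>))))\<^sup>2 * N * (\<Sum>i\<in>J. (D (g (w i)))\<^sup>2)"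
proof -
  let ?s = "\<Sum>i\<in>J. D (g (w i))"
  let ?c = "2 / (\<nu> * (1 - \<kappa>))"
  have wV: "w i \<in> V" if "i \<in> insert n J" for i
    using that w J picard_closed[OF w(2)[OF J(2)]] by auto
  have nonneg: "D (g (w i)) \<ge> 0" if "i \<in> J" for i using D_g_nonneg w that by blast
  have le_s: "D (g (w i)) \<le> ?s" if "i \<in> J" for i
    using member_le_sum[OF that, of "\<lambda>i. D (g (w i))"] nonneg J(1) by auto
  have s0: "?s \<ge> 0" using nonneg by (rule sum_nonneg)
  have den: "\<nu> * (1 - \<kappa>) > 0" using nu_pos kappa_less by simp
  have "nrm (\<lambda>x. w i x - w k x) \<le> ?c * ?s" if i: "i \<in> insert n J" for i
  proof (cases "i = n")
    case True
    have "nrm (\<lambda>x. w n x - w k x) \<le> D (g (w k)) / \<nu>"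
      using picard_increment[OF w(1,2)[OF J(2)]] nrm_minus_commute[OF wV wV, of n k] w(3) J(2) by simp
    also have "\<dots> \<le> ?s / \<nu>" using le_s[OF J(2)] nu_pos by (simp add: divide_right_mono)
    also have "\<dots> \<le> ?s / \<nu> * (2 / (1 - \<kappa>))"
    proof -
      have "1 \<le> 2 / (1 - \<kappa>)" using kappa_nonneg kappa_less by (simp add: field_simps)
      then have "?s / \<nu> * 1 \<le> ?s / \<nu> * (2 / (1 - \<kappa>))"
        by (rule mult_left_mono) (use s0 nu_pos in simp)
      then show ?thesis by simp
    qed
    finally show ?thesis using True by (simp add: mult.commute)
  next
    case False
    then have "i \<in> J" using i by simp
    then have "nrm (\<lambda>x. w i x - w k x) \<le> (D (g (w i)) + D (g (w k))) / (\<nu> * (1 - \<kappa>))"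
      using distance_residual[OF w(1) w(1) w(2) w(2)] J(2) by blast
    also have "\<dots> \<le> (?s + ?s) / (\<nu> * (1 - \<kappa>))"
      using den le_s[OF J(2)] le_s[OF \<open>i \<in> J\<close>] by (intro divide_right_mono add_mono) auto
    finally show ?thesis by simp
  qed
  from affine_combination_residual_le[OF _ \<alpha>(1) wV u \<alpha>(2) w(1)[OF J(2)] this N]
  have "D (g u) \<le> D (\<lambda>z. \<Sum>i\<in>insert n J. \<alpha> i * g (w i) z) + N * a * M * ((1 + N * a) * (?c * ?s))\<^sup>2"
    using J(1) by simp
  also have "N * a * M * ((1 + N * a) * (?c * ?s))\<^sup>2 = N * a * M * ((1 + N * a) * ?c)\<^sup>2 * ?s\<^sup>2"
    by (simp only: power_mult_distrib mult.assoc)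
  also have "\<dots> \<le> N * a * M * ((1 + N * a) * ?c)\<^sup>2 * (N * (\<Sum>i\<in>J. (D (g (w i)))\<^sup>2))"
  proof (rule mult_left_mono)
    have "?s\<^sup>2 \<le> (\<Sum>i\<in>J. 1\<^sup>2) * (\<Sum>i\<in>J. (D (g (w i)))\<^sup>2)"
      using Cauchy_Schwarz_ineq_sum[of "\<lambda>_. 1" "\<lambda>i. D (g (w i))" J] by simp
    also have "\<dots> \<le> N * (\<Sum>i\<in>J. (D (g (w i)))\<^sup>2)"
      using J N by (intro mult_right_mono sum_nonneg) auto
    finally show "?s\<^sup>2 \<le> N * (\<Sum>i\<in>J. (D (g (w i)))\<^sup>2)" .
    show "0 \<le> N * a * M * ((1 + N * a) * ?c)\<^sup>2"
      using N \<alpha>(2)[of n] M_nonneg by simp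
  qed
  finally show ?thesis by (simp add: mult.assoc)
qed

end

section \<open>Dual norms\<close>

context flow_domain
begin

lemma zero_AE_grad_norm:
  assumes "AE x in MU. z x = 0"
  shows "grad_norm \<Omega> z = 0"
proof -
  have "grad_inner \<Omega> z z = grad_inner \<Omega> (\<lambda>_. 0) z" by (rule grad_inner_cong[OF assms])
  also have "\<dots> = grad_inner \<Omega> z (\<lambda>_. 0)" by (simp add: grad_inner_def L2_inner_def mult.commute)
  also have "\<dots> = grad_inner \<Omega> (\<lambda>_. 0) (\<lambda>_. 0)" by (rule grad_inner_cong[OF assms])
  also have "\<dots> = 0"
    using X.form_lincomb[OF X.zero_closed X.zero_closed X.zero_closed, of 0 0] by simp
  finally show ?thesis by (simp add: grad_norm_def)
qed

text \<open>
  A field of gradient norm zero has to be treated separately: there the quotient in the definition is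
  \<open>0\<close> by the convention for division, and the functional vanishes by its bound.
\<close>

lemma dual_norm_upper:
  assumes W: "W \<subseteq> X_space \<Omega>" and G: "\<And>z. z \<in> W \<Longrightarrow> \<bar>G z\<bar> \<le> K * grad_norm \<Omega> z" and z: "z \<in> W"
  shows "G z \<le> dual_norm \<Omega> W G * grad_norm \<Omega> z"
proof (cases "grad_norm \<Omega> z = 0")
  case True
  then show ?thesis using G[OF z] by simp
next
  case False
  have nonneg: "grad_norm \<Omega> y \<ge> 0" if "y \<in> W" for y
    using X.nrm_nonneg W that by (auto simp: X_nrm_eq)
  then have pos: "grad_norm \<Omega> z > 0" using z False by (simp add: less_le)
  have "G z / grad_norm \<Omega> z \<le> dual_norm \<Omega> W G"
    unfolding dual_norm_def
  proof (rule cSup_upper)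
    show "G z / grad_norm \<Omega> z \<in> {G z / grad_norm \<Omega> z | z. z \<in> W \<and> \<not> (AE x in MU. z x = 0)}"
      using z False zero_AE_grad_norm by blast
    show "bdd_above {G z / grad_norm \<Omega> z | z. z \<in> W \<and> \<not> (AE x in MU. z x = 0)}"
    proof (rule bdd_aboveI)
      fix t assume "t \<in> {G z / grad_norm \<Omega> z | z. z \<in> W \<and> \<not> (AE x in MU. z x = 0)}"
      then obtain y where y: "t = G y / grad_norm \<Omega> y" "y \<in> W" by blast
      show "t \<le> \<bar>K\<bar>"
      proof (cases "grad_norm \<Omega> y = 0")
        case False
        then have "grad_norm \<Omega> y > 0" using nonneg[OF y(2)] by simp
        then have "t \<le> K" using G[OF y(2)] y(1) by (simp add: pos_divide_le_eq)
        then show ?thesis by simp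
      qed (simp add: y)
    qed
  qed
  then show ?thesis using pos by (simp add: field_simps)
qed

lemma dual_norm_least:
  assumes W: "W \<subseteq> X_space \<Omega>" and z0: "z0 \<in> W" "grad_norm \<Omega> z0 > 0"
    and G: "\<And>z. z \<in> W \<Longrightarrow> G z \<le> K * grad_norm \<Omega> z" and K: "K \<ge> 0"
  shows "dual_norm \<Omega> W G \<le> K"
  unfolding dual_norm_def
proof (rule cSup_least)
  show "{G z / grad_norm \<Omega> z | z. z \<in> W \<and> \<not> (AE x in MU. z x = 0)} \<noteq> {}"
    using z0 zero_AE_grad_norm[of z0] by auto
  fix t assume "t \<in> {G z / grad_norm \<Omega> z | z. z \<in> W \<and> \<not> (AE x in MU. z x = 0)}"
  then obtain y where y: "t = G y / grad_norm \<Omega> y" "y \<in> W" by blast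
  have "grad_norm \<Omega> y \<ge> 0" using X.nrm_nonneg W y(2) by (auto simp: X_nrm_eq)
  then show "t \<le> K"
    using G[OF y(2)] y(1) K by (cases "grad_norm \<Omega> y = 0") (simp_all add: pos_divide_le_eq)
qed

lemma dual_norm_nonneg:
  assumes W: "W \<subseteq> X_space \<Omega>" and z0: "z0 \<in> W" "(\<lambda>x. - z0 x) \<in> W" "grad_norm \<Omega> z0 > 0"
    and G: "\<And>z. z \<in> W \<Longrightarrow> \<bar>G z\<bar> \<le> K * grad_norm \<Omega> z" "G (\<lambda>x. - z0 x) = - G z0"
  shows "dual_norm \<Omega> W G \<ge> 0"
proof -
  have "grad_norm \<Omega> (\<lambda>x. - z0 x) = grad_norm \<Omega> z0"
    using X.form_lincomb_self[of z0 z0 "-1" 0] z0(1) W by (auto simp: grad_norm_def)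
  then have "- G z0 \<le> dual_norm \<Omega> W G * grad_norm \<Omega> z0"
    using dual_norm_upper[OF W G(1) z0(2)] G(2) by simp
  moreover have "G z0 \<le> dual_norm \<Omega> W G * grad_norm \<Omega> z0"
    by (rule dual_norm_upper[OF W G(1) z0(1)])
  ultimately have "0 \<le> dual_norm \<Omega> W G * grad_norm \<Omega> z0" by linarith
  then show ?thesis using z0(3) by (simp add: zero_le_mult_iff)
qed

lemma Hm1_lincomb:
  "f \<in> Hm1 \<Omega> \<Longrightarrow> v \<in> X_space \<Omega> \<Longrightarrow> w \<in> X_space \<Omega> \<Longrightarrow>
    f (\<lambda>x. a *\<^sub>R v x + b *\<^sub>R w x) = a * f v + b * f w"
  unfolding Hm1_def by blast

lemma Hm1_norm_bound:
  assumes f: "f \<in> Hm1 \<Omega>" and z: "z \<in> X_space \<Omega>"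
  shows "\<bar>f z\<bar> \<le> Hm1_norm \<Omega> f * grad_norm \<Omega> z"
proof -
  obtain K where K: "\<And>v. v \<in> X_space \<Omega> \<Longrightarrow> \<bar>f v\<bar> \<le> K * grad_norm \<Omega> v"
    using f unfolding Hm1_def by blast
  have "f (\<lambda>x. - z x) = - f z" using Hm1_lincomb[OF f z z, of "-1" 0] by simp
  moreover have "grad_norm \<Omega> (\<lambda>x. - z x) = grad_norm \<Omega> z"
    using X.form_lincomb_self[OF z z, of "-1" 0] by (simp add: grad_norm_def)
  ultimately show ?thesis
    using dual_norm_upper[OF subset_refl K z] dual_norm_upper[OF subset_refl K X.uminus_closed[OF z]] by simp
qed

text \<open>
  The functionals are bounded on \<open>V_space \<Omega>\<close>, so their dual norms are finite suprema, and these are taken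
  over a nonempty set by \<open>divergence_free_field\<close>.
\<close>

lemma picard_setting:
  assumes "\<nu> > 0" "\<kappa> < 1" "f \<in> Hm1 \<Omega>" "convection_constant \<Omega> M" "\<kappa> = M / \<nu>\<^sup>2 * Hm1_norm \<Omega> f"
  shows "picard_setting (V_space \<Omega>) (grad_inner \<Omega>) (convection_form \<Omega>) f (Vdual_norm \<Omega>) \<nu> M (Hm1_norm \<Omega> f) \<kappa>"
proof -
  obtain z0 where z0: "z0 \<in> V_space \<Omega>" "grad_norm \<Omega> z0 > 0"
    by (rule divergence_free_field) (use dim in auto)
  have VX: "V_space \<Omega> \<subseteq> X_space \<Omega>" using V_X by blast
  show ?thesis
  proof (unfold_locales, goal_cases)
    case 3
    have z0X: "z0 \<in> X_space \<Omega>" using z0 V_X by blast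
    have "f (\<lambda>x. - z0 x) = - f z0" using Hm1_lincomb[OF assms(3) z0X z0X, of "-1" 0] by simp
    then show ?case
      using dual_norm_nonneg[OF subset_refl z0X X.uminus_closed[OF z0X] z0(2)] Hm1_norm_bound[OF assms(3)] by blast
  next
    case (15 G K)
    then show ?case
      using dual_norm_nonneg[OF VX z0(1) V.uminus_closed[OF z0(1)] z0(2), of G K] z0(1) by (simp add: V_nrm_eq)
  next
    case (13 G K z)
    then show ?case using dual_norm_upper[OF VX, of G K z] by (simp add: V_nrm_eq)
  next
    case (14 G K)
    then show ?case using dual_norm_least[OF VX z0, of G K] by (simp add: V_nrm_eq)
  next
    case (11 u v r s)
    then show ?case by (intro Hm1_lincomb[OF assms(3)] V_X)
  next
    case (12 z)
    then show ?case using Hm1_norm_bound[OF assms(3) V_X] by (simp add: V_nrm_eq)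
  next
    case (9 v z)
    then show ?case by (intro convection_form_skew[OF assms(4)] V_X)
  next
    case (10 v w z)
    then show ?case using convection_form_bound[OF assms(4) V_X V_X V_X] by (simp add: V_nrm_eq)
  next
    case 2
    then show ?case by (rule convection_constant_nonneg[OF assms(4)])
  qed (use assms convection_form_lincomb1 convection_form_lincomb2 convection_form_lincomb3 V_X in auto)
qed

lemma NGMRES_in_V:
  assumes "NGMRES \<Omega> \<nu> f m u ut \<alpha>"
  shows "u k \<in> V_space \<Omega>"
proof (induction k rule: less_induct)
  case (less k)
  show ?case
  proof (cases k)
    case 0
    then show ?thesis using assms by (simp add: NGMRES_def)
  next
    case (Suc l)
    have ut: "ut (Suc l) \<in> V_space \<Omega>" using assms by (auto simp: NGMRES_def is_picard_def)
    have sum: "(\<lambda>x. \<Sum>i = l - min m l..l. \<alpha> (Suc l) i *\<^sub>R u i x) \<in> V_space \<Omega>"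
      by (rule V.sum_closed) (use less Suc in auto)
    have "(\<lambda>x. \<alpha> (Suc l) (Suc l) *\<^sub>R ut (Suc l) x + (\<Sum>i = l - min m l..l. \<alpha> (Suc l) i *\<^sub>R u i x)) \<in> V_space \<Omega>"
      using V.lincomb_closed[OF ut sum, of "\<alpha> (Suc l) (Suc l)" 1] by simp
    moreover have "AE x in MU. u (Suc l) x = \<alpha> (Suc l) (Suc l) *\<^sub>R ut (Suc l) x + (\<Sum>i = l - min m l..l. \<alpha> (Suc l) i *\<^sub>R u i x)"
      using assms by (simp add: NGMRES_def)
    then have "AE x in MU. \<alpha> (Suc l) (Suc l) *\<^sub>R ut (Suc l) x + (\<Sum>i = l - min m l..l. \<alpha> (Suc l) i *\<^sub>R u i x) = u (Suc l) x"
      by (rule eventually_mono) (rule sym)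
    ultimately show ?thesis unfolding Suc by (rule V_cong)
  qed
qed

text \<open>
  The fields of a step are indexed as the coefficients are: \<open>w\<close> agrees with \<open>u\<close> up to \<open>k\<close>, and \<open>w (Suc k)\<close>
  is the Picard image of \<open>u k\<close>. There are \<open>N\<close> of them.
\<close>

lemma NGMRES_residual:
  fixes \<nu> M \<kappa> abar :: real and m :: nat
  defines "N \<equiv> real (m + 2)"
  assumes "\<nu> > 0" "\<kappa> < 1" "f \<in> Hm1 \<Omega>" "convection_constant \<Omega> M" "\<kappa> = M / \<nu>\<^sup>2 * Hm1_norm \<Omega> f"
    and ng: "NGMRES \<Omega> \<nu> f m u ut \<alpha>"
    and bound: "\<forall>k. \<forall>j\<in>{k - min m k..Suc k}. \<bar>\<alpha> (Suc k) j\<bar> \<le> abar"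
    and k: "k \<ge> m"
  shows "Vdual_norm \<Omega> (residual \<Omega> \<nu> f (u (Suc k)))
      \<le> Vdual_norm \<Omega> (combined_residual \<Omega> \<nu> f m u ut k (\<alpha> (Suc k)))
        + N * abar * M * ((1 + N * abar) * (2 / (\<nu> * (1 - \<kappa>))))\<^sup>2 * N
          * (\<Sum>i = k - m..k. (Vdual_norm \<Omega> (residual \<Omega> \<nu> f (u i)))\<^sup>2)"
    and "Vdual_norm \<Omega> (residual \<Omega> \<nu> f (ut (Suc k))) \<le> \<kappa> * Vdual_norm \<Omega> (residual \<Omega> \<nu> f (u k))"
    and "Vdual_norm \<Omega> (residual \<Omega> \<nu> f (ut (Suc k))) \<ge> 0"
    and "Vdual_norm \<Omega> (combined_residual \<Omega> \<nu> f m u ut k (\<alpha> (Suc k))) \<ge> 0"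
proof -
  interpret P: picard_setting "V_space \<Omega>" "grad_inner \<Omega>" "convection_form \<Omega>" f "Vdual_norm \<Omega>" \<nu> M "Hm1_norm \<Omega> f" \<kappa>
    by (rule picard_setting[OF assms(2-6)])
  have g: "P.g v = residual \<Omega> \<nu> f v" for v by (simp add: P.g_def residual_def fun_eq_iff)
  have pic: "P.picard (u i) (ut (Suc i))" for i
    using ng by (simp add: NGMRES_def is_picard_def P.picard_def)
  have uV: "u i \<in> V_space \<Omega>" for i by (rule NGMRES_in_V[OF ng])
  define J where "J = {k - m..k}"
  define w where "w i = (if i = Suc k then ut (Suc k) else u i)" for i
  have J: "finite J" "k \<in> J" "Suc k \<notin> J" by (auto simp: J_def)
  have ins: "insert (Suc k) J = {k - min m k..Suc k}"
    using k by (auto simp: J_def min_def)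
  have wV: "w i \<in> V_space \<Omega>" if "i \<in> insert (Suc k) J" for i
    using uV P.picard_closed[OF pic] by (simp add: w_def)
  have wJ: "w i = u i" if "i \<in> J" for i using that J(3) by (auto simp: w_def)
  define U where "U = (\<lambda>x. \<Sum>i\<in>insert (Suc k) J. \<alpha> (Suc k) i *\<^sub>R w i x)"
  have U_sum: "U x = \<alpha> (Suc k) (Suc k) *\<^sub>R ut (Suc k) x + (\<Sum>i = k - min m k..k. \<alpha> (Suc k) i *\<^sub>R u i x)" for x
  proof -
    have "(\<Sum>i\<in>J. \<alpha> (Suc k) i *\<^sub>R w i x) = (\<Sum>i = k - min m k..k. \<alpha> (Suc k) i *\<^sub>R u i x)"
      by (rule sum.cong) (use k wJ in \<open>auto simp: J_def min_def\<close>)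
    then show ?thesis using J by (simp add: U_def) (simp add: w_def)
  qed
  have comb: "combined_residual \<Omega> \<nu> f m u ut k (\<alpha> (Suc k)) = (\<lambda>z. \<Sum>i\<in>insert (Suc k) J. \<alpha> (Suc k) i * P.g (w i) z)"
  proof
    fix z
    have "(\<Sum>i\<in>J. \<alpha> (Suc k) i * P.g (w i) z) = (\<Sum>i = k - min m k..k. \<alpha> (Suc k) i * residual \<Omega> \<nu> f (u i) z)"
      by (rule sum.cong) (use k wJ in \<open>auto simp: J_def min_def g\<close>)
    then show "combined_residual \<Omega> \<nu> f m u ut k (\<alpha> (Suc k)) z = (\<Sum>i\<in>insert (Suc k) J. \<alpha> (Suc k) i * P.g (w i) z)"
      using J by (simp add: combined_residual_def) (simp add: w_def g)
  qed
  have "residual \<Omega> \<nu> f (u (Suc k)) = residual \<Omega> \<nu> f U"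
    by (rule residual_cong) (use ng in \<open>simp add: U_sum NGMRES_def\<close>)
  moreover have "card (insert (Suc k) J) = m + 2" using k J by (simp add: J_def)
  moreover have "Vdual_norm \<Omega> (P.g U) \<le> Vdual_norm \<Omega> (\<lambda>z. \<Sum>i\<in>insert (Suc k) J. \<alpha> (Suc k) i * P.g (w i) z)
    + N * abar * M * ((1 + N * abar) * (2 / (\<nu> * (1 - \<kappa>))))\<^sup>2 * N * (\<Sum>i\<in>J. (Vdual_norm \<Omega> (P.g (w i)))\<^sup>2)"
  proof (rule P.ngmres_step[OF J _ _ _ _ _ U_def])
    show "w i \<in> V_space \<Omega>" if "i \<in> J" for i using wV that by simp
    show "P.picard (w i) (ut (Suc i))" if "i \<in> J" for i using pic wJ[OF that] by simp
    show "w (Suc k) = ut (Suc k)" by (simp add: w_def)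
    show "sum (\<alpha> (Suc k)) (insert (Suc k) J) = 1" using ng by (simp add: NGMRES_def ins)
    show "\<bar>\<alpha> (Suc k) i\<bar> \<le> abar" if "i \<in> insert (Suc k) J" for i using bound that by (simp add: ins)
    show "N = real (card (insert (Suc k) J))" using calculation(2) by (simp add: N_def)
  qed
  moreover have "(\<Sum>i\<in>J. (Vdual_norm \<Omega> (P.g (w i)))\<^sup>2) = (\<Sum>i = k - m..k. (Vdual_norm \<Omega> (residual \<Omega> \<nu> f (u i)))\<^sup>2)"
    by (rule sum.cong) (auto simp: J_def wJ g)
  ultimately show "Vdual_norm \<Omega> (residual \<Omega> \<nu> f (u (Suc k)))
      \<le> Vdual_norm \<Omega> (combined_residual \<Omega> \<nu> f m u ut k (\<alpha> (Suc k)))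
        + N * abar * M * ((1 + N * abar) * (2 / (\<nu> * (1 - \<kappa>))))\<^sup>2 * N
          * (\<Sum>i = k - m..k. (Vdual_norm \<Omega> (residual \<Omega> \<nu> f (u i)))\<^sup>2)"
    unfolding comb by (simp only: g)
  show "Vdual_norm \<Omega> (residual \<Omega> \<nu> f (ut (Suc k))) \<le> \<kappa> * Vdual_norm \<Omega> (residual \<Omega> \<nu> f (u k))"
    using P.residual_picard[OF uV pic] by (simp only: g)
  show "Vdual_norm \<Omega> (residual \<Omega> \<nu> f (ut (Suc k))) \<ge> 0"
    using P.D_g_nonneg[OF P.picard_closed[OF pic]] by (simp only: g)
  show "Vdual_norm \<Omega> (combined_residual \<Omega> \<nu> f m u ut k (\<alpha> (Suc k))) \<ge> 0"
    unfolding comb by (rule P.combination_nonneg[OF wV])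
qed

end

theorem theorem3p6:
  fixes \<nu> M \<kappa> abar :: real and m :: nat
  assumes "CARD('n::finite) = 2 \<or> CARD('n) = 3"
    and "\<nu> > 0" and "\<kappa> < 1" and "m \<ge> 1"
  shows "\<exists>C\<ge>0. \<forall>(\<Omega> :: (real ^ 'n) set) f u ut \<alpha>.
    open \<Omega> \<and> bounded \<Omega> \<and> connected \<Omega> \<and> \<Omega> \<noteq> {} \<and>
    f \<in> Hm1 \<Omega> \<and> convection_constant \<Omega> M \<and> \<kappa> = M / \<nu>\<^sup>2 * Hm1_norm \<Omega> f \<and>
    NGMRES \<Omega> \<nu> f m u ut \<alpha> \<and>
    (\<forall>k. \<forall>j\<in>{k - min m k..Suc k}. \<bar>\<alpha> (Suc k) j\<bar> \<le> abar) \<longrightarrow>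
    (\<forall>k\<ge>m.
      let g = residual \<Omega> \<nu> f;
          comb = Vdual_norm \<Omega> (combined_residual \<Omega> \<nu> f m u ut k (\<alpha> (Suc k)));
          \<theta> = comb / Vdual_norm \<Omega> (g (u k));
          \<gamma> = comb / Vdual_norm \<Omega> (g (ut (Suc k)));
          R = (\<Sum>i = k - m..k. (Vdual_norm \<Omega> (g (u i)))\<^sup>2)
      in (Vdual_norm \<Omega> (g (u k)) \<noteq> 0 \<longrightarrow>
            Vdual_norm \<Omega> (g (u (Suc k))) \<le> \<theta> * Vdual_norm \<Omega> (g (u k)) + C * R) \<and>
         (Vdual_norm \<Omega> (g (ut (Suc k))) \<noteq> 0 \<longrightarrow>
            Vdual_norm \<Omega> (g (u (Suc k))) \<le> \<gamma> * \<kappa> * Vdual_norm \<Omega> (g (u k)) + C * R))"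
proof -
  define N where "N = real (m + 2)"
  define C where "C = N * abar * M * ((1 + N * abar) * (2 / (\<nu> * (1 - \<kappa>))))\<^sup>2 * N"
  show ?thesis
  proof (intro exI[of _ "\<bar>C\<bar>"] conjI allI impI abs_ge_zero, elim conjE)
    fix \<Omega> :: "(real ^ 'n) set" and f u ut \<alpha> and k :: nat
    assume \<Omega>: "open \<Omega>" "bounded \<Omega>" "\<Omega> \<noteq> {}"
      and f: "f \<in> Hm1 \<Omega>" "convection_constant \<Omega> M" "\<kappa> = M / \<nu>\<^sup>2 * Hm1_norm \<Omega> f"
      and ng: "NGMRES \<Omega> \<nu> f m u ut \<alpha>"
      and bound: "\<forall>k. \<forall>j\<in>{k - min m k..Suc k}. \<bar>\<alpha> (Suc k) j\<bar> \<le> abar" and k: "m \<le> k"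
    interpret flow_domain \<Omega> by unfold_locales (use \<Omega> assms(1) in auto)
    let ?D = "\<lambda>v. Vdual_norm \<Omega> (residual \<Omega> \<nu> f v)"
    define comb where "comb = Vdual_norm \<Omega> (combined_residual \<Omega> \<nu> f m u ut k (\<alpha> (Suc k)))"
    define R where "R = (\<Sum>i = k - m..k. (?D (u i))\<^sup>2)"
    note est = NGMRES_residual[OF assms(2,3) f ng bound k, folded N_def, folded C_def comb_def R_def]
    have "C * R \<le> \<bar>C\<bar> * R"
      by (rule mult_right_mono) (auto simp: R_def intro: sum_nonneg)
    then have main: "?D (u (Suc k)) \<le> comb + \<bar>C\<bar> * R" using est(1) by linarith
    have "?D (u (Suc k)) \<le> comb / ?D (u k) * ?D (u k) + \<bar>C\<bar> * R" if "?D (u k) \<noteq> 0"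
      using main that by simp
    moreover have "?D (u (Suc k)) \<le> comb / ?D (ut (Suc k)) * \<kappa> * ?D (u k) + \<bar>C\<bar> * R" if ne: "?D (ut (Suc k)) \<noteq> 0"
    proof -
      have "comb = comb / ?D (ut (Suc k)) * ?D (ut (Suc k))" using ne by simp
      also have "\<dots> \<le> comb / ?D (ut (Suc k)) * (\<kappa> * ?D (u k))"
        by (intro mult_left_mono est(2) divide_nonneg_nonneg est(3,4))
      finally show ?thesis using main by (simp add: mult.assoc)
    qed
    ultimately show "let g = residual \<Omega> \<nu> f;
          comb = Vdual_norm \<Omega> (combined_residual \<Omega> \<nu> f m u ut k (\<alpha> (Suc k)));
          \<theta> = comb / Vdual_norm \<Omega> (g (u k));
          \<gamma> = comb / Vdual_norm \<Omega> (g (ut (Suc k)));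
          R = (\<Sum>i = k - m..k. (Vdual_norm \<Omega> (g (u i)))\<^sup>2)
      in (Vdual_norm \<Omega> (g (u k)) \<noteq> 0 \<longrightarrow>
            Vdual_norm \<Omega> (g (u (Suc k))) \<le> \<theta> * Vdual_norm \<Omega> (g (u k)) + \<bar>C\<bar> * R) \<and>
         (Vdual_norm \<Omega> (g (ut (Suc k))) \<noteq> 0 \<longrightarrow>
            Vdual_norm \<Omega> (g (u (Suc k))) \<le> \<gamma> * \<kappa> * Vdual_norm \<Omega> (g (u k)) + \<bar>C\<bar> * R)"
      unfolding Let_def comb_def R_def by blast
  qed
qed

end
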